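(* Let $\Sigma$ be any $(\mathbf d,\mathbf z)$-cluster pattern in a semifield $\mathbb P$ with initial seed $(\mathbf x,\mathbf y,B)$, $B=(b_{ij})$ (with $\mathbf y\in\mathbb P^n$ and $\mathbf z$ valued in $\mathbb P$), and cluster variables $x^t_i\in\mathcal F$. Let $G^t=(g^t_{ij})$ and $F^t_i$ be the $G$-matrices and $F$-polynomials of the $(\mathbf d,\mathbf z)$-cluster pattern with principal coefficients having the same initial exchange matrix $B$ and the same $\mathbf d$. Put $\hat y_j=y_j\prod_{k=1}^nx_k^{b_{kj}}\in\mathcal F$. Then for all $t$ and $i$, $$x^t_i=\Bigl(\prod_{j=1}^nx_j^{g^t_{ji}}\Bigr)\frac{F^t_i|_{\mathcal F}(\hat{\mathbf y},\mathbf z)}{F^t_i|_{\mathbb P}(\mathbf y,\mathbf z)}.$$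
   Context: All matrices integer and $[a]_+=\max(a,0)$. A semifield $\mathbb P$ is an abelian multiplicative group with a commutative associative $\oplus$ over which multiplication distributes; $\mathbb Z\mathbb P$ its group ring, $\mathbb Q\mathbb P$ its fraction field, $\mathcal F=\mathbb Q\mathbb P(w_1,\dots,w_n)$. A seed in $\mathbb P$ is $(\mathbf x,\mathbf y,B)$ with $B=(b_{ij})$ skew-symmetrizable $n\times n$, $\mathbf x\in\mathcal F^n$, $\mathbf y\in\mathbb P^n$. Mutation data: positive integers $\mathbf d$ and $z_{i,s}\in\mathbb P$ ($1\le s\le d_i-1$) with $z_{i,s}=z_{i,d_i-s}$, $z_{i,0}=z_{i,d_i}=1$. The $(\mathbf d,\mathbf z)$-mutation $\mu_k(\mathbf{x},\mathbf{y},B)=(\mathbf{x}',\mathbf{y}',B')$: $b'_{ij}=-b_{ij}$ if $i=k$ or $j=k$, else $b'_{ij}=b_{ij}+d_k([-b_{ik}]_+b_{kj}+b_{ik}[b_{kj}]_+)$; $y'_k=y_k^{-1}$, $y'_i=y_i(y_k^{[\varepsilon b_{ki}]_+})^{d_k}(\bigoplus_{s=0}^{d_k}z_{k,s}y_k^{\varepsilon s})^{-b_{ki}}$ ($i\ne k$); $x'_i=x_i$ ($i\ne k$), $x'_k=x_k^{-1}(\prod_jx_j^{[-\varepsilon b_{jk}]_+})^{d_k}\frac{\sum_{s=0}^{d_k}z_{k,s}\hat y_k^{\varepsilon s}}{\bigoplus_{s=0}^{d_k}z_{k,s}y_k^{\varepsilon s}}$, $\hat y_i=y_i\prod_jx_j^{b_{ji}}$,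 $\varepsilon=\pm1$. $\mathbb T_n$ is the $n$-regular tree with edges labeled $1,\dots,n$, distinct labels at each vertex; a $(\mathbf d,\mathbf z)$-cluster pattern assigns seeds $(\mathbf x_t,\mathbf y_t,B_t)$, $\mathbf x_t=(x^t_i)$, to vertices related by $\mu_k$ along edges labeled $k$, initial seed at a fixed $t_0$. Principal coefficients: for formal variables $y_1,\dots,y_n$, $z_{i,s}$ ($z_{i,s}=z_{i,d_i-s}$), $\mathrm{Trop}(\mathbf y,\mathbf z)$ is the free abelian group they generate with $\oplus$ the componentwise minimum of exponents; the pattern with principal coefficients lives in $\mathrm{Trop}(\mathbf y,\mathbf z)$ with initial seed $(\mathbf x,\mathbf y,B)$. Its cluster variables are $X$-functions $X^t_i\in\mathbb Z[x_1^{\pm1},\dots,x_n^{\pm1},\mathbf y,\mathbf z]$, homogeneous for the grading $\deg x_i=\mathbf e_i$, $\deg y_j=-\sum_ib_{ij}\mathbf e_i$, $\deg z_{i,s}=0$; $\deg X^t_j=\sum_ig^t_{ij}\mathbf e_i$ defines $G^t=(g^t_{ij})$; and $F^t_i(\mathbf y,\mathbf z)=X^t_i(1,\dots,1,\mathbf y,\mathbf z)\in\mathbb Z[\mathbf y,\mathbf z]$. Each $F^t_i$ is a subtraction-free rational expression in $\mathbf y,\mathbf z$; $F^t_i|_{\mathbb P}(\mathbf y,\mathbf z)$ denotes its evaluation in $\mathbb P$ ($+$ replaced by $\oplus$, variables replaced by the given elements of $\mathbb P$), and $F^t_i|_{\mathcal F}(\hat{\mathbf y},\mathbf z)$ its evaluation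 in the field $\mathcal F$ at $y_j\mapsto\hat y_j$, $z_{i,s}\mapsto z_{i,s}$. *)

theory Defs
  imports Complex_Main "HOL-Library.Poly_Mapping" "HOL-Library.Product_Lexorder"
    "HOL-Computational_Algebra.Fraction_Field"
begin

record 'p semifield_ops =
  smul :: "'p \<Rightarrow> 'p \<Rightarrow> 'p"
  sone :: 'p
  sinv :: "'p \<Rightarrow> 'p"
  splus :: "'p \<Rightarrow> 'p \<Rightarrow> 'p"

definition semifield :: "'p semifield_ops \<Rightarrow> bool" where
  "semifield S \<longleftrightarrow>
     (\<forall>a b c. smul S (smul S a b) c = smul S a (smul S b c)) \<and>
     (\<forall>a b. smul S a b = smul S b a) \<and>
     (\<forall>a. smul S (sone S) a = a) \<and>
     (\<forall>a. smul S (sinv S a) a = sone S) \<and>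
     (\<forall>a b c. splus S (splus S a b) c = splus S a (splus S b c)) \<and>
     (\<forall>a b. splus S a b = splus S b a) \<and>
     (\<forall>a b c. smul S a (splus S b c) = splus S (smul S a b) (smul S a c))"

definition spow :: "'p semifield_ops \<Rightarrow> 'p \<Rightarrow> nat \<Rightarrow> 'p" where
  "spow S a k = (smul S a ^^ k) (sone S)"

definition spowi :: "'p semifield_ops \<Rightarrow> 'p \<Rightarrow> int \<Rightarrow> 'p" where
  "spowi S a k = (if 0 \<le> k then spow S a (nat k) else sinv S (spow S a (nat (- k))))"

primrec sbig :: "'p semifield_ops \<Rightarrow> (nat \<Rightarrow> 'p) \<Rightarrow> nat \<Rightarrow> 'p" where
  "sbig S f 0 = f 0"
| "sbig S f (Suc m) = splus S (sbig S f m) (f (Suc m))"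

text \<open>The embedding of the semifield P into the ambient field F (P \<subseteq> ZP \<subseteq> QP \<subseteq> F).\<close>
definition semifield_hom :: "'p semifield_ops \<Rightarrow> ('p \<Rightarrow> 'f::field) \<Rightarrow> bool" where
  "semifield_hom S emb \<longleftrightarrow> (\<forall>a b. emb (smul S a b) = emb a * emb b) \<and> emb (sone S) = 1"

definition skew_symmetrizable :: "nat \<Rightarrow> (nat \<Rightarrow> nat \<Rightarrow> int) \<Rightarrow> bool" where
  "skew_symmetrizable n B \<longleftrightarrow>
     (\<exists>D::nat \<Rightarrow> int. (\<forall>i<n. 0 < D i) \<and> (\<forall>i<n. \<forall>j<n. D i * B i j = - (D j * B j i)))"

definition mutation_data :: "'p semifield_ops \<Rightarrow> nat \<Rightarrow> (nat \<Rightarrow> nat) \<Rightarrow> (nat \<Rightarrow> nat \<Rightarrow> 'p) \<Rightarrow> bool" where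
  "mutation_data S n d z \<longleftrightarrow>
     (\<forall>i<n. 0 < d i \<and> z i 0 = sone S \<and> z i (d i) = sone S \<and>
            (\<forall>s. 1 \<le> s \<and> s \<le> d i - 1 \<longrightarrow> z i s = z i (d i - s)))"

definition pos :: "int \<Rightarrow> int" where "pos a = max a 0"

type_synonym ('f, 'p) seed = "(nat \<Rightarrow> 'f) \<times> (nat \<Rightarrow> 'p) \<times> (nat \<Rightarrow> nat \<Rightarrow> int)"

definition mut_B :: "(nat \<Rightarrow> nat) \<Rightarrow> nat \<Rightarrow> (nat \<Rightarrow> nat \<Rightarrow> int) \<Rightarrow> nat \<Rightarrow> nat \<Rightarrow> int" where
  "mut_B d k B i j =
     (if i = k \<or> j = k then - B i j
      else B i j + int (d k) * (pos (- B i k) * B k j + B i k * pos (B k j)))"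

text \<open>Mutation with the sign choice \<open>\<epsilon> = 1\<close> (the result does not depend on \<open>\<epsilon>\<close>).\<close>
definition mut_y :: "'p semifield_ops \<Rightarrow> (nat \<Rightarrow> nat) \<Rightarrow> (nat \<Rightarrow> nat \<Rightarrow> 'p) \<Rightarrow> nat
    \<Rightarrow> (nat \<Rightarrow> 'p) \<Rightarrow> (nat \<Rightarrow> nat \<Rightarrow> int) \<Rightarrow> nat \<Rightarrow> 'p" where
  "mut_y S d z k y B i =
     (if i = k then sinv S (y k)
      else smul S (y i)
             (smul S (spowi S (y k) (int (d k) * pos (B k i)))
                     (spowi S (sbig S (\<lambda>s. smul S (z k s) (spow S (y k) s)) (d k)) (- B k i))))"

definition mut_x :: "'p semifield_ops \<Rightarrow> ('p \<Rightarrow> 'f::field) \<Rightarrow> nat \<Rightarrow> (nat \<Rightarrow> nat) \<Rightarrow> (nat \<Rightarrow> nat \<Rightarrow> 'p)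
    \<Rightarrow> nat \<Rightarrow> (nat \<Rightarrow> 'f) \<Rightarrow> (nat \<Rightarrow> 'p) \<Rightarrow> (nat \<Rightarrow> nat \<Rightarrow> int) \<Rightarrow> nat \<Rightarrow> 'f" where
  "mut_x S emb n d z k x y B i =
     (if i \<noteq> k then x i
      else
        (let yhat = emb (y k) * (\<Prod>j<n. x j powi B j k) in
         inverse (x k) * (\<Prod>j<n. x j powi pos (- B j k)) ^ d k
         * (\<Sum>s\<le>d k. emb (z k s) * yhat ^ s)
         / emb (sbig S (\<lambda>s. smul S (z k s) (spow S (y k) s)) (d k))))"

definition mutate :: "'p semifield_ops \<Rightarrow> ('p \<Rightarrow> 'f::field) \<Rightarrow> nat \<Rightarrow> (nat \<Rightarrow> nat) \<Rightarrow> (nat \<Rightarrow> nat \<Rightarrow> 'p)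
    \<Rightarrow> nat \<Rightarrow> ('f, 'p) seed \<Rightarrow> ('f, 'p) seed" where
  "mutate S emb n d z k sd =
     (case sd of (x, y, B) \<Rightarrow> (mut_x S emb n d z k x y B, mut_y S d z k y B, mut_B d k B))"

text \<open>Vertices of the n-regular tree \<open>\<T>\<^sub>n\<close>: reduced words of edge labels read from \<open>t\<^sub>0\<close>.\<close>
definition reduced_word :: "nat \<Rightarrow> nat list \<Rightarrow> bool" where
  "reduced_word n w \<longleftrightarrow> (\<forall>k\<in>set w. k < n) \<and> (\<forall>i. Suc i < length w \<longrightarrow> w ! i \<noteq> w ! Suc i)"

definition seed_at :: "'p semifield_ops \<Rightarrow> ('p \<Rightarrow> 'f::field) \<Rightarrow> nat \<Rightarrow> (nat \<Rightarrow> nat) \<Rightarrow> (nat \<Rightarrow> nat \<Rightarrow> 'p)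
    \<Rightarrow> ('f, 'p) seed \<Rightarrow> nat list \<Rightarrow> ('f, 'p) seed" where
  "seed_at S emb n d z s0 w = foldl (\<lambda>sd k. mutate S emb n d z k sd) s0 w"

definition cvar :: "'p semifield_ops \<Rightarrow> ('p \<Rightarrow> 'f::field) \<Rightarrow> nat \<Rightarrow> (nat \<Rightarrow> nat) \<Rightarrow> (nat \<Rightarrow> nat \<Rightarrow> 'p)
    \<Rightarrow> ('f, 'p) seed \<Rightarrow> nat list \<Rightarrow> nat \<Rightarrow> 'f" where
  "cvar S emb n d z s0 w i = fst (seed_at S emb n d z s0 w) i"

text \<open>Formal variables, encoded as triples: x_i = (0,i,0), y_i = (1,i,0),
  z_{i,s} = (2,i,min s (d_i - s)) (so that z_{i,s} = z_{i,d_i-s}).\<close>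
type_synonym pvar = "nat \<times> nat \<times> nat"
type_synonym tmon = "pvar \<Rightarrow>\<^sub>0 int"           \<comment> \<open>Laurent monomials = elements of Trop(y,z)\<close>
type_synonym lpoly = "tmon \<Rightarrow>\<^sub>0 int"
type_synonym pfield = "lpoly fract"

definition vx :: "nat \<Rightarrow> pvar" where "vx i = (0, i, 0)"
definition vy :: "nat \<Rightarrow> pvar" where "vy i = (1, i, 0)"
definition vz :: "(nat \<Rightarrow> nat) \<Rightarrow> nat \<Rightarrow> nat \<Rightarrow> pvar" where "vz d i s = (2, i, min s (d i - s))"

definition tmin :: "tmon \<Rightarrow> tmon \<Rightarrow> tmon" where
  "tmin a b = Abs_poly_mapping (\<lambda>v. min (Poly_Mapping.lookup a v) (Poly_Mapping.lookup b v))"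

definition trop :: "tmon semifield_ops" where
  "trop = \<lparr>smul = (+), sone = 0, sinv = uminus, splus = tmin\<rparr>"

definition emb_trop :: "tmon \<Rightarrow> pfield" where
  "emb_trop m = Fract (Poly_Mapping.single m 1) 1"

definition gen :: "pvar \<Rightarrow> pfield" where
  "gen v = Fract (Poly_Mapping.single (Poly_Mapping.single v 1) 1) 1"

definition ztrop :: "(nat \<Rightarrow> nat) \<Rightarrow> nat \<Rightarrow> nat \<Rightarrow> tmon" where
  "ztrop d i s = (if s = 0 \<or> s = d i then 0 else Poly_Mapping.single (vz d i s) 1)"

definition princ_seed :: "(nat \<Rightarrow> nat \<Rightarrow> int) \<Rightarrow> (pfield, tmon) seed" where
  "princ_seed B = (\<lambda>i. gen (vx i), \<lambda>i. Poly_Mapping.single (vy i) 1, B)"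

definition Xfun :: "nat \<Rightarrow> (nat \<Rightarrow> nat) \<Rightarrow> (nat \<Rightarrow> nat \<Rightarrow> int) \<Rightarrow> nat list \<Rightarrow> nat \<Rightarrow> pfield" where
  "Xfun n d B w i = cvar trop emb_trop n d (ztrop d) (princ_seed B) w i"

definition Xpoly :: "nat \<Rightarrow> (nat \<Rightarrow> nat) \<Rightarrow> (nat \<Rightarrow> nat \<Rightarrow> int) \<Rightarrow> nat list \<Rightarrow> nat \<Rightarrow> lpoly" where
  "Xpoly n d B w i = (SOME p. Fract p 1 = Xfun n d B w i)"

text \<open>Degree of a monomial for the grading deg x_i = e_i, deg y_j = - sum_i b_ij e_i, deg z = 0
  (j-th component).\<close>
definition mdeg :: "nat \<Rightarrow> (nat \<Rightarrow> nat \<Rightarrow> int) \<Rightarrow> tmon \<Rightarrow> nat \<Rightarrow> int" where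
  "mdeg n B m j = Poly_Mapping.lookup m (vx j) - (\<Sum>l<n. B j l * Poly_Mapping.lookup m (vy l))"

text \<open>G-matrix entry g^t_{ji}: j-th component of deg X^t_i (X^t_i is homogeneous).\<close>
definition gmat :: "nat \<Rightarrow> (nat \<Rightarrow> nat) \<Rightarrow> (nat \<Rightarrow> nat \<Rightarrow> int) \<Rightarrow> nat list \<Rightarrow> nat \<Rightarrow> nat \<Rightarrow> int" where
  "gmat n d B w j i = mdeg n B (SOME m. m \<in> Poly_Mapping.keys (Xpoly n d B w i)) j"

definition evalL :: "lpoly \<Rightarrow> (pvar \<Rightarrow> 'f::field) \<Rightarrow> 'f" where
  "evalL p val = (\<Sum>m\<in>Poly_Mapping.keys p. of_int (Poly_Mapping.lookup p m) * (\<Prod>v\<in>Poly_Mapping.keys m. val v powi Poly_Mapping.lookup m v))"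

definition Fpoly :: "nat \<Rightarrow> (nat \<Rightarrow> nat) \<Rightarrow> (nat \<Rightarrow> nat \<Rightarrow> int) \<Rightarrow> nat list \<Rightarrow> nat \<Rightarrow> pfield" where
  "Fpoly n d B w i = evalL (Xpoly n d B w i) (\<lambda>v. if fst v = 0 then 1 else gen v)"

datatype 'v sfexpr = SFVar 'v | SFOne | SFAdd "'v sfexpr" "'v sfexpr"
  | SFMul "'v sfexpr" "'v sfexpr" | SFDiv "'v sfexpr" "'v sfexpr"

primrec sf_vars :: "'v sfexpr \<Rightarrow> 'v set" where
  "sf_vars (SFVar v) = {v}" | "sf_vars SFOne = {}"
| "sf_vars (SFAdd a b) = sf_vars a \<union> sf_vars b"
| "sf_vars (SFMul a b) = sf_vars a \<union> sf_vars b"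
| "sf_vars (SFDiv a b) = sf_vars a \<union> sf_vars b"

primrec sf_eval_field :: "('v \<Rightarrow> 'f::field) \<Rightarrow> 'v sfexpr \<Rightarrow> 'f" where
  "sf_eval_field val (SFVar v) = val v" | "sf_eval_field val SFOne = 1"
| "sf_eval_field val (SFAdd a b) = sf_eval_field val a + sf_eval_field val b"
| "sf_eval_field val (SFMul a b) = sf_eval_field val a * sf_eval_field val b"
| "sf_eval_field val (SFDiv a b) = sf_eval_field val a / sf_eval_field val b"

primrec sf_eval_sf :: "'p semifield_ops \<Rightarrow> ('v \<Rightarrow> 'p) \<Rightarrow> 'v sfexpr \<Rightarrow> 'p" where
  "sf_eval_sf S val (SFVar v) = val v" | "sf_eval_sf S val SFOne = sone S"
| "sf_eval_sf S val (SFAdd a b) = splus S (sf_eval_sf S val a) (sf_eval_sf S val b)"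
| "sf_eval_sf S val (SFMul a b) = smul S (sf_eval_sf S val a) (sf_eval_sf S val b)"
| "sf_eval_sf S val (SFDiv a b) = smul S (sf_eval_sf S val a) (sinv S (sf_eval_sf S val b))"

definition Fexpr :: "nat \<Rightarrow> (nat \<Rightarrow> nat) \<Rightarrow> (nat \<Rightarrow> nat \<Rightarrow> int) \<Rightarrow> nat list \<Rightarrow> nat \<Rightarrow> pvar sfexpr" where
  "Fexpr n d B w i = (SOME e. sf_vars e \<subseteq> {v. fst v = 1 \<or> fst v = 2} \<and>
                             sf_eval_field gen e = Fpoly n d B w i)"

definition F_in_P :: "'p semifield_ops \<Rightarrow> nat \<Rightarrow> (nat \<Rightarrow> nat) \<Rightarrow> (nat \<Rightarrow> nat \<Rightarrow> int) \<Rightarrow> (nat \<Rightarrow> nat \<Rightarrow> 'p)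
    \<Rightarrow> (nat \<Rightarrow> 'p) \<Rightarrow> nat list \<Rightarrow> nat \<Rightarrow> 'p" where
  "F_in_P S n d B z y w i =
     sf_eval_sf S (\<lambda>(a, b, c). if a = 1 then y b else if a = 2 then z b c else sone S) (Fexpr n d B w i)"

definition yhat :: "('p \<Rightarrow> 'f::field) \<Rightarrow> nat \<Rightarrow> (nat \<Rightarrow> nat \<Rightarrow> int) \<Rightarrow> (nat \<Rightarrow> 'f) \<Rightarrow> (nat \<Rightarrow> 'p) \<Rightarrow> nat \<Rightarrow> 'f" where
  "yhat emb n B x y j = emb (y j) * (\<Prod>k<n. x k powi B k j)"

definition F_in_F :: "('p \<Rightarrow> 'f::field) \<Rightarrow> nat \<Rightarrow> (nat \<Rightarrow> nat) \<Rightarrow> (nat \<Rightarrow> nat \<Rightarrow> int) \<Rightarrow> (nat \<Rightarrow> nat \<Rightarrow> 'p)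
    \<Rightarrow> (nat \<Rightarrow> 'f) \<Rightarrow> (nat \<Rightarrow> 'p) \<Rightarrow> nat list \<Rightarrow> nat \<Rightarrow> 'f" where
  "F_in_F emb n d B z x y w i =
     evalL (Xpoly n d B w i)
       (\<lambda>(a, b, c). if a = 1 then yhat emb n B x y b else if a = 2 then emb (z b c) else 1)"

end

(* Every seed is encoded by the exponent vectors of its y-hat monomials, so that mutation becomes
   arithmetic in a free abelian group of exponents.

   Laurent phenomenon. Induct on the length of the mutation path, for arbitrary initial seeds with
   linearly independent y-hat exponents. If the path starts with j, k, then a cluster variable X at
   its end is Laurent in the seeds reached by j and by j, k, j, because both are closer to the end.
   Clearing denominators writes X with denominator a power of p, and also with denominator a power
   of q, where p is the first exchange polynomial up to a unit and q is the product of the two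
   cluster variables created by j, k, j. A degree argument shows that q is not a zero divisor
   modulo p, hence X is Laurent in the initial seed; no unique factorization is needed.

   Separation. The exchange relations with principal coefficients are identities between Laurent
   polynomials, hence survive every specialization of the variables. Specializing x to 1 exhibits
   the F-polynomials as subtraction-free expressions and gives the recursion of their values in P;
   a subtraction-free expression is a quotient of two multisets of monomials, so its value in a
   semifield depends only on the rational function. Specializing y and z to their values in the
   given pattern, one compares both recursions: x_i is the specialized X-function divided by the
   value of F_i in P, and y_i is the monomial e_i evaluated at these values. Homogeneity of the
   X-functions then splits off the monomial given by the g-vector. *)

theory Submission
  imports Defs "HOL-Library.Multiset"
begin

text \<open>What is known of the ambient field is that \<open>emb\<close> is multiplicative and that
  cluster variables do not vanish. Substituting into a rational function may therefore hit a zero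
  denominator, while a Laurent polynomial can be evaluated at every point with nonzero coordinates.
  This is why the exchange relations are wanted between Laurent polynomials, and the Laurent
  phenomenon has to come before separation. Linear independence handles commuting mutations. If b_jk
  is nonzero, the second exchange polynomial is a unit modulo the first. If b_jk = 0, no such
  reduction is available, and the two are told apart by a weight that vanishes on one y-hat exponent
  and not on the other. That weight must vanish on all z_{k,s}, so independence is asked of the
  coordinates other than z; with principal coefficients the y_l provide it. Mutation is allowed with
  any coefficient monomial, because the auxiliary seeds of the Laurent argument come from no
  semifield and because the reverse of a mutation carries a different monomial.\<close>

declare split_paired_All [simp del] split_paired_Ex [simp del]

section \<open>Evaluation of Laurent polynomials\<close>

text \<open>Monomials form the free abelian group on the formal variables, Laurent polynomials the
  free abelian group on the monomials. \<open>frag_of\<close> is the generator at both levels, so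
  \<open>frag_of (frag_of v)\<close> is the variable \<open>v\<close> as a polynomial.\<close>

definition evalM :: "(pvar \<Rightarrow> 'f::field) \<Rightarrow> tmon \<Rightarrow> 'f" where
  "evalM V m = (\<Prod>v\<in>Poly_Mapping.keys m. V v powi Poly_Mapping.lookup m v)"

abbreviation nz :: "('a \<Rightarrow> 'f::field) \<Rightarrow> bool" where
  "nz V \<equiv> \<forall>v. V v \<noteq> 0"

lemma evalM_superset:
  assumes "finite A" "Poly_Mapping.keys m \<subseteq> A"
  shows "evalM V m = (\<Prod>v\<in>A. V v powi Poly_Mapping.lookup m v)"
  unfolding evalM_def
  by (rule prod.mono_neutral_left) (use assms in \<open>auto simp: in_keys_iff\<close>)

lemma evalM_zero [simp]: "evalM V 0 = 1"
  by (simp add: evalM_def)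

lemma evalM_of [simp]: "evalM V (frag_of v) = V v"
  by (simp add: evalM_def)

lemma evalM_add:
  assumes "nz V"
  shows "evalM V (a + b) = evalM V a * evalM V b"
proof -
  let ?A = "Poly_Mapping.keys a \<union> Poly_Mapping.keys b"
  have "evalM V (a + b) = (\<Prod>v\<in>?A. V v powi Poly_Mapping.lookup (a + b) v)"
    by (rule evalM_superset) (auto dest: subsetD[OF keys_add])
  also have "\<dots> = (\<Prod>v\<in>?A. V v powi Poly_Mapping.lookup a v) * (\<Prod>v\<in>?A. V v powi Poly_Mapping.lookup b v)"
    using assms by (simp add: lookup_add power_int_add prod.distrib)
  also have "\<dots> = evalM V a * evalM V b"
    by (simp add: evalM_superset[of ?A])
  finally show ?thesis .
qed

lemma evalM_nonzero [simp]: "nz V \<Longrightarrow> evalM V m \<noteq> 0"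
  by (simp add: evalM_def)

lemma evalM_uminus: "nz V \<Longrightarrow> evalM V (- a) = inverse (evalM V a)"
  by (metis add.right_inverse evalM_add evalM_zero inverse_unique)

lemma evalM_diff: "nz V \<Longrightarrow> evalM V (a - b) = evalM V a / evalM V b"
  by (metis diff_conv_add_uminus divide_inverse evalM_add evalM_uminus)

lemma evalM_cmul: "evalM V (frag_cmul c m) = evalM V m powi c"
proof -
  have "evalM V (frag_cmul c m) = (\<Prod>v\<in>Poly_Mapping.keys m. V v powi Poly_Mapping.lookup (frag_cmul c m) v)"
    by (rule evalM_superset) (auto simp: keys_cmul)
  also have "\<dots> = (\<Prod>v\<in>Poly_Mapping.keys m. (V v powi Poly_Mapping.lookup m v) powi c)"
    by (simp add: power_int_mult[symmetric] mult.commute)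
  also have "\<dots> = (\<Prod>v\<in>Poly_Mapping.keys m. V v powi Poly_Mapping.lookup m v) powi c"
    by (induction rule: finite_induct[OF finite_keys[of m]]) (auto simp: power_int_mult_distrib)
  finally show ?thesis by (simp add: evalM_def)
qed

lemma evalM_cong: "(\<And>v. v \<in> Poly_Mapping.keys m \<Longrightarrow> V v = W v) \<Longrightarrow> evalM V m = evalM W m"
  by (simp add: evalM_def)

lemma evalM_mult_left: "evalM (\<lambda>v. V v * W v) m = evalM V m * evalM W m"
  by (simp add: evalM_def power_int_mult_distrib prod.distrib)

lemma evalM_upd:
  assumes "nz V" "a \<noteq> 0"
  shows "evalM (V(v := a)) m = evalM V (m - frag_cmul (Poly_Mapping.lookup m v) (frag_of v)) * a powi Poly_Mapping.lookup m v"
proof -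
  let ?V = "V(v := a)" and ?r = "m - frag_cmul (Poly_Mapping.lookup m v) (frag_of v)"
  have nz: "nz ?V" using assms by auto
  have "evalM ?V m = evalM ?V (?r + frag_cmul (Poly_Mapping.lookup m v) (frag_of v))"
    by simp
  also have "\<dots> = evalM ?V ?r * a powi Poly_Mapping.lookup m v"
    by (subst evalM_add[OF nz]) (simp add: evalM_cmul)
  also have "evalM ?V ?r = evalM V ?r"
    by (rule evalM_cong) (auto simp: in_keys_iff lookup_minus)
  finally show ?thesis .
qed

lemma evalL_evalM: "evalL p V = (\<Sum>m\<in>Poly_Mapping.keys p. of_int (Poly_Mapping.lookup p m) * evalM V m)"
  by (simp add: evalL_def evalM_def)

lemma evalL_superset:
  assumes "finite A" "Poly_Mapping.keys p \<subseteq> A"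
  shows "evalL p V = (\<Sum>m\<in>A. of_int (Poly_Mapping.lookup p m) * evalM V m)"
  unfolding evalL_evalM
  by (rule sum.mono_neutral_left) (use assms in \<open>auto simp: in_keys_iff\<close>)

lemma evalL_zero [simp]: "evalL 0 V = 0"
  by (simp add: evalL_evalM)

lemma evalL_of [simp]: "evalL (frag_of m) V = evalM V m"
  by (simp add: evalL_evalM)

lemma evalL_one [simp]: "evalL 1 V = 1"
  using evalL_of[of 0 V] by (simp del: evalL_of)

lemma evalL_add [simp]: "evalL (p + q) V = evalL p V + evalL q V"
proof -
  let ?A = "Poly_Mapping.keys p \<union> Poly_Mapping.keys q"
  have "evalL (p + q) V = (\<Sum>m\<in>?A. of_int (Poly_Mapping.lookup (p + q) m) * evalM V m)"
    by (rule evalL_superset) (auto dest: subsetD[OF keys_add])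
  also have "\<dots> = evalL p V + evalL q V"
    by (simp add: lookup_add ring_distribs sum.distrib evalL_superset[of ?A])
  finally show ?thesis .
qed

lemma evalL_diff [simp]: "evalL (p - q) V = evalL p V - evalL q V"
  by (metis add_diff_cancel diff_add_cancel evalL_add)

lemma evalL_sum [simp]: "evalL (sum f A) V = (\<Sum>i\<in>A. evalL (f i) V)"
  by (induction A rule: infinite_finite_induct) auto

lemma frag_of_mult: "frag_of a * frag_of b = (frag_of (a + b) :: 'a::comm_monoid_add \<Rightarrow>\<^sub>0 int)"
  by (simp add: mult_single)

lemma lpoly_induct [case_names zero of diff]:
  assumes "P 0" "\<And>m. P (frag_of m)" "\<And>a b. P a \<Longrightarrow> P b \<Longrightarrow> P (a - b)"
  shows "P (p :: 'a \<Rightarrow>\<^sub>0 int)"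
  by (rule frag_induction[where S = UNIV]) (use assms in auto)

lemma evalL_mult [simp]:
  assumes "nz V"
  shows "evalL (p * q) V = evalL p V * evalL q V"
proof (induction p rule: lpoly_induct)
  case (of m)
  show ?case
    by (induction q rule: lpoly_induct)
      (auto simp: frag_of_mult evalM_add[OF assms] right_diff_distrib)
qed (auto simp: left_diff_distrib)

lemma evalL_power [simp]: "nz V \<Longrightarrow> evalL (p ^ k) V = evalL p V ^ k"
  by (induction k) auto

lemma evalL_prod [simp]: "nz V \<Longrightarrow> evalL (prod f A) V = (\<Prod>i\<in>A. evalL (f i) V)"
  by (induction A rule: infinite_finite_induct) auto

section \<open>Evaluation at the generic point: Laurent polynomials inside their fraction
  field\<close>

lemma gen_nonzero [simp]: "gen v \<noteq> 0"
  by (simp add: gen_def Zero_fract_def eq_fract)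

lemma evalM_gen: "evalM gen m = Fract (frag_of m) 1"
proof (induction m rule: lpoly_induct)
  case zero
  show ?case by (simp add: One_fract_def)
next
  case (of v)
  show ?case by (simp add: gen_def)
next
  case (diff a b)
  have "Fract (frag_of (a - b)) 1 * Fract (frag_of b) 1 = Fract (frag_of a) (1 :: lpoly)"
    by (simp add: frag_of_mult)
  moreover have "Fract (frag_of b) (1 :: lpoly) \<noteq> 0"
    by (simp add: Zero_fract_def eq_fract)
  ultimately show ?case
    by (simp add: evalM_diff diff eq_fract frag_of_mult)
qed

lemma evalL_gen: "evalL p gen = Fract p 1"
proof (induction p rule: lpoly_induct)
  case zero
  show ?case by (simp add: Zero_fract_def)
next
  case (of m)
  show ?case by (simp add: evalM_gen)
next
  case (diff a b)
  then show ?case by simp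
qed

lemma Fract_1_inject: "Fract p 1 = Fract q 1 \<longleftrightarrow> p = (q :: 'a::idom)"
  by (simp add: eq_fract)

section \<open>Homogeneous components and regular elements\<close>

definition hcomp :: "(tmon \<Rightarrow> int) \<Rightarrow> int \<Rightarrow> lpoly \<Rightarrow> lpoly" where
  "hcomp \<mu> a p = Poly_Mapping.mapp (\<lambda>m c. if \<mu> m = a then c else 0) p"

lemma lookup_hcomp: "Poly_Mapping.lookup (hcomp \<mu> a p) m = (if \<mu> m = a then Poly_Mapping.lookup p m else 0)"
  by (simp add: hcomp_def lookup_mapp when_def in_keys_iff)

lemma hcomp_zero [simp]: "hcomp \<mu> a 0 = 0"
  by (simp add: poly_mapping_eq_iff fun_eq_iff lookup_hcomp)

lemma hcomp_add: "hcomp \<mu> a (p + q) = hcomp \<mu> a p + hcomp \<mu> a q"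
  by (simp add: poly_mapping_eq_iff fun_eq_iff lookup_hcomp lookup_add)

lemma hcomp_diff: "hcomp \<mu> a (p - q) = hcomp \<mu> a p - hcomp \<mu> a q"
  by (simp add: poly_mapping_eq_iff fun_eq_iff lookup_hcomp lookup_minus)

lemma hcomp_of: "hcomp \<mu> a (frag_of m) = (if \<mu> m = a then frag_of m else 0)"
  by (rule poly_mapping_eqI) (auto simp: lookup_hcomp lookup_single when_def)

lemma hcomp_eq_0: "(\<And>m. m \<in> Poly_Mapping.keys p \<Longrightarrow> \<mu> m \<noteq> a) \<Longrightarrow> hcomp \<mu> a p = 0"
  by (auto simp add: poly_mapping_eq_iff fun_eq_iff lookup_hcomp in_keys_iff)

lemma hcomp_mult:
  assumes \<mu>: "\<And>a b. \<mu> (a + b) = \<mu> a + \<mu> b"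
    and P: "\<And>m. m \<in> Poly_Mapping.keys P \<Longrightarrow> \<mu> m = c"
  shows "hcomp \<mu> a (P * q) = P * hcomp \<mu> (a - c) q"
proof -
  have "Poly_Mapping.keys P \<subseteq> {m. \<mu> m = c}" using P by auto
  then show ?thesis
  proof (induction P rule: frag_induction)
    case (one m)
    show ?case
      by (induction q rule: lpoly_induct)
        (use one in \<open>auto simp: frag_of_mult hcomp_of \<mu> hcomp_diff right_diff_distrib\<close>)
  qed (auto simp: hcomp_diff left_diff_distrib)
qed

lemma frag_of_dvd_iff: "P dvd frag_of m * f \<longleftrightarrow> P dvd f" for f :: lpoly
proof
  assume "P dvd frag_of m * f"
  then have "P dvd frag_of (- m) * (frag_of m * f)" by (rule dvd_mult)
  then show "P dvd f" by (simp add: mult.assoc[symmetric] frag_of_mult)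
qed simp

text \<open>As \<open>P\<close> is homogeneous, the components of \<open>P * Q\<close> are
  \<open>P\<close> times those of \<open>Q\<close>; a component of \<open>Q\<close> of another
  weight would be killed by \<open>P\<close>, which is impossible in a domain.\<close>

lemma homogeneous_factor:
  fixes \<mu> :: "tmon \<Rightarrow> int" and P Q :: lpoly
  assumes \<mu>: "\<And>a b. \<mu> (a + b) = \<mu> a + \<mu> b"
    and P: "\<And>m. m \<in> Poly_Mapping.keys P \<Longrightarrow> \<mu> m = c" "P \<noteq> 0"
    and PQ: "\<And>m. m \<in> Poly_Mapping.keys (P * Q) \<Longrightarrow> \<mu> m = b"
    and m: "m \<in> Poly_Mapping.keys Q"
  shows "\<mu> m = b - c"
proof (rule ccontr)
  assume "\<mu> m \<noteq> b - c"
  then have "hcomp \<mu> (\<mu> m + c) (P * Q) = 0"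
    by (intro hcomp_eq_0) (auto dest: PQ)
  then have "P * hcomp \<mu> (\<mu> m) Q = 0"
    by (simp add: hcomp_mult[OF \<mu> P(1)])
  then have "hcomp \<mu> (\<mu> m) Q = 0" using P by simp
  then have "Poly_Mapping.lookup Q m = 0"
    by (metis lookup_hcomp lookup_zero)
  with m show False by (simp add: in_keys_iff)
qed

text \<open>\<open>Q\<close> is not a zero divisor modulo \<open>P\<close>: a form of coprimality
  that a degree argument can establish.\<close>

definition regular_mod :: "lpoly \<Rightarrow> lpoly \<Rightarrow> bool" where
  "regular_mod P Q \<longleftrightarrow> (\<forall>f. P dvd Q * f \<longrightarrow> P dvd f)"

text \<open>The top \<open>\<mu>\<close>-component of \<open>Q f\<close> is a unit times that of \<open>f\<close>, and \<open>P\<close> divides it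
  because \<open>P\<close> is \<open>\<mu>\<close>-homogeneous.\<close>
lemma regular_mod_top:
  fixes \<mu> :: "tmon \<Rightarrow> int"
  assumes \<mu>: "\<And>a b. \<mu> (a + b) = \<mu> a + \<mu> b"
    and P: "\<And>m. m \<in> Poly_Mapping.keys P \<Longrightarrow> \<mu> m = c"
    and Q0: "\<And>m. m \<in> Poly_Mapping.keys Q0 \<Longrightarrow> \<mu> m < \<mu> e"
  shows "regular_mod P (frag_of e + Q0)"
proof -
  let ?Q = "frag_of e + Q0"
  have comp: "P dvd hcomp \<mu> b g" if "P dvd g" for b g
    using that by (auto simp: hcomp_mult[OF \<mu> P])
  have "P dvd f" if "P dvd ?Q * f" for f
    using that
  \<comment> \<open>Induction on the number of monomials of \<open>f\<close>: its top component is
    divisible by \<open>P\<close>, and subtracting it removes a monomial and adds none.\<close>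
  proof (induction "card (Poly_Mapping.keys f)" arbitrary: f rule: less_induct)
    case less
    show ?case
    proof (cases "f = 0")
      case False
      let ?K = "\<mu> ` Poly_Mapping.keys f"
      define a where "a = Max ?K"
      have K: "finite ?K" "?K \<noteq> {}" using False by auto
      then have "a \<in> ?K" unfolding a_def by (rule Max_in)
      then obtain m0 where m0: "m0 \<in> Poly_Mapping.keys f" "\<mu> m0 = a" by auto
      have le: "\<mu> m \<le> a" if "m \<in> Poly_Mapping.keys f" for m
        unfolding a_def using K that by auto
      have "hcomp \<mu> (a + \<mu> e) (Q0 * f) = 0"
      proof (rule hcomp_eq_0)
        fix m assume "m \<in> Poly_Mapping.keys (Q0 * f)"
        then obtain u v where "m = u + v" "u \<in> Poly_Mapping.keys Q0" "v \<in> Poly_Mapping.keys f"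
          using keys_mult by blast
        then show "\<mu> m \<noteq> a + \<mu> e" using Q0[of u] le[of v] by (simp add: \<mu>)
      qed
      moreover have "hcomp \<mu> (a + \<mu> e) (frag_of e * f) = frag_of e * hcomp \<mu> a f"
        by (subst hcomp_mult[OF \<mu>, of _ "\<mu> e"]) auto
      ultimately have "hcomp \<mu> (a + \<mu> e) (?Q * f) = frag_of e * hcomp \<mu> a f"
        by (simp add: distrib_right hcomp_add)
      then have dv: "P dvd hcomp \<mu> a f"
        using comp[OF less.prems] by (metis frag_of_dvd_iff)
      have "P dvd ?Q * f - ?Q * hcomp \<mu> a f"
        using less.prems dv by (intro dvd_diff) auto
      then have "P dvd ?Q * (f - hcomp \<mu> a f)"
        by (simp add: right_diff_distrib)
      moreover have "Poly_Mapping.keys (f - hcomp \<mu> a f) \<subset> Poly_Mapping.keys f"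
        using m0 by (auto simp: in_keys_iff lookup_minus lookup_hcomp split: if_splits)
      then have "card (Poly_Mapping.keys (f - hcomp \<mu> a f)) < card (Poly_Mapping.keys f)"
        by (intro psubset_card_mono) auto
      ultimately have "P dvd f - hcomp \<mu> a f" by (rule less.hyps[rotated])
      with dv have "P dvd (f - hcomp \<mu> a f) + hcomp \<mu> a f" by (rule dvd_add[rotated])
      then show ?thesis by simp
    qed simp
  qed
  then show ?thesis unfolding regular_mod_def by blast
qed

lemma regular_mod_mult: "regular_mod P Q \<Longrightarrow> regular_mod P R \<Longrightarrow> regular_mod P (Q * R)"
  unfolding regular_mod_def mult.assoc by blast

lemma regular_mod_power: "regular_mod P Q \<Longrightarrow> regular_mod P (Q ^ k)"
proof (induction k)
  case 0
  show ?case by (simp add: regular_mod_def)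
qed (simp add: regular_mod_mult)

lemma regular_mod_frag_of: "regular_mod P (frag_of m)"
  by (simp add: regular_mod_def frag_of_dvd_iff)

lemma regular_mod_cong:
  assumes "regular_mod P Q"
  shows "regular_mod P (Q + P * R)"
proof -
  have "P dvd f" if "P dvd (Q + P * R) * f" for f
  proof -
    have "P dvd (Q + P * R) * f - P * (R * f)" using that by (intro dvd_diff) auto
    then have "P dvd Q * f" by (simp add: algebra_simps)
    then show ?thesis using assms unfolding regular_mod_def by blast
  qed
  then show ?thesis unfolding regular_mod_def by blast
qed

lemma regular_mod_associate:
  assumes "regular_mod P Q"
  shows "regular_mod (frag_of m * P) Q"
proof -
  have iff: "frag_of m * P dvd f \<longleftrightarrow> P dvd f" for f
  proof
    assume "P dvd f"
    then have "frag_of m * P dvd frag_of m * (frag_of (- m) * f)"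
      by (intro mult_dvd_mono) auto
    then show "frag_of m * P dvd f" by (simp add: mult.assoc[symmetric] frag_of_mult)
  qed (use dvd_mult_right in blast)
  show ?thesis using assms unfolding regular_mod_def iff .
qed

lemma regular_mod_dvd_power:
  assumes "regular_mod P Q" "P \<noteq> 0" "P ^ a dvd Q * f"
  shows "P ^ a dvd f"
  using assms(3)
proof (induction a arbitrary: f)
  case (Suc a)
  then have "P dvd Q * f" by (metis dvd_mult_left power_Suc)
  then have "P dvd f" using assms(1) unfolding regular_mod_def by blast
  then obtain g where g: "f = P * g" by auto
  with Suc.prems have "P * P ^ a dvd P * (Q * g)" by (simp add: algebra_simps)
  then have "P ^ a dvd Q * g" using assms(2) by simp
  then show ?case using Suc.IH[of g] g by simp
qed simp

lemma common_denominator: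
  assumes V: "nz V" and inj: "\<And>p. evalL p V = 0 \<Longrightarrow> p = 0" and reg: "regular_mod P Q"
    and "P \<noteq> 0" "Q \<noteq> 0"
    and X: "X * evalL P V ^ a = evalL f V" "X * evalL Q V ^ b = evalL g V"
  shows "\<exists>h. X = evalL h V"
proof -
  have "evalL (Q ^ b * f - P ^ a * g) V = 0"
    using V by (simp add: X[symmetric])
  \<comment> \<open>Both fractions represent \<open>X\<close>. As \<open>Q\<close> is regular modulo
    \<open>P\<close>, the divisor \<open>P ^ a\<close> of the left side must divide
    \<open>f\<close>.\<close>
  then have "Q ^ b * f = P ^ a * g" using inj by fastforce
  then have "P ^ a dvd Q ^ b * f" by simp
  then have "P ^ a dvd f"
    using regular_mod_power[OF reg] \<open>P \<noteq> 0\<close> regular_mod_dvd_power by blast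
  then obtain h where "f = P ^ a * h" by auto
  then have "X * evalL P V ^ a = evalL h V * evalL P V ^ a"
    using V X by simp
  moreover have "evalL P V \<noteq> 0" using inj \<open>P \<noteq> 0\<close> by auto
  ultimately show ?thesis by auto
qed

definition free_of :: "pvar \<Rightarrow> lpoly \<Rightarrow> bool" where
  "free_of v p \<longleftrightarrow> (\<forall>m\<in>Poly_Mapping.keys p. Poly_Mapping.lookup m v = 0)"

lemma free_of_frag_of [simp]: "free_of v (frag_of m) \<longleftrightarrow> Poly_Mapping.lookup m v = 0"
  by (simp add: free_of_def)

lemma free_of_zero [simp]: "free_of v 0"
  by (simp add: free_of_def)

lemma free_of_one [simp]: "free_of v 1"
  by (simp add: free_of_def)

lemma free_of_add: "free_of v p \<Longrightarrow> free_of v q \<Longrightarrow> free_of v (p + q)"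
  using keys_add[of p q] by (auto simp: free_of_def)

lemma free_of_mult: "free_of v p \<Longrightarrow> free_of v q \<Longrightarrow> free_of v (p * q)"
  using keys_mult[of p q] by (fastforce simp: free_of_def lookup_add)

lemma free_of_power: "free_of v p \<Longrightarrow> free_of v (p ^ k)"
  by (induction k) (auto intro: free_of_mult)

lemma free_of_sum: "(\<And>i. i \<in> A \<Longrightarrow> free_of v (f i)) \<Longrightarrow> free_of v (sum f A)"
  by (induction A rule: infinite_finite_induct) (auto intro: free_of_add)

lemma evalL_upd_free: "free_of v p \<Longrightarrow> evalL p (V(v := a)) = evalL p V"
  unfolding evalL_evalM free_of_def
  by (intro sum.cong refl arg_cong[of _ _ "\<lambda>x. _ * x"] evalM_cong) (auto simp: in_keys_iff)

section \<open>Changing the cluster\<close>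

text \<open>The elements that some power of \<open>Q\<close> makes Laurent form a ring. It contains
  every \<open>V' v\<close>, and also its inverse because \<open>V' v\<close> divides
  \<open>Q\<close>; hence it contains all Laurent polynomials in \<open>V'\<close>.\<close>

lemma evalL_clear_denominators:
  assumes V: "nz V" and V': "nz V'" and Q: "evalL Q V \<noteq> 0"
    and g: "\<And>v. \<exists>g g'. V' v = evalL g V \<and> V' v * evalL g' V = evalL Q V"
  shows "\<exists>N q. evalL p V' * evalL Q V ^ N = evalL q V"
proof -
  define D where "D = {y. \<exists>N q. y * evalL Q V ^ N = evalL q V}"
  have mult: "x * y \<in> D" if "x \<in> D" "y \<in> D" for x y
  proof -
    from that obtain M p N q where h: "x * evalL Q V ^ M = evalL p V" "y * evalL Q V ^ N = evalL q V"
      unfolding D_def by blast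
    have "(x * y) * evalL Q V ^ (M + N) = (x * evalL Q V ^ M) * (y * evalL Q V ^ N)"
      by (simp add: power_add mult_ac)
    also have "\<dots> = evalL (p * q) V"
      using V by (simp add: h)
    finally have "(x * y) * evalL Q V ^ (M + N) = evalL (p * q) V" .
    then show ?thesis unfolding D_def by blast
  qed
  have diff: "x - y \<in> D" if "x \<in> D" "y \<in> D" for x y
  proof -
    from that obtain M p N q where h: "x * evalL Q V ^ M = evalL p V" "y * evalL Q V ^ N = evalL q V"
      unfolding D_def by blast
    have "(x - y) * evalL Q V ^ (M + N)
        = (x * evalL Q V ^ M) * evalL Q V ^ N - (y * evalL Q V ^ N) * evalL Q V ^ M"
      by (simp add: power_add algebra_simps)
    also have "\<dots> = evalL (p * Q ^ N - q * Q ^ M) V"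
      using V by (simp add: h)
    finally have "(x - y) * evalL Q V ^ (M + N) = evalL (p * Q ^ N - q * Q ^ M) V" .
    then show ?thesis unfolding D_def by blast
  qed
  have of: "V' v \<in> D" "inverse (V' v) \<in> D" for v
  proof -
    from g obtain a b where ab: "V' v = evalL a V" "V' v * evalL b V = evalL Q V" by blast
    have "V' v * evalL Q V ^ 0 = evalL a V" using ab by simp
    then show "V' v \<in> D" unfolding D_def by blast
    have "inverse (V' v) * evalL Q V ^ 1 = evalL b V"
      using V' by (simp flip: ab(2))
    then show "inverse (V' v) \<in> D" unfolding D_def by blast
  qed
  have one: "1 \<in> D" unfolding D_def by (rule CollectI, rule exI[of _ 0], rule exI[of _ 1]) simp
  have "evalM V' m \<in> D \<and> inverse (evalM V' m) \<in> D" for m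
    by (induction m rule: lpoly_induct)
      (auto simp: one of evalM_diff[OF V'] divide_inverse intro: mult)
  moreover have "0 \<in> D" using diff[OF one one] by simp
  ultimately have "evalL p V' \<in> D"
    by (induction p rule: lpoly_induct) (auto intro: diff)
  then show ?thesis by (simp add: D_def)
qed

text \<open>The substitution \<open>x \<mapsto> P / x\<close> is an involution of the localization at \<open>P\<close>.\<close>
lemma evalL_exchange_injective:
  assumes V: "nz V" and inj: "\<And>p. evalL p V = 0 \<Longrightarrow> p = 0"
    and P: "free_of x P" "P \<noteq> 0" and 0: "evalL p (V(x := evalL P V / V x)) = 0"
  shows "p = 0"
proof -
  let ?V' = "V(x := evalL P V / V x)" and ?P = "evalL P V"
  have P0: "?P \<noteq> 0" using inj P by auto
  have V': "nz ?V'" using V P0 by auto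
  have PP: "evalL P ?V' = ?P" by (rule evalL_upd_free) fact
  \<comment> \<open>Graph of the substitution on the localization: \<open>y\<close> is a fraction
    \<open>q / P ^ N\<close> read at \<open>V\<close>, and \<open>y'\<close> is the same fraction
    read at \<open>?V'\<close>. Substituting twice returns \<open>V\<close>, so the graph contains
    the pair of \<open>evalL p ?V'\<close> and \<open>evalL p V\<close>.\<close>
  define D where "D = {(y, y'). \<exists>N q. y * ?P ^ N = evalL q V \<and> evalL q ?V' = y' * ?P ^ N}"
  have mult: "(x * y, x' * y') \<in> D" if "(x, x') \<in> D" "(y, y') \<in> D" for x y x' y'
  proof -
    from that obtain M p N q where h: "x * ?P ^ M = evalL p V" "y * ?P ^ N = evalL q V"
      "evalL p ?V' = x' * ?P ^ M" "evalL q ?V' = y' * ?P ^ N"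
      unfolding D_def by blast
    have "(x * y) * ?P ^ (M + N) = (x * ?P ^ M) * (y * ?P ^ N)"
      by (simp add: power_add mult_ac)
    also have "\<dots> = evalL (p * q) V"
      using V by (simp add: h)
    finally have 1: "(x * y) * ?P ^ (M + N) = evalL (p * q) V" .
    have "evalL (p * q) ?V' = (x' * y') * ?P ^ (M + N)"
      unfolding evalL_mult[OF V'] h by (simp add: power_add mult_ac)
    with 1 show ?thesis unfolding D_def by blast
  qed
  have diff: "(x - y, x' - y') \<in> D" if "(x, x') \<in> D" "(y, y') \<in> D" for x y x' y'
  proof -
    from that obtain M p N q where h: "x * ?P ^ M = evalL p V" "y * ?P ^ N = evalL q V"
      "evalL p ?V' = x' * ?P ^ M" "evalL q ?V' = y' * ?P ^ N"
      unfolding D_def by blast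
    have "(x - y) * ?P ^ (M + N) = (x * ?P ^ M) * ?P ^ N - (y * ?P ^ N) * ?P ^ M"
      by (simp add: power_add algebra_simps)
    also have "\<dots> = evalL (p * P ^ N - q * P ^ M) V"
      using V by (simp add: h)
    finally have 1: "(x - y) * ?P ^ (M + N) = evalL (p * P ^ N - q * P ^ M) V" .
    have "evalL (p * P ^ N - q * P ^ M) ?V' = (x' - y') * ?P ^ (M + N)"
      unfolding evalL_diff evalL_mult[OF V'] evalL_power[OF V'] h PP
      by (simp add: power_add algebra_simps)
    with 1 show ?thesis unfolding D_def by blast
  qed
  have D1: "(y, y') \<in> D" if "y * ?P ^ N = evalL q V" "evalL q ?V' = y' * ?P ^ N" for y y' N q
    using that unfolding D_def by blast
  have of: "(?V' v, V v) \<in> D \<and> (inverse (?V' v), inverse (V v)) \<in> D" for v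
  proof (cases "v = x")
    case True
    have "evalL (P * frag_of (- frag_of x)) ?V' = V x"
      unfolding evalL_mult[OF V'] PP evalL_of evalM_uminus[OF V'] evalM_of
      using V P0 by (simp add: field_simps)
    moreover have "evalL (P * frag_of (- frag_of x)) V = ?P / V x"
      using V by (simp add: evalM_uminus divide_inverse)
    ultimately have "(?V' x, V x) \<in> D"
      by (intro D1[of _ 0 "P * frag_of (- frag_of x)"]) auto
    moreover have "(inverse (?V' x), inverse (V x)) \<in> D"
      by (rule D1[of _ 1 "frag_of (frag_of x)"]) (use V P0 in \<open>auto simp: field_simps\<close>)
    ultimately show ?thesis using True by blast
  next
    case False
    have "(V v, V v) \<in> D"
      by (rule D1[of _ 0 "frag_of (frag_of v)"]) (use False in auto)
    moreover have "evalL (frag_of (- frag_of v)) ?V' = inverse (V v)"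
      unfolding evalL_of evalM_uminus[OF V'] evalM_of using False by simp
    then have "(inverse (V v), inverse (V v)) \<in> D"
      using V by (intro D1[of _ 0 "frag_of (- frag_of v)"]) (auto simp: evalM_uminus)
    ultimately show ?thesis using False by simp
  qed
  have one: "(1, 1) \<in> D" by (rule D1[of _ 0 1]) auto
  have "(evalM ?V' m, evalM V m) \<in> D \<and> (inverse (evalM ?V' m), inverse (evalM V m)) \<in> D" for m
  proof (induction m rule: lpoly_induct)
    case (diff a b)
    have "evalM ?V' (a - b) = evalM ?V' a * inverse (evalM ?V' b)"
      "inverse (evalM ?V' (a - b)) = inverse (evalM ?V' a) * evalM ?V' b"
      "evalM V (a - b) = evalM V a * inverse (evalM V b)"
      "inverse (evalM V (a - b)) = inverse (evalM V a) * evalM V b"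
      unfolding evalM_diff[OF V'] evalM_diff[OF V] by (simp_all add: divide_inverse mult.commute)
    with diff show ?case by (simp only: mult)
  qed (simp_all only: one of evalM_of evalM_zero inverse_1)
  moreover have "(0, 0) \<in> D" using diff[OF one one] by simp
  ultimately have "(evalL p ?V', evalL p V) \<in> D"
    by (induction p rule: lpoly_induct) (auto intro: diff)
  \<comment> \<open>The first entry of the pair is 0, so its numerator is the zero polynomial, and
    the second entry vanishes too.\<close>
  then obtain N q where q: "0 * ?P ^ N = evalL q V" "evalL q ?V' = evalL p V * ?P ^ N"
    unfolding D_def 0 by blast
  then have "q = 0" using inj[of q] by simp
  with q P0 have "evalL p V = 0" by simp
  then show ?thesis by (rule inj)
qed

section \<open>Mutation of extended seeds\<close>

definition theta :: "(nat \<Rightarrow> nat) \<Rightarrow> nat \<Rightarrow> lpoly \<Rightarrow> lpoly" where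
  "theta d k g = (\<Sum>s\<le>d k. frag_of (ztrop d k s) * g ^ s)"

definition theta_at :: "(nat \<Rightarrow> nat) \<Rightarrow> nat \<Rightarrow> (pvar \<Rightarrow> 'f::field) \<Rightarrow> 'f \<Rightarrow> 'f" where
  "theta_at d k V y = (\<Sum>s\<le>d k. evalM V (ztrop d k s) * y ^ s)"

lemma evalL_theta: "nz V \<Longrightarrow> evalL (theta d k g) V = theta_at d k V (evalL g V)"
  by (simp add: theta_def theta_at_def)

lemma lookup_ztrop: "fst v \<noteq> 2 \<Longrightarrow> Poly_Mapping.lookup (ztrop d k s) v = 0"
  by (auto simp: ztrop_def vz_def lookup_single when_def)

lemma ztrop_sym: "s \<le> d k \<Longrightarrow> ztrop d k (d k - s) = ztrop d k s"
  by (auto simp: ztrop_def vz_def min.commute)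

lemma theta_at_cong: "(\<And>v. fst v = 2 \<Longrightarrow> V v = W v) \<Longrightarrow> theta_at d k V = theta_at d k W"
  unfolding theta_at_def fun_eq_iff
  by (intro allI sum.cong refl arg_cong[of _ _ "\<lambda>x. x * _"] evalM_cong)
    (metis in_keys_iff lookup_ztrop)

text \<open>Summation in reverse order, with z_{k,s} = z_{k,d_k-s}. Both
  \<open>mutV_involution\<close> and \<open>mutated_value\<close> rest on this symmetry.\<close>

lemma theta_at_palindromic:
  assumes "y \<noteq> 0"
  shows "theta_at d k V y = y ^ d k * theta_at d k V (inverse y)"
proof -
  have "theta_at d k V y = (\<Sum>s\<le>d k. evalM V (ztrop d k (d k - s)) * y ^ (d k - s))"
    unfolding theta_at_def
    by (rule sum.reindex_bij_witness[of _ "\<lambda>s. d k - s" "\<lambda>s. d k - s"]) auto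
  also have "\<dots> = (\<Sum>s\<le>d k. y ^ d k * (evalM V (ztrop d k s) * inverse y ^ s))"
    using assms by (intro sum.cong) (auto simp: ztrop_sym power_diff field_simps)
  finally show ?thesis by (simp add: theta_at_def sum_distrib_left)
qed

lemma frag_of_power: "frag_of a ^ s = (frag_of (frag_cmul (int s) a) :: lpoly)"
  by (induction s) (auto simp: frag_of_mult frag_cmul_distrib add.commute)

lemma theta_uminus:
  "theta d k (frag_of (- e)) = frag_of (frag_cmul (- int (d k)) e) * theta d k (frag_of e)"
proof -
  have "theta d k (frag_of (- e)) = (\<Sum>s\<le>d k. frag_of (ztrop d k (d k - s)) * frag_of (- e) ^ (d k - s))"
    unfolding theta_def
    by (rule sum.reindex_bij_witness[of _ "\<lambda>s. d k - s" "\<lambda>s. d k - s"]) auto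
  also have "\<dots> = (\<Sum>s\<le>d k. frag_of (frag_cmul (- int (d k)) e) * (frag_of (ztrop d k s) * frag_of e ^ s))"
  proof (intro sum.cong refl)
    fix s assume "s \<in> {..d k}"
    then have "frag_cmul (int (d k - s)) (- e) = frag_cmul (- int (d k)) e + frag_cmul (int s) e"
      by (intro poly_mapping_eqI) (simp add: lookup_add of_nat_diff algebra_simps)
    then show "frag_of (ztrop d k (d k - s)) * frag_of (- e) ^ (d k - s)
        = frag_of (frag_cmul (- int (d k)) e) * (frag_of (ztrop d k s) * frag_of e ^ s)"
      using \<open>s \<in> {..d k}\<close> by (simp add: frag_of_power frag_of_mult ztrop_sym add_ac)
  qed
  finally show ?thesis by (simp add: theta_def sum_distrib_left)
qed

text \<open>At the rational point with all coordinates 1 the value is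
  \<open>d k + 1\<close>.\<close>

lemma theta_nonzero: "theta d k (frag_of e) \<noteq> 0"
proof
  assume 0: "theta d k (frag_of e) = 0"
  have "evalM (\<lambda>_. 1 :: rat) m = 1" for m by (simp add: evalM_def)
  then have "evalL (theta d k (frag_of e)) (\<lambda>_. 1 :: rat) = of_nat (Suc (d k))"
    by (simp add: evalL_theta theta_at_def)
  with 0 show False by (simp del: of_nat_Suc)
qed

lemma keys_theta:
  assumes "m \<in> Poly_Mapping.keys (theta d k (frag_of e))"
  obtains s where "s \<le> d k" "m = ztrop d k s + frag_cmul (int s) e"
proof -
  have "Poly_Mapping.keys (theta d k (frag_of e))
      \<subseteq> (\<Union>s\<in>{..d k}. Poly_Mapping.keys (frag_of (ztrop d k s) * frag_of e ^ s :: lpoly))"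
    unfolding theta_def by (rule keys_sum)
  then show thesis using assms that by (auto simp: frag_of_power frag_of_mult)
qed

text \<open>An extended seed is a pair of a valuation \<open>V\<close> (cluster variables at \<open>vx i\<close>, coefficients
  elsewhere) and the exponent vectors \<open>e\<^sub>i\<close> of the monomials \<open>\<open>y\<close>-hat\<^sub>i\<close>, so that
  \<open>b\<^sub>i\<^sub>j\<close> is the exponent of \<open>vx i\<close> in \<open>e\<^sub>j\<close>. The exchange relation is normalized by an arbitrary
  coefficient monomial, which enters through \<open>\<beta>\<close>.\<close>

definition mutE :: "(nat \<Rightarrow> nat) \<Rightarrow> nat \<Rightarrow> tmon \<Rightarrow> (nat \<Rightarrow> tmon) \<Rightarrow> nat \<Rightarrow> tmon" where
  "mutE d k \<beta> e i = (if i = k then - e k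
     else e i + frag_cmul (int (d k) * pos (Poly_Mapping.lookup (e i) (vx k))) (e k)
       + frag_cmul (Poly_Mapping.lookup (e i) (vx k)) (\<beta> - frag_cmul 2 (frag_of (vx k))))"

text \<open>With x_k' for the new value, theta = x_k x_k' / \<beta>. Inserting this into the rule
  that multiplies y-hat_i by y-hat_k to the power d_k [b_ki]_+ and by theta to the power -b_ki gives
  \<open>mutE\<close>. Of the two units of x_k subtracted there per b_ki, one cancels the x_k in
  y-hat_i and the other is the exponent -b_ki of x_k'.\<close>

definition mutV :: "(nat \<Rightarrow> nat) \<Rightarrow> nat \<Rightarrow> tmon \<Rightarrow> (nat \<Rightarrow> tmon) \<Rightarrow> (pvar \<Rightarrow> 'f::field) \<Rightarrow> pvar \<Rightarrow> 'f" where
  "mutV d k \<beta> e V = V(vx k := evalM V \<beta> * theta_at d k V (evalM V (e k)) / V (vx k))"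

definition exchange_mon :: "nat \<Rightarrow> (nat \<Rightarrow> nat) \<Rightarrow> nat \<Rightarrow> (nat \<Rightarrow> tmon) \<Rightarrow> tmon \<Rightarrow> bool" where
  "exchange_mon n d k e \<beta> \<longleftrightarrow>
     (\<forall>j<n. Poly_Mapping.lookup \<beta> (vx j) = int (d k) * pos (- Poly_Mapping.lookup (e k) (vx j)))"

definition exch_matrix :: "(nat \<Rightarrow> tmon) \<Rightarrow> nat \<Rightarrow> nat \<Rightarrow> int" where
  "exch_matrix e i j = Poly_Mapping.lookup (e j) (vx i)"

definition independent_columns :: "nat \<Rightarrow> (nat \<Rightarrow> tmon) \<Rightarrow> bool" where
  "independent_columns n e \<longleftrightarrow>
     (\<forall>c. (\<forall>v. fst v \<noteq> 2 \<longrightarrow> (\<Sum>i<n. c i * Poly_Mapping.lookup (e i) v) = 0) \<longrightarrow> (\<forall>i<n. c i = 0))"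

text \<open>Injectivity of evaluation is algebraic independence of all values, cluster variables and
  coefficients together.\<close>

definition good_seed :: "nat \<Rightarrow> (pvar \<Rightarrow> 'f::field) \<Rightarrow> (nat \<Rightarrow> tmon) \<Rightarrow> bool" where
  "good_seed n V e \<longleftrightarrow> nz V \<and> (\<forall>p. evalL p V = 0 \<longrightarrow> p = 0)
     \<and> skew_symmetrizable n (exch_matrix e) \<and> independent_columns n e"

lemma vx_eq_iff [simp]: "vx i = vx j \<longleftrightarrow> i = j"
  by (simp add: vx_def)

lemma fst_vx [simp]: "fst (vx i) = 0"
  by (simp add: vx_def)

lemma lookup_mutE:
  "Poly_Mapping.lookup (mutE d k \<beta> e i) v = (if i = k then - Poly_Mapping.lookup (e k) v
     else Poly_Mapping.lookup (e i) v + int (d k) * pos (exch_matrix e k i) * Poly_Mapping.lookup (e k) v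
       + exch_matrix e k i * (Poly_Mapping.lookup \<beta> v - (if v = vx k then 2 else 0)))"
  by (simp add: mutE_def exch_matrix_def lookup_add lookup_minus lookup_single when_def)

lemma skew_symmetrizableD:
  assumes "skew_symmetrizable n B" "i < n" "j < n"
  shows "B i i = 0" "B i j > 0 \<longleftrightarrow> B j i < 0" "B i j = 0 \<longleftrightarrow> B j i = 0"
proof -
  obtain D :: "nat \<Rightarrow> int" where D: "\<And>i. i < n \<Longrightarrow> D i > 0"
    "\<And>i j. i < n \<Longrightarrow> j < n \<Longrightarrow> D i * B i j = - (D j * B j i)"
    using assms(1) unfolding skew_symmetrizable_def by blast
  have pos: "D i > 0" "D j > 0" using D assms by auto
  have eq: "D i * B i j = - (D j * B j i)" "D i * B i i = - (D i * B i i)" using D assms by blast+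
  show "B i i = 0" using pos eq(2) by simp
  have "B i j > 0 \<longleftrightarrow> D i * B i j > 0" "B j i < 0 \<longleftrightarrow> D j * B j i < 0"
    using pos by (simp_all add: zero_less_mult_iff mult_less_0_iff)
  then show "B i j > 0 \<longleftrightarrow> B j i < 0" unfolding eq(1) by simp
  show "B i j = 0 \<longleftrightarrow> B j i = 0"
    using pos eq(1) by (metis mult_eq_0_iff neg_equal_0_iff_equal less_irrefl)
qed

text \<open>The same \<open>D\<close> serves, since D_i [-b_ik]_+ = D_k [b_ki]_+ interchanges the
  two terms of the mutation rule.\<close>

lemma skew_symmetrizable_mut_B:
  assumes "skew_symmetrizable n B" "k < n"
  shows "skew_symmetrizable n (mut_B d k B)"
proof -
  obtain D :: "nat \<Rightarrow> int" where D: "\<And>i. i < n \<Longrightarrow> D i > 0"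
    "\<And>i j. i < n \<Longrightarrow> j < n \<Longrightarrow> D i * B i j = - (D j * B j i)"
    using assms(1) unfolding skew_symmetrizable_def by blast
  have pos: "a * pos b = pos (a * b)" if "a > 0" for a b
    using that by (auto simp: pos_def max_def zero_le_mult_iff mult_le_0_iff)
  have "D i * mut_B d k B i j = - (D j * mut_B d k B j i)" if ij: "i < n" "j < n" for i j
  proof (cases "i = k \<or> j = k")
    case True
    then show ?thesis using D(2)[OF ij] by (auto simp: mut_B_def)
  next
    case False
    have p: "D i * pos (- B i k) = D k * pos (B k i)" if "i < n" for i
      using D(1)[OF that] D(1)[OF assms(2)] D(2)[OF that assms(2)] by (simp add: pos)
    have "D i * mut_B d k B i j = D i * B i j
        + int (d k) * ((D i * pos (- B i k)) * B k j + (D i * B i k) * pos (B k j))"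
      using False by (simp add: mut_B_def algebra_simps)
    also have "\<dots> = - (D j * B j i) + int (d k) * (pos (B k i) * (D k * B k j) - B k i * (D k * pos (B k j)))"
      unfolding p[OF ij(1)] D(2)[OF ij] D(2)[OF ij(1) assms(2)] by (simp add: algebra_simps)
    also have "\<dots> = - (D j * B j i) + int (d k) * (pos (B k i) * - (D j * B j k) - B k i * (D j * pos (- B j k)))"
      unfolding p[OF ij(2)] D(2)[OF ij(2) assms(2)] by simp
    also have "\<dots> = - (D j * mut_B d k B j i)"
      using False by (simp add: mut_B_def algebra_simps)
    finally show ?thesis .
  qed
  with D show ?thesis unfolding skew_symmetrizable_def by blast
qed

lemma exch_matrix_mutE:
  assumes "exchange_mon n d k e \<beta>" "k < n" "i < n" "exch_matrix e k k = 0"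
  shows "exch_matrix (mutE d k \<beta> e) i j = mut_B d k (exch_matrix e) i j"
proof -
  have \<beta>: "Poly_Mapping.lookup \<beta> (vx i) = int (d k) * pos (- exch_matrix e i k)"
    "Poly_Mapping.lookup \<beta> (vx k) = 0"
    using assms by (auto simp: exchange_mon_def exch_matrix_def pos_def)
  have e: "Poly_Mapping.lookup (e j') (vx i') = exch_matrix e i' j'" for i' j'
    by (simp add: exch_matrix_def)
  show ?thesis
    unfolding exch_matrix_def[of "mutE d k \<beta> e"] lookup_mutE \<beta> e mut_B_def
    using assms(4) \<beta> by (auto simp: algebra_simps)
qed

lemma skew_symmetrizable_cong:
  assumes "\<And>i j. i < n \<Longrightarrow> j < n \<Longrightarrow> A i j = B i j"
  shows "skew_symmetrizable n A \<longleftrightarrow> skew_symmetrizable n B"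
  unfolding skew_symmetrizable_def using assms by (intro ex_cong1) auto

text \<open>A relation among the new vectors, read at the coordinate \<open>vx k\<close>, says
  \<open>- s = 0\<close> and so loses its \<open>\<beta>\<close> term. What remains is a relation
  among the old vectors in which \<open>e k\<close> has the coefficient
  \<open>t - c k\<close>.\<close>

lemma independent_columns_mutE:
  assumes "independent_columns n e" "exchange_mon n d k e \<beta>" "k < n" "exch_matrix e k k = 0"
  shows "independent_columns n (mutE d k \<beta> e)"
  unfolding independent_columns_def
proof (intro allI impI)
  fix c i assume c: "\<forall>v. fst v \<noteq> 2 \<longrightarrow> (\<Sum>i<n. c i * Poly_Mapping.lookup (mutE d k \<beta> e i) v) = 0" and i: "i < n"
  let ?N = "{..<n} - {k}"
  have split: "(\<Sum>i<n. f i) = f k + (\<Sum>i\<in>?N. f i)" for f :: "nat \<Rightarrow> int"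
    using assms by (simp add: sum.remove)
  define s where "s = (\<Sum>i\<in>?N. c i * exch_matrix e k i)"
  define t where "t = (\<Sum>i\<in>?N. c i * (int (d k) * pos (exch_matrix e k i)))"
  have expand: "(\<Sum>i<n. c i * Poly_Mapping.lookup (mutE d k \<beta> e i) v)
      = (\<Sum>i\<in>?N. c i * Poly_Mapping.lookup (e i) v) + (t - c k) * Poly_Mapping.lookup (e k) v
        + s * (Poly_Mapping.lookup \<beta> v - (if v = vx k then 2 else 0))" for v
  proof -
    have "(\<Sum>i\<in>?N. c i * Poly_Mapping.lookup (mutE d k \<beta> e i) v)
      = (\<Sum>i\<in>?N. c i * Poly_Mapping.lookup (e i) v
          + (c i * (int (d k) * pos (exch_matrix e k i))) * Poly_Mapping.lookup (e k) v
          + (c i * exch_matrix e k i) * (Poly_Mapping.lookup \<beta> v - (if v = vx k then 2 else 0)))"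
      by (intro sum.cong) (auto simp: lookup_mutE algebra_simps)
    then show ?thesis
      by (simp add: split lookup_mutE[of _ _ _ _ k] sum.distrib s_def t_def flip: sum_distrib_right)
        (simp add: algebra_simps)
  qed
  have "Poly_Mapping.lookup \<beta> (vx k) = 0" "Poly_Mapping.lookup (e k) (vx k) = 0"
    using assms by (auto simp: exchange_mon_def exch_matrix_def pos_def)
  moreover have "(\<Sum>i\<in>?N. c i * Poly_Mapping.lookup (e i) (vx k)) = s"
    by (simp add: s_def exch_matrix_def)
  ultimately have s: "s = 0"
    using c[rule_format, of "vx k"] expand[of "vx k"] by simp
  let ?c = "\<lambda>i. if i = k then t - c k else c i"
  have z: "(\<Sum>i<n. ?c i * Poly_Mapping.lookup (e i) v) = 0" if "fst v \<noteq> 2" for v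
  proof -
    have "(\<Sum>i\<in>?N. ?c i * Poly_Mapping.lookup (e i) v) = (\<Sum>i\<in>?N. c i * Poly_Mapping.lookup (e i) v)"
      by (intro sum.cong) auto
    then show ?thesis using c[rule_format, OF that] expand[of v] s
      by (simp add: split)
  qed
  have *: "?c i = 0" if "i < n" for i
    by (rule assms(1)[unfolded independent_columns_def, rule_format, OF z that])
  have c0: "c i = 0" if "i < n" "i \<noteq> k" for i using *[OF that(1)] that(2) by simp
  then have "t = 0" unfolding t_def by (intro sum.neutral) auto
  moreover have "t - c k = 0" using *[OF \<open>k < n\<close>] by simp
  ultimately show "c i = 0" using c0[OF i] by auto
qed

lemma good_seed_mut:
  assumes "good_seed n V e" "k < n" "exchange_mon n d k e \<beta>"
  shows "good_seed n (mutV d k \<beta> e V) (mutE d k \<beta> e)"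
proof -
  have V: "nz V" and inj: "\<And>p. evalL p V = 0 \<Longrightarrow> p = 0"
    and sk: "skew_symmetrizable n (exch_matrix e)" and ind: "independent_columns n e"
    using assms by (auto simp: good_seed_def)
  have kk: "exch_matrix e k k = 0" using sk assms by (blast intro: skew_symmetrizableD)
  define P where "P = frag_of \<beta> * theta d k (frag_of (e k))"
  have P: "evalL P V = evalM V \<beta> * theta_at d k V (evalM V (e k))"
    using V by (simp add: P_def evalL_theta)
  have "P \<noteq> 0" by (simp add: P_def theta_nonzero)
  have "Poly_Mapping.lookup \<beta> (vx k) = 0" "Poly_Mapping.lookup (e k) (vx k) = 0"
    using assms kk by (auto simp: exchange_mon_def exch_matrix_def pos_def)
  then have "free_of (vx k) P"
    unfolding P_def theta_def
    by (intro free_of_mult free_of_sum free_of_power) (auto simp: lookup_ztrop)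
  then have "p = 0" if "evalL p (mutV d k \<beta> e V) = 0" for p
    using that evalL_exchange_injective[OF V inj _ \<open>P \<noteq> 0\<close>] unfolding mutV_def P[symmetric] by blast
  moreover have "evalL P V \<noteq> 0" using inj \<open>P \<noteq> 0\<close> by auto
  then have "nz (mutV d k \<beta> e V)" using V by (auto simp: mutV_def P[symmetric])
  moreover have "skew_symmetrizable n (exch_matrix (mutE d k \<beta> e))"
    using skew_symmetrizable_mut_B[OF sk assms(2), of d] exch_matrix_mutE[OF assms(3,2) _ kk]
    by (subst skew_symmetrizable_cong) auto
  ultimately show ?thesis
    using independent_columns_mutE[OF ind assms(3,2) kk] by (simp add: good_seed_def)
qed

text \<open>The reverse monomial is \<beta> + d_k e_k because its exponent at \<open>vx j\<close> is
  d_k [-b_jk]_+ + d_k b_jk = d_k [b_jk]_+, as the column \<open>- e k\<close> demands.\<close>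

lemma mutE_involution:
  assumes "exchange_mon n d k e \<beta>" "k < n" "exch_matrix e k k = 0"
  shows "mutE d k (\<beta> + frag_cmul (int (d k)) (e k)) (mutE d k \<beta> e) = e"
proof
  fix i
  have "Poly_Mapping.lookup \<beta> (vx k) = 0" "Poly_Mapping.lookup (e k) (vx k) = 0"
    using assms by (auto simp: exchange_mon_def exch_matrix_def pos_def)
  then have b: "exch_matrix (mutE d k \<beta> e) k i = - exch_matrix e k i"
    unfolding exch_matrix_def[of "mutE _ _ _ _"] lookup_mutE by (auto simp: exch_matrix_def)
  have p: "int (d k) * pos (exch_matrix e k i) = int (d k) * pos (- exch_matrix e k i) + int (d k) * exch_matrix e k i"
    by (simp add: pos_def max_def)
  show "mutE d k (\<beta> + frag_cmul (int (d k)) (e k)) (mutE d k \<beta> e) i = e i"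
  proof (rule poly_mapping_eqI)
    fix v
    show "Poly_Mapping.lookup (mutE d k (\<beta> + frag_cmul (int (d k)) (e k)) (mutE d k \<beta> e) i) v = Poly_Mapping.lookup (e i) v"
    proof (cases "i = k")
      case False
      have "int (d k) * pos (exch_matrix e k i) * Poly_Mapping.lookup (e k) v
          = int (d k) * pos (- exch_matrix e k i) * Poly_Mapping.lookup (e k) v + int (d k) * exch_matrix e k i * Poly_Mapping.lookup (e k) v"
        by (simp add: p distrib_right)
      with False show ?thesis
        by (simp add: lookup_mutE[of _ _ _ "mutE _ _ _ _"] b lookup_mutE lookup_add algebra_simps)
    qed (simp add: lookup_mutE)
  qed
qed

lemma exchange_mon_involution:
  assumes "exchange_mon n d k e \<beta>"
  shows "exchange_mon n d k (mutE d k \<beta> e) (\<beta> + frag_cmul (int (d k)) (e k))"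
  using assms by (auto simp: exchange_mon_def lookup_mutE lookup_add pos_def max_def)

lemma mutV_involution:
  assumes "good_seed n V e" "k < n" "exchange_mon n d k e \<beta>"
  shows "mutV d k (\<beta> + frag_cmul (int (d k)) (e k)) (mutE d k \<beta> e) (mutV d k \<beta> e V) = V"
proof -
  let ?V' = "mutV d k \<beta> e V"
  have V: "nz V" and V': "nz ?V'" and kk: "exch_matrix e k k = 0"
    using assms good_seed_mut[OF assms] skew_symmetrizableD(1)[of n "exch_matrix e" k] by (auto simp: good_seed_def)
  have l: "Poly_Mapping.lookup \<beta> (vx k) = 0" "Poly_Mapping.lookup (e k) (vx k) = 0"
    using assms kk by (auto simp: exchange_mon_def exch_matrix_def pos_def)
  have upd: "evalM ?V' m = evalM V m" if "Poly_Mapping.lookup m (vx k) = 0" for m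
    by (rule evalM_cong) (use that in \<open>auto simp: mutV_def in_keys_iff\<close>)
  have th: "theta_at d k ?V' = theta_at d k V"
    by (rule theta_at_cong) (auto simp: mutV_def)
  have "?V' (vx k) = evalM V \<beta> * theta_at d k V (evalM V (e k)) / V (vx k)"
    by (simp add: mutV_def)
  moreover have "evalM V \<beta> * theta_at d k V (evalM V (e k))
      = evalM V (\<beta> + frag_cmul (int (d k)) (e k)) * theta_at d k V (evalM V (- e k))"
    using V theta_at_palindromic[of "evalM V (e k)" d k V]
    by (simp add: evalM_add evalM_cmul evalM_uminus)
  ultimately have "evalM V (\<beta> + frag_cmul (int (d k)) (e k)) * theta_at d k V (evalM V (- e k)) / ?V' (vx k) = V (vx k)"
    using V V' by (metis nonzero_mult_div_cancel_left nonzero_eq_divide_eq mult.commute times_divide_eq_right)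
  then show ?thesis
    using l by (subst mutV_def) (simp add: upd th mutE_def lookup_add, simp add: mutV_def)
qed

section \<open>The Laurent phenomenon\<close>

text \<open>An exchange polynomial at a seed where \<open>v\<close> has the value of
  \<open>P\<close>, rewritten over \<open>V\<close>. If \<open>v\<close> has a negative exponent in
  \<open>m\<close>, the palindromic symmetry replaces \<open>m\<close> by its inverse; the resulting
  factor m^d cancels the \<open>v\<close> in \<open>\<beta>\<close>, and \<open>P\<close> enters
  with nonnegative powers only.\<close>

lemma mutated_value:
  assumes V: "nz V" and P: "evalL P V \<noteq> 0" and v: "fst v = 0"
    and \<beta>: "Poly_Mapping.lookup \<beta> v = int (d k) * pos (- Poly_Mapping.lookup m v)"
  defines "c \<equiv> Poly_Mapping.lookup m v" and "V' \<equiv> V(v := evalL P V)"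
  shows "evalM V' \<beta> * theta_at d k V' (evalM V' m)
    = evalL (frag_of (if 0 \<le> c then \<beta> else \<beta> + frag_cmul (int (d k)) m)
        * theta d k (frag_of (if 0 \<le> c then m - frag_cmul c (frag_of v) else - (m - frag_cmul c (frag_of v)))
            * P ^ nat \<bar>c\<bar>)) V"
proof -
  have V': "nz V'" using V P by (simp add: V'_def)
  have upd: "evalM V' u = evalM V u" if "Poly_Mapping.lookup u v = 0" for u
    unfolding V'_def by (rule evalM_cong) (use that in \<open>auto simp: in_keys_iff\<close>)
  have th: "theta_at d k V' = theta_at d k V"
    by (rule theta_at_cong) (use v in \<open>auto simp: V'_def\<close>)
  have m: "evalM V' m = evalM V (m - frag_cmul c (frag_of v)) * evalL P V powi c"
    using evalM_upd[OF V P, of v m] by (simp add: V'_def c_def)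
  show ?thesis
  proof (cases "0 \<le> c")
    case True
    then have "Poly_Mapping.lookup \<beta> v = 0" by (simp add: \<beta> c_def pos_def)
    with True show ?thesis
      using V by (simp add: upd th m evalL_theta power_int_nonneg_exp)
  next
    case False
    have "Poly_Mapping.lookup (\<beta> + frag_cmul (int (d k)) m) v = 0"
      using False by (simp add: \<beta> c_def pos_def lookup_add max_def)
    then have "evalM V' \<beta> * evalM V' m ^ d k = evalM V (\<beta> + frag_cmul (int (d k)) m)"
      by (simp add: upd evalM_add[OF V'] evalM_cmul flip: upd)
    moreover have "inverse (evalM V' m) = evalL (frag_of (- (m - frag_cmul c (frag_of v))) * P ^ nat \<bar>c\<bar>) V"
      using False V unfolding m evalM_uminus[OF V] evalL_mult[OF V] evalL_of
      by (simp add: power_int_def power_inverse)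
    ultimately show ?thesis
      using False V V' theta_at_palindromic[of "evalM V' m" d k V']
      by (simp add: evalL_theta th mult.assoc)
  qed
qed

text \<open>Expansion to first order in \<open>p\<close> with coefficients free of \<open>v\<close>,
  although \<open>p\<close> itself may involve \<open>v\<close>. The first order is needed because
  \<open>p3\<close> is obtained by dividing by \<open>p1\<close>, so that the coefficient
  \<open>W\<close> survives in its residue modulo \<open>p1\<close>.\<close>

definition jet :: "pvar \<Rightarrow> lpoly \<Rightarrow> lpoly \<Rightarrow> lpoly \<Rightarrow> bool" where
  "jet v p f0 f \<longleftrightarrow> free_of v f0 \<and> (\<exists>W R. free_of v W \<and> f = f0 + p * W + p * p * R)"

lemma jet_free: "free_of v f \<Longrightarrow> jet v p f f"
  unfolding jet_def by (intro conjI exI[of _ 0]) auto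

lemma jet_self: "jet v p 0 p"
  unfolding jet_def by (intro conjI exI[of _ 1] exI[of _ 0]) auto

lemma jet_add:
  assumes "jet v p f0 f" "jet v p g0 g"
  shows "jet v p (f0 + g0) (f + g)"
proof -
  from assms obtain W R W' R' where "free_of v W" "f = f0 + p * W + p * p * R"
    "free_of v W'" "g = g0 + p * W' + p * p * R'" and f0: "free_of v f0" "free_of v g0"
    unfolding jet_def by blast
  then have "f + g = (f0 + g0) + p * (W + W') + p * p * (R + R')" "free_of v (W + W')"
    by (simp_all add: algebra_simps free_of_add)
  with f0 show ?thesis unfolding jet_def using free_of_add by blast
qed

lemma jet_mult:
  assumes "jet v p f0 f" "jet v p g0 g"
  shows "jet v p (f0 * g0) (f * g)"
proof -
  from assms obtain W R W' R' where W: "free_of v W" "f = f0 + p * W + p * p * R"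
    "free_of v W'" "g = g0 + p * W' + p * p * R'" and f0: "free_of v f0" "free_of v g0"
    unfolding jet_def by blast
  have "f * g = f0 * g0 + p * (f0 * W' + W * g0)
      + p * p * (W * W' + f0 * R' + R * g0 + p * W * R' + p * R * W' + p * p * R * R')"
    by (simp add: W algebra_simps)
  moreover have "free_of v (f0 * W' + W * g0)"
    using W f0 by (intro free_of_add free_of_mult)
  ultimately show ?thesis
    using f0 free_of_mult unfolding jet_def by blast
qed

lemma jet_power: "jet v p f0 f \<Longrightarrow> jet v p (f0 ^ s) (f ^ s)"
  by (induction s) (auto intro: jet_mult jet_free)

lemma jet_sum: "(\<And>i. i \<in> A \<Longrightarrow> jet v p (f0 i) (f i)) \<Longrightarrow> jet v p (sum f0 A) (sum f A)"
  by (induction A rule: infinite_finite_induct) (auto intro: jet_add jet_free)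

lemma jet_theta:
  assumes "jet v p f0 f" "fst v = 0"
  shows "jet v p (theta d k f0) (theta d k f)"
  unfolding theta_def
  by (intro jet_sum jet_mult jet_power jet_free assms) (use assms in \<open>simp add: lookup_ztrop\<close>)

lemma theta_zero: "theta d k 0 = 1"
proof -
  have "theta d k 0 = (\<Sum>s\<in>{0}. frag_of (ztrop d k s) * 0 ^ s)"
    unfolding theta_def by (rule sum.mono_neutral_right) auto
  then show ?thesis by (simp add: ztrop_def)
qed

lemma regular_mod_one: "regular_mod P 1"
  by (simp add: regular_mod_def)

text \<open>The weight \<open>\<mu>\<close> is a 2 by 2 minor with \<open>e j\<close> as first row.
  It vanishes on \<open>e j\<close> and on the z's and is positive on \<open>e k\<close>, so the
  first polynomial is homogeneous and the second has a single top monomial.\<close>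

lemma regular_mod_theta_theta:
  assumes ind: "independent_columns n e" and jk: "j < n" "k < n" "j \<noteq> k" and dk: "d k > 0"
  shows "regular_mod (theta d j (frag_of (e j))) (theta d k (frag_of (e k)))"
proof -
  let ?l = "\<lambda>i v. Poly_Mapping.lookup (e i) v"
  have two: "(\<Sum>i<n. (if i = j then a else if i = k then b else 0) * f i) = a * f j + b * f k"
    for a b :: int and f
  proof -
    have "(\<Sum>i<n. (if i = j then a else if i = k then b else 0) * f i)
        = (\<Sum>i\<in>{j, k}. (if i = j then a else if i = k then b else 0) * f i)"
      by (rule sum.mono_neutral_right) (use jk in auto)
    then show ?thesis using jk by simp
  qed
  have indD: "a = 0 \<and> b = 0" if "\<And>v. fst v \<noteq> 2 \<Longrightarrow> a * ?l j v + b * ?l k v = 0" for a b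
  proof -
    let ?c = "\<lambda>i. if i = j then a else if i = k then b else 0"
    have "?c i = 0" if "i < n" for i
      by (rule ind[unfolded independent_columns_def, rule_format, OF _ that])
        (unfold two, use \<open>\<And>v. fst v \<noteq> 2 \<Longrightarrow> a * ?l j v + b * ?l k v = 0\<close> in blast)
    from this[of j] this[of k] jk show ?thesis by auto
  qed
  obtain u where u: "fst u \<noteq> 2" "?l j u \<noteq> 0"
    using indD[of 1 0] by auto
  \<comment> \<open>If all minors with column \<open>u\<close> vanished, these coefficients would be
    a relation between \<open>e j\<close> and \<open>e k\<close> in which \<open>?l j u\<close> is
    nonzero.\<close>
  obtain v where v: "fst v \<noteq> 2" "?l j u * ?l k v - ?l k u * ?l j v \<noteq> 0"
    using indD[of "- ?l k u" "?l j u"] u by (auto simp: algebra_simps)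
  define q where "q = ?l j u * ?l k v - ?l k u * ?l j v"
  define \<mu> where "\<mu> m = sgn q * (?l j u * Poly_Mapping.lookup m v - ?l j v * Poly_Mapping.lookup m u)" for m
  have add: "\<mu> (a + b) = \<mu> a + \<mu> b" for a b
    by (simp add: \<mu>_def lookup_add algebra_simps)
  have z: "\<mu> (ztrop d i s) = 0" for i s
    using u v by (simp add: \<mu>_def lookup_ztrop)
  have cm: "\<mu> (frag_cmul c m) = c * \<mu> m" for c m
    by (simp add: \<mu>_def algebra_simps)
  have "\<mu> (e j) = 0" by (simp add: \<mu>_def algebra_simps)
  have "\<mu> (e k) = sgn q * q" by (simp add: \<mu>_def q_def algebra_simps)
  then have pos: "\<mu> (e k) > 0" using v by (simp add: q_def[symmetric] sgn_if)
  let ?top = "ztrop d k (d k) + frag_cmul (int (d k)) (e k)"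
  let ?Q0 = "\<Sum>s<d k. frag_of (ztrop d k s) * frag_of (e k) ^ s :: lpoly"
  have "theta d k (frag_of (e k)) = frag_of ?top + ?Q0"
    unfolding theta_def by (simp add: lessThan_Suc_atMost[symmetric] frag_of_power frag_of_mult)
  moreover have "regular_mod (theta d j (frag_of (e j))) (frag_of ?top + ?Q0)"
  proof (rule regular_mod_top[OF add])
    fix m assume "m \<in> Poly_Mapping.keys (theta d j (frag_of (e j)))"
    then show "\<mu> m = 0"
      by (rule keys_theta) (simp add: add z cm \<open>\<mu> (e j) = 0\<close>)
  next
    fix m assume "m \<in> Poly_Mapping.keys ?Q0"
    then obtain s where "s < d k" "m = ztrop d k s + frag_cmul (int s) (e k)"
      using keys_sum[of "\<lambda>s. frag_of (ztrop d k s) * frag_of (e k) ^ s :: lpoly" "{..<d k}"]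
      by (auto simp: frag_of_power frag_of_mult)
    then show "\<mu> m < \<mu> ?top" using pos by (simp add: add z cm)
  qed
  ultimately show ?thesis by simp
qed

text \<open>In the grading by the exponent of \<open>v\<close>, \<open>P\<close> and
  \<open>W\<close> have degree 0 and \<open>frag_of w\<close> is the top term; adding a multiple of
  \<open>P\<close> does not affect regularity modulo \<open>P\<close>.\<close>

lemma regular_mod_second_exchange:
  assumes P: "free_of v P" and w: "Poly_Mapping.lookup w v = 1" and W: "free_of v W"
  shows "regular_mod (frag_of u * P) (frag_of w + W + frag_of u * P * R)"
proof -
  have "regular_mod P (frag_of w + W)"
  proof (rule regular_mod_top[where \<mu> = "\<lambda>m. Poly_Mapping.lookup m v"])
    show "Poly_Mapping.lookup m v = 0" if "m \<in> Poly_Mapping.keys P" for m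
      using P that by (simp add: free_of_def)
    show "Poly_Mapping.lookup m v < Poly_Mapping.lookup w v" if "m \<in> Poly_Mapping.keys W" for m
      using W w that by (simp add: free_of_def)
  qed (simp add: lookup_add)
  then show ?thesis by (intro regular_mod_cong regular_mod_associate)
qed

text \<open>Modulo \<open>p1\<close>, which does not involve \<open>x\<^sub>j\<close> up to a unit, the polynomial \<open>p2\<close> is a unit (or, if
  \<open>b\<^sub>j\<^sub>k = 0\<close>, the exchange polynomial at \<open>k\<close>), and \<open>p3\<close> is, up to a unit, a monomial of degree 1 in
  \<open>x\<^sub>j\<close> plus a term free of \<open>x\<^sub>j\<close>. Divisibility by \<open>p1\<close> in the definition of \<open>p3\<close> rests on the palindromic
  coefficients \<open>z\<close>.\<close>
lemma rank_two_exchange: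
  fixes V :: "pvar \<Rightarrow> 'f::field"
  assumes good: "good_seed n V e" and jk: "j < n" "k < n" "j \<noteq> k" and dk: "d k > 0"
    and \<beta>: "exchange_mon n d j e \<beta>"
  defines "e1 \<equiv> mutE d j \<beta> e" and "V1 \<equiv> mutV d j \<beta> e V"
  assumes \<beta>1: "exchange_mon n d k e1 \<beta>1"
  defines "e2 \<equiv> mutE d k \<beta>1 e1" and "V2 \<equiv> mutV d k \<beta>1 e1 V1"
  assumes \<beta>2: "exchange_mon n d j e2 \<beta>2"
  defines "V3 \<equiv> mutV d j \<beta>2 e2 V2"
  obtains p1 p2 p3 where
    "V1 = V(vx j := evalL p1 V)" "V3 = V(vx j := evalL p3 V, vx k := evalL p2 V)"
    "regular_mod p1 p2" "regular_mod p1 p3"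
proof -
  let ?l = Poly_Mapping.lookup
  have good1: "good_seed n V1 e1" unfolding V1_def e1_def by (rule good_seed_mut[OF good jk(1) \<beta>])
  have good2: "good_seed n V2 e2" unfolding V2_def e2_def by (rule good_seed_mut[OF good1 jk(2) \<beta>1])
  have nz: "nz V" "nz V1" "nz V2" using good good1 good2 by (auto simp: good_seed_def)
  have sk: "skew_symmetrizable n (exch_matrix e)" using good by (simp add: good_seed_def)
  have lj: "?l (e j) (vx j) = 0" "?l (e k) (vx k) = 0" "?l \<beta> (vx j) = 0"
    using skew_symmetrizableD(1)[OF sk] jk \<beta> by (auto simp: exch_matrix_def exchange_mon_def pos_def)
  \<comment> \<open>\<open>c\<close> and \<open>a\<close> are the matrix entries b_jk and b_kj after
    the mutation at \<open>j\<close>.\<close>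
  define c where "c = - ?l (e k) (vx j)"
  define a where "a = - ?l (e j) (vx k)"
  have ca: "c > 0 \<longleftrightarrow> a < 0" "c = 0 \<longleftrightarrow> a = 0"
    using skew_symmetrizableD(2)[OF sk jk(2,1)] skew_symmetrizableD(3)[OF sk jk(1,2)]
    by (auto simp: c_def a_def exch_matrix_def)
  have e1j: "e1 j = - e j" by (simp add: e1_def mutE_def)
  have c: "?l (e1 k) (vx j) = c"
    using jk lj by (simp add: e1_def lookup_mutE exch_matrix_def c_def)
  have \<beta>1k: "?l \<beta>1 (vx k) = 0" "?l \<beta>1 (vx j) = int (d k) * pos (- c)"
  proof -
    have "?l (e1 k) (vx k) = 0"
      using skew_symmetrizableD(1)[of n "exch_matrix e1" k] good1 jk by (auto simp: good_seed_def exch_matrix_def)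
    then show "?l \<beta>1 (vx k) = 0" "?l \<beta>1 (vx j) = int (d k) * pos (- c)"
      using \<beta>1 jk c by (auto simp: exchange_mon_def pos_def)
  qed
  have e2j: "e2 j = - e j + frag_cmul (int (d k) * pos a) (e1 k) + frag_cmul a (\<beta>1 - frag_cmul 2 (frag_of (vx k)))"
    using jk by (simp add: e2_def mutE_def e1j a_def)
  have a: "?l (e2 j) (vx k) = - a"
    using jk by (simp add: e2_def lookup_mutE e1j exch_matrix_def \<beta>1k a_def e1j)
      (use skew_symmetrizableD(1)[of n "exch_matrix e1" k] good1 in \<open>auto simp: good_seed_def exch_matrix_def\<close>)
  have e2jj: "?l (e2 j) (vx j) = 0" "?l \<beta>2 (vx j) = 0" "?l \<beta>2 (vx k) = int (d j) * pos (- ?l (e2 j) (vx k))"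
  proof -
    show "?l (e2 j) (vx j) = 0"
      using skew_symmetrizableD(1)[of n "exch_matrix e2" j] good2 jk by (auto simp: good_seed_def exch_matrix_def)
    then show "?l \<beta>2 (vx j) = 0" "?l \<beta>2 (vx k) = int (d j) * pos (- ?l (e2 j) (vx k))"
      using \<beta>2 jk by (auto simp: exchange_mon_def pos_def)
  qed

  define P where "P = theta d j (frag_of (e j))"
  define u where "u = \<beta> - frag_of (vx j)"
  define p1 where "p1 = frag_of u * P"
  have freeP: "free_of (vx j) P"
    unfolding P_def theta_def
    by (intro free_of_mult free_of_sum free_of_power) (auto simp: lookup_ztrop lj)
  have p1: "V1 = V(vx j := evalL p1 V)"
    using nz by (simp add: V1_def mutV_def p1_def P_def u_def evalL_theta evalM_diff)
  have p1_nz: "evalL p1 V \<noteq> 0" using nz(2)[rule_format, of "vx j"] p1 by simp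

  define r where "r = (if 0 \<le> c then e1 k - frag_cmul c (frag_of (vx j)) else - (e1 k - frag_cmul c (frag_of (vx j))))"
  define \<tau> where "\<tau> = (if 0 \<le> c then \<beta>1 else \<beta>1 + frag_cmul (int (d k)) (e1 k))"
  \<comment> \<open>The exchange polynomial at \<open>k\<close> over \<open>V\<close>, stripped of a
    monomial: x_j' has become \<open>p1\<close>, and \<open>r\<close> is the rest of the y-hat
    exponent, inverted if that is needed to make the power of \<open>p1\<close> nonnegative.\<close>
  define h where "h = theta d k (frag_of r * p1 ^ nat \<bar>c\<bar>)"
  define p2 where "p2 = frag_of (\<tau> - frag_of (vx k)) * h"
  have "evalM V1 \<beta>1 * theta_at d k V1 (evalM V1 (e1 k)) = evalL (frag_of \<tau> * h) V"
    using mutated_value[OF nz(1) p1_nz, of "vx j" \<beta>1 d k "e1 k"] \<beta>1k c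
    unfolding p1[symmetric] \<tau>_def h_def r_def by simp
  then have p2: "V2 = V1(vx k := evalL p2 V)"
    using nz jk by (simp add: V2_def mutV_def p2_def evalM_diff) (simp add: p1)
  have p2_nz: "evalL p2 V \<noteq> 0" using nz(3)[rule_format, of "vx k"] p2 by simp
  let ?Vk = "V(vx k := evalL p2 V)"
  have Vk: "evalM V2 m = evalM ?Vk m" if "?l m (vx j) = 0" for m
    by (rule evalM_cong) (use that in \<open>auto simp: p2 p1 in_keys_iff\<close>)
  have th: "theta_at d j V2 = theta_at d j ?Vk"
    by (rule theta_at_cong) (auto simp: p2 p1)

  \<comment> \<open>In the third mutation the monomials coming from x_k' = \<open>p2\<close> cancel
    those in \<open>e2 j\<close>; the argument of the exchange polynomial is left as
    \<open>e j\<close> or its inverse, times a power of \<open>h\<close>.\<close>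
  define w where "w = (if 0 \<le> - a then - e j else e j)"
  define \<kappa> where "\<kappa> = (if 0 \<le> - a then \<beta>2 else \<beta>2 + frag_cmul (int (d j)) (e2 j))"
  define N where "N = theta d j (frag_of w * h ^ nat \<bar>a\<bar>)"
  have "evalM V2 \<beta>2 * theta_at d j V2 (evalM V2 (e2 j)) = evalL (frag_of \<kappa> * N) V"
  proof -
    define r' where "r' = (if 0 \<le> - a then e2 j - frag_cmul (- a) (frag_of (vx k)) else - (e2 j - frag_cmul (- a) (frag_of (vx k))))"
    have "evalM V2 \<beta>2 * theta_at d j V2 (evalM V2 (e2 j))
        = evalL (frag_of \<kappa> * theta d j (frag_of r' * p2 ^ nat \<bar>a\<bar>)) V"
      using mutated_value[OF nz(1) p2_nz, of "vx k" \<beta>2 d j "e2 j"] e2jj a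
      unfolding \<kappa>_def r'_def th by (simp add: Vk)
    moreover have "r' + frag_cmul \<bar>a\<bar> (\<tau> - frag_of (vx k)) = w"
    proof (cases "0 \<le> - a")
      case True
      then have "0 \<le> c" using ca by linarith
      show ?thesis
        by (rule poly_mapping_eqI)
          (use True \<open>0 \<le> c\<close> in \<open>simp add: r'_def \<tau>_def w_def e2j lookup_add lookup_minus pos_def max_def algebra_simps\<close>)
    next
      case False
      then have "c < 0" using ca by linarith
      show ?thesis
        by (rule poly_mapping_eqI)
          (use False \<open>c < 0\<close> in \<open>simp add: r'_def \<tau>_def w_def e2j lookup_add lookup_minus pos_def max_def algebra_simps\<close>)
    qed
    then have "frag_of r' * p2 ^ nat \<bar>a\<bar> = frag_of w * h ^ nat \<bar>a\<bar>"
      by (simp add: p2_def power_mult_distrib frag_of_power frag_of_mult flip: mult.assoc)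
    ultimately show ?thesis by (simp add: N_def)
  qed
  then have V3j: "V3 = V2(vx j := evalL (frag_of \<kappa> * N) V / evalL p1 V)"
    using jk by (simp add: V3_def mutV_def) (simp add: p1 p2)

  \<comment> \<open>Because z_{k,0} = 1, setting \<open>p1\<close> to 0 turns \<open>h\<close> into
    1.\<close>
  have jet_h: "jet (vx j) p1 1 h" if "c \<noteq> 0"
  proof -
    have "?l r (vx j) = 0" by (simp add: r_def lookup_minus c)
    then have "jet (vx j) p1 (frag_of r * 0 ^ nat \<bar>c\<bar>) (frag_of r * p1 ^ nat \<bar>c\<bar>)"
      by (intro jet_mult jet_power jet_self jet_free) simp
    then have "jet (vx j) p1 (theta d k (frag_of r * 0 ^ nat \<bar>c\<bar>)) h"
      unfolding h_def by (rule jet_theta) simp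
    then show ?thesis using that by (simp add: theta_zero power_0_left)
  qed
  have "jet (vx j) p1 1 (h ^ nat \<bar>a\<bar>)"
  proof (cases "c = 0")
    case True
    then show ?thesis using ca by (simp add: jet_free)
  next
    case False
    from jet_power[OF jet_h[OF this], of "nat \<bar>a\<bar>"] show ?thesis by simp
  qed
  then have "jet (vx j) p1 (theta d j (frag_of w * 1)) N"
    unfolding N_def by (intro jet_theta jet_mult jet_free) (auto simp: w_def lj)
  then obtain W R where W: "free_of (vx j) W" and N: "N = theta d j (frag_of w) + p1 * W + p1 * p1 * R"
    by (auto simp: jet_def)
  \<comment> \<open>The unit by which \<open>theta d j (frag_of w)\<close> differs from
    \<open>p1\<close>; if \<open>w\<close> is \<open>- e j\<close>, \<open>theta_uminus\<close>
    supplies a factor. Since x_j has exponent -1 in \<open>u\<close>, it has exponent 1 in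
    \<open>w'\<close>.\<close>
  define w' where "w' = (if 0 \<le> - a then - frag_cmul (int (d j)) (e j) else 0) - u"
  have w': "theta d j (frag_of w) = p1 * frag_of w'" "?l w' (vx j) = 1"
    by (auto simp: w_def w'_def u_def p1_def P_def theta_uminus lookup_minus lj frag_of_mult
        simp flip: mult.assoc)
  define p3 where "p3 = frag_of \<kappa> * (frag_of w' + W + p1 * R)"
  have "frag_of \<kappa> * N = p1 * p3" by (simp add: p3_def N w' algebra_simps)
  then have "V3 = V2(vx j := evalL p3 V)"
    using nz p1_nz by (simp add: V3j)
  then have V3: "V3 = V(vx j := evalL p3 V, vx k := evalL p2 V)"
    using jk by (auto simp: p1 p2 fun_eq_iff)
  have "regular_mod p1 p3"
    unfolding p3_def p1_def
    by (intro regular_mod_mult regular_mod_frag_of regular_mod_second_exchange[OF freeP w'(2) W])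
  moreover have "regular_mod p1 h"
  proof (cases "c = 0")
    case True
    have "e1 k = e k" using True jk by (simp add: e1_def mutE_def c_def pos_def)
    then have "h = theta d k (frag_of (e k))" using True by (simp add: h_def r_def)
    moreover have "regular_mod P (theta d k (frag_of (e k)))"
      unfolding P_def using good jk dk by (intro regular_mod_theta_theta[of n]) (auto simp: good_seed_def)
    ultimately show ?thesis unfolding p1_def by (simp add: regular_mod_associate)
  next
    case False
    from jet_h[OF this] obtain W R where "h = 1 + p1 * W + p1 * p1 * R" by (auto simp: jet_def)
    then have "h = 1 + p1 * (W + p1 * R)" by (simp add: algebra_simps)
    then show ?thesis using regular_mod_cong[OF regular_mod_one] by simp
  qed
  then have "regular_mod p1 p2"
    unfolding p2_def by (intro regular_mod_mult regular_mod_frag_of)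
  ultimately show thesis using that p1 V3 by blast
qed

inductive mutation_path :: "nat \<Rightarrow> (nat \<Rightarrow> nat) \<Rightarrow> nat \<Rightarrow> (pvar \<Rightarrow> 'f::field) \<Rightarrow> (nat \<Rightarrow> tmon)
    \<Rightarrow> (pvar \<Rightarrow> 'f) \<Rightarrow> (nat \<Rightarrow> tmon) \<Rightarrow> bool" for n d where
  nil: "mutation_path n d 0 V e V e"
| step: "k < n \<Longrightarrow> exchange_mon n d k e \<beta> \<Longrightarrow> mutation_path n d N (mutV d k \<beta> e V) (mutE d k \<beta> e) V' e'
    \<Longrightarrow> mutation_path n d (Suc N) V e V' e'"

lemma mutation_path_snoc:
  assumes "mutation_path n d N V e V' e'" "k < n" "exchange_mon n d k e' \<beta>"
  shows "mutation_path n d (Suc N) V e (mutV d k \<beta> e' V') (mutE d k \<beta> e')"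
  using assms by (induction rule: mutation_path.induct) (auto intro: mutation_path.intros)

lemma exchange_mon_exists: "\<exists>\<beta>. exchange_mon n d k e \<beta>"
proof -
  have lookup: "Poly_Mapping.lookup (\<Sum>j<n. frag_cmul (b j) (frag_of (vx j))) (vx i) = b i" if "i < n" for b i
    using that by (simp add: lookup_sum lookup_single when_def if_distrib[of "(*) _"] cong: if_cong)
  show ?thesis unfolding exchange_mon_def
    by (rule exI[of _ "\<Sum>j<n. frag_cmul (int (d k) * pos (- Poly_Mapping.lookup (e k) (vx j))) (frag_of (vx j))"])
      (simp add: lookup)
qed

theorem laurent_phenomenon:
  fixes V :: "pvar \<Rightarrow> 'f::field"
  assumes "good_seed n V e" "mutation_path n d N V e V' e'" "\<And>k. k < n \<Longrightarrow> d k > 0"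
  shows "\<exists>p. V' v = evalL p V"
  using assms(1,2)
proof (induction N arbitrary: V e rule: less_induct)
  case (less N)
  have V: "nz V" and inj: "\<And>p. evalL p V = 0 \<Longrightarrow> p = 0"
    using less.prems by (auto simp: good_seed_def)
  from less.prems(2) show ?case
  proof cases
    case nil
    then show ?thesis by (metis evalL_of evalM_of)
  next
    case (step j \<beta> M)
    note M = step
    define V1 where "V1 = mutV d j \<beta> e V"
    define e1 where "e1 = mutE d j \<beta> e"
    have good1: "good_seed n V1 e1"
      unfolding V1_def e1_def using less.prems step by (intro good_seed_mut)
    obtain q1 where q1: "V' v = evalL q1 V1"
      using less.IH[of M, OF _ good1] step unfolding V1_def e1_def by auto
    define p1 where "p1 = frag_of (\<beta> - frag_of (vx j)) * theta d j (frag_of (e j))"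
    have V1: "V1 = V(vx j := evalL p1 V)"
      using V by (simp add: V1_def mutV_def p1_def evalL_theta evalM_diff)
    have mono: "\<exists>g. V x = evalL g V" for x
      by (rule exI[of _ "frag_of (frag_of x)"]) simp
    from step(4) show ?thesis
    proof cases
      case nil
      have "V' v = V1 v" using nil by (simp add: V1_def)
      then show ?thesis using mono by (cases "v = vx j") (auto simp: V1)
    next
      case (step k \<beta>1 M')
      define V2 where "V2 = mutV d k \<beta>1 e1 V1"
      define e2 where "e2 = mutE d k \<beta>1 e1"
      have good2: "good_seed n V2 e2"
        unfolding V2_def e2_def using good1 step by (intro good_seed_mut) (auto simp: e1_def)
      have path2: "mutation_path n d M' V2 e2 V' e'"
        using step by (simp add: V2_def e2_def V1_def e1_def)
      show ?thesis
      proof (cases "k = j")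
        case True
        \<comment> \<open>going back and forth along \<open>j\<close> rescales \<open>x\<^sub>j\<close> by a coefficient monomial\<close>
        obtain q2 where q2: "V' v = evalL q2 V2"
          using less.IH[of M', OF _ good2 path2] M step by auto
        have ex: "exchange_mon n d j (mutE d j \<beta> e) (\<beta> + frag_cmul (int (d j)) (e j))"
          using M by (intro exchange_mon_involution)
        have "mutV d j (\<beta> + frag_cmul (int (d j)) (e j)) e1 V1 = V"
          unfolding V1_def e1_def using less.prems M by (intro mutV_involution)
        then have eqV: "V1(vx j := evalM V1 (\<beta> + frag_cmul (int (d j)) (e j)) * theta_at d j V1 (evalM V1 (e1 j)) / V1 (vx j)) = V"
          by (simp add: mutV_def)
        define T where "T = theta_at d j V1 (evalM V1 (e1 j)) / V1 (vx j)"
        have nz1: "nz V1" using good1 by (simp add: good_seed_def)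
        have V2: "V2 = V(vx j := evalM V1 \<beta>1 * T)"
          using True by (simp add: V2_def mutV_def T_def V1)
        have "V (vx j) = evalM V1 (\<beta> + frag_cmul (int (d j)) (e j)) * T"
          using eqV unfolding T_def by (metis fun_upd_same times_divide_eq_right)
        then have "evalM V1 \<beta>1 * T = evalM V1 (\<beta>1 - (\<beta> + frag_cmul (int (d j)) (e j))) * V (vx j)"
          using nz1 by (simp add: evalM_diff)
        moreover define m where "m = \<beta>1 - (\<beta> + frag_cmul (int (d j)) (e j))"
        moreover have "evalM V1 m = evalM V m"
        proof (rule evalM_cong)
          have "Poly_Mapping.lookup (e j) (vx j) = 0"
            using less.prems M skew_symmetrizableD(1)[of n "exch_matrix e" j]
            by (auto simp: good_seed_def exch_matrix_def)
          then have "Poly_Mapping.lookup m (vx j) = 0"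
            using M step True by (simp add: m_def lookup_minus lookup_add exchange_mon_def pos_def e1_def lookup_mutE)
          then show "V1 x = V x" if "x \<in> Poly_Mapping.keys m" for x
            using that by (auto simp: V1 in_keys_iff)
        qed
        ultimately have V2': "V2 = V(vx j := evalM V (m + frag_of (vx j)))"
          using V by (simp add: V2 evalM_add)
        \<comment> \<open>Denominator 1: every value of \<open>V2\<close> is a Laurent monomial in
          \<open>V\<close>.\<close>
        have "\<exists>N q. evalL q2 V2 * evalL 1 V ^ N = evalL q V"
        proof (rule evalL_clear_denominators[OF V])
          show "nz V2" using good2 by (simp add: good_seed_def)
          fix x
          have "\<exists>w. V2 x = evalM V w"
            unfolding V2' by (metis evalM_of fun_upd_apply)
          then obtain w where "V2 x = evalM V w" ..
          then show "\<exists>g g'. V2 x = evalL g V \<and> V2 x * evalL g' V = evalL 1 V"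
            using V by (intro exI[of _ "frag_of w"] exI[of _ "frag_of (- w)"]) (simp add: evalM_uminus)
        qed simp
        then show ?thesis using q2 by auto
      next
        case False
        obtain \<beta>2 where \<beta>2: "exchange_mon n d j e2 \<beta>2" using exchange_mon_exists by blast
        define V3 where "V3 = mutV d j \<beta>2 e2 V2"
        define e3 where "e3 = mutE d j \<beta>2 e2"
        have good3: "good_seed n V3 e3"
          unfolding V3_def e3_def using good2 M \<beta>2 by (intro good_seed_mut)
        have "exch_matrix e2 j j = 0"
          using good2 M skew_symmetrizableD(1) unfolding good_seed_def by blast
        \<comment> \<open>From \<open>V3\<close> the path goes back along \<open>j\<close> to
          \<open>V2\<close> and on to the end: \<open>Suc M'\<close> steps, against
          \<open>Suc (Suc M')\<close> from \<open>V\<close>.\<close>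
        then have "mutation_path n d (Suc M') V3 e3 V' e'"
          using path2 M \<beta>2 good2
          by (intro mutation_path.step[of j _ _ _ "\<beta>2 + frag_cmul (int (d j)) (e2 j)"])
            (simp_all add: V3_def e3_def exchange_mon_involution mutV_involution mutE_involution)
        then obtain q3 where q3: "V' v = evalL q3 V3"
          using less.IH[of "Suc M'", OF _ good3] M step by auto
        obtain p p2 p3 where p: "V1 = V(vx j := evalL p V)" "V3 = V(vx j := evalL p3 V, vx k := evalL p2 V)"
          "regular_mod p p2" "regular_mod p p3"
          using rank_two_exchange[of n V e j k d \<beta> \<beta>1 \<beta>2] less.prems M step False \<beta>2 assms(3)[of k]
          unfolding V1_def V2_def V3_def e1_def e2_def by metis
        have nz: "nz V1" "nz V3" using good1 good3 by (auto simp: good_seed_def)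
        have pnz: "evalL p V \<noteq> 0" "evalL p2 V \<noteq> 0" "evalL p3 V \<noteq> 0"
          using nz(1)[rule_format, of "vx j"] nz(2)[rule_format, of "vx j"]
            nz(2)[rule_format, of "vx k"] False by (auto simp: p)
        have inv: "\<exists>g g'. V x = evalL g V \<and> V x * evalL g' V = evalL Q V" for x Q
          by (rule exI[of _ "frag_of (frag_of x)"], rule exI[of _ "frag_of (- frag_of x) * Q"])
            (use V in \<open>simp add: evalM_uminus\<close>)
        have "\<exists>N q. evalL q1 V1 * evalL p V ^ N = evalL q V"
        proof (rule evalL_clear_denominators[OF V nz(1) pnz(1)])
          fix x
          have "\<exists>g g'. evalL p V = evalL g V \<and> evalL p V * evalL g' V = evalL p V"
            by (intro exI[of _ p] exI[of _ 1]) simp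
          then show "\<exists>g g'. V1 x = evalL g V \<and> V1 x * evalL g' V = evalL p V"
            using inv[of x p] by (simp add: p)
        qed
        moreover have "\<exists>N q. evalL q3 V3 * evalL (p2 * p3) V ^ N = evalL q V"
        proof (rule evalL_clear_denominators[OF V nz(2)])
          show "evalL (p2 * p3) V \<noteq> 0" using V pnz by simp
          fix x
          have "\<exists>g g'. evalL p2 V = evalL g V \<and> evalL p2 V * evalL g' V = evalL (p2 * p3) V"
            using V by (intro exI[of _ p2] exI[of _ p3]) simp
          moreover have "\<exists>g g'. evalL p3 V = evalL g V \<and> evalL p3 V * evalL g' V = evalL (p2 * p3) V"
            using V by (intro exI[of _ p3] exI[of _ p2]) simp
          ultimately show "\<exists>g g'. V3 x = evalL g V \<and> V3 x * evalL g' V = evalL (p2 * p3) V"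
            using inv[of x "p2 * p3"] by (simp add: p)
        qed
        moreover have "p \<noteq> 0" "p2 * p3 \<noteq> 0" using pnz by auto
        ultimately show ?thesis
          using common_denominator[OF V inj regular_mod_mult[OF p(3,4)]] q1 q3 by metis
      qed
    qed
  qed
qed

section \<open>Subtraction-free expressions in a semifield\<close>

locale semifield_ctx =
  fixes S :: "'p semifield_ops"
  assumes semifield: "semifield S"
begin

sublocale sm: comm_monoid_set "smul S" "sone S"
  using semifield unfolding semifield_def by unfold_locales metis+

sublocale sm: group "smul S" "sone S" "sinv S"
  using semifield unfolding semifield_def by unfold_locales metis+

sublocale sp: abel_semigroup "splus S"
  using semifield unfolding semifield_def by unfold_locales metis+

lemma smul_splus: "smul S a (splus S b c) = splus S (smul S a b) (smul S a c)"
  using semifield by (simp add: semifield_def)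

lemma splus_smul: "smul S (splus S b c) a = splus S (smul S b a) (smul S c a)"
  using smul_splus[of a b c] by (simp add: sm.commute)

lemma sinv_smul: "sinv S (smul S a b) = smul S (sinv S a) (sinv S b)"
  by (simp add: sm.inverse_distrib_swap sm.commute)

lemma spow_0 [simp]: "spow S a 0 = sone S"
  by (simp add: spow_def)

lemma spow_Suc: "spow S a (Suc k) = smul S a (spow S a k)"
  by (simp add: spow_def)

lemma spowi_0 [simp]: "spowi S a 0 = sone S"
  by (simp add: spowi_def)

lemma spowi_add_1: "spowi S a (k + 1) = smul S a (spowi S a k)"
proof (cases "0 \<le> k")
  case True
  then show ?thesis by (simp add: spowi_def nat_add_distrib spow_Suc)
next
  case False
  then obtain m where k: "k = - int (Suc m)"
    by (metis not_le int_cases4 nat_int_comparison(2) negD of_nat_Suc)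
  have neg: "spowi S a (- int l) = sinv S (spow S a l)" for l
    by (cases "l = 0") (simp_all add: spowi_def)
  have "spowi S a (k + 1) = sinv S (spow S a m)"
    using neg[of m] by (simp add: k)
  moreover have "spowi S a k = sinv S (smul S a (spow S a m))"
    unfolding k neg spow_Suc ..
  ultimately show ?thesis by (simp add: sinv_smul flip: sm.assoc)
qed

lemma spowi_1 [simp]: "spowi S a 1 = a"
  using spowi_add_1[of a 0] by simp

lemma spowi_diff_1: "spowi S a (k - 1) = smul S (sinv S a) (spowi S a k)"
  using spowi_add_1[of a "k - 1"] by (simp flip: sm.assoc)

lemma spowi_add: "spowi S a (k + l) = smul S (spowi S a k) (spowi S a l)"
proof (induction k rule: int_induct[of _ 0])
  case (step1 k)
  have "spowi S a (k + 1 + l) = smul S a (spowi S a (k + l))"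
    using spowi_add_1[of a "k + l"] by (simp add: ac_simps)
  then show ?case using step1 by (simp add: spowi_add_1 sm.assoc)
next
  case (step2 k)
  have "spowi S a (k - 1 + l) = smul S (sinv S a) (spowi S a (k + l))"
    using spowi_diff_1[of a "k + l"] by (simp add: algebra_simps)
  then show ?case using step2 by (simp add: spowi_diff_1 sm.assoc)
qed simp

lemma spowi_smul: "spowi S (smul S a b) k = smul S (spowi S a k) (spowi S b k)"
  by (induction k rule: int_induct[of _ 0])
    (simp_all add: spowi_add_1 spowi_diff_1 sinv_smul sm.assoc sm.left_commute)

lemma spowi_sone [simp]: "spowi S (sone S) k = sone S"
  by (induction k rule: int_induct[of _ 0]) (simp_all add: spowi_add_1 spowi_diff_1)

section \<open>Values of Laurent monomials in a semifield\<close>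

definition monS :: "(pvar \<Rightarrow> 'p) \<Rightarrow> tmon \<Rightarrow> 'p" where
  "monS Q m = sm.F (\<lambda>v. spowi S (Q v) (Poly_Mapping.lookup m v)) (Poly_Mapping.keys m)"

lemma monS_superset:
  assumes "finite A" "Poly_Mapping.keys m \<subseteq> A"
  shows "monS Q m = sm.F (\<lambda>v. spowi S (Q v) (Poly_Mapping.lookup m v)) A"
  unfolding monS_def by (rule sm.mono_neutral_left) (use assms in \<open>auto simp: in_keys_iff\<close>)

lemma monS_zero [simp]: "monS Q 0 = sone S"
  by (simp add: monS_def)

lemma monS_of [simp]: "monS Q (frag_of v) = Q v"
  by (simp add: monS_def)

lemma monS_add: "monS Q (a + b) = smul S (monS Q a) (monS Q b)"
proof -
  let ?A = "Poly_Mapping.keys a \<union> Poly_Mapping.keys b"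
  have "monS Q (a + b) = sm.F (\<lambda>v. spowi S (Q v) (Poly_Mapping.lookup (a + b) v)) ?A"
    by (rule monS_superset) (auto dest: subsetD[OF keys_add])
  then show ?thesis
    by (simp add: lookup_add spowi_add sm.distrib monS_superset[of ?A])
qed

lemma monS_uminus: "monS Q (- a) = sinv S (monS Q a)"
  using monS_add[of Q a "- a"] by (simp add: sm.inverse_unique)

lemma monS_diff: "monS Q (a - b) = smul S (monS Q a) (sinv S (monS Q b))"
  using monS_add[of Q a "- b"] by (simp add: monS_uminus)

lemma monS_cmul: "monS Q (frag_cmul c m) = spowi S (monS Q m) c"
proof (induction c rule: int_induct[of _ 0])
  case (step1 c)
  then show ?case
    by (simp add: frag_cmul_distrib monS_add spowi_add_1 sm.commute)
next
  case (step2 c)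
  then show ?case
    using frag_cmul_distrib[of c "- 1" m]
    by (simp add: monS_diff spowi_diff_1 sm.commute)
qed simp

lemma monS_cong: "(\<And>v. v \<in> Poly_Mapping.keys m \<Longrightarrow> Q v = Q' v) \<Longrightarrow> monS Q m = monS Q' m"
  unfolding monS_def by (rule sm.cong) auto

lemma monS_upd:
  "monS (Q(v := a)) m = smul S (monS Q (m - frag_cmul (Poly_Mapping.lookup m v) (frag_of v))) (spowi S a (Poly_Mapping.lookup m v))"
proof -
  let ?r = "m - frag_cmul (Poly_Mapping.lookup m v) (frag_of v)"
  have "monS (Q(v := a)) m = monS (Q(v := a)) (?r + frag_cmul (Poly_Mapping.lookup m v) (frag_of v))"
    by simp
  also have "\<dots> = smul S (monS (Q(v := a)) ?r) (spowi S a (Poly_Mapping.lookup m v))"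
    by (subst monS_add) (simp add: monS_cmul)
  also have "monS (Q(v := a)) ?r = monS Q ?r"
    by (rule monS_cong) (auto simp: in_keys_iff lookup_minus)
  finally show ?thesis .
qed

lemma sbig_cong: "(\<And>s. s \<le> m \<Longrightarrow> f s = g s) \<Longrightarrow> sbig S f m = sbig S g m"
  by (induction m) simp_all

text \<open>The semifield with a zero adjoined, so that multisets of monomials can be summed.\<close>

fun oplus :: "'p option \<Rightarrow> 'p option \<Rightarrow> 'p option" where
  "oplus None y = y"
| "oplus x None = x"
| "oplus (Some a) (Some b) = Some (splus S a b)"

fun otimes :: "'p option \<Rightarrow> 'p option \<Rightarrow> 'p option" where
  "otimes (Some a) (Some b) = Some (smul S a b)"
| "otimes _ _ = None"

lemma oplus_None [simp]: "oplus x None = x"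
  by (cases x) auto

lemma otimes_None [simp]: "otimes x None = None"
  by (cases x) auto

sublocale os: comm_monoid_mset oplus None
proof
  show "oplus (oplus a b) c = oplus a (oplus b c)" for a b c
    by (cases a; cases b; cases c) (auto simp: sp.assoc)
  show "oplus a b = oplus b a" for a b
    by (cases a; cases b) (auto simp: sp.commute)
qed auto

lemma otimes_oplus: "otimes x (oplus y w) = oplus (otimes x y) (otimes x w)"
  by (cases x; cases y; cases w) (auto simp: smul_splus)

lemma oplus_otimes: "otimes (oplus y w) x = oplus (otimes y x) (otimes w x)"
  by (cases x; cases y; cases w) (auto simp: splus_smul)

definition msetS :: "(pvar \<Rightarrow> 'p) \<Rightarrow> tmon multiset \<Rightarrow> 'p option" where
  "msetS Q M = os.F (image_mset (\<lambda>m. Some (monS Q m)) M)"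

lemma msetS_simps [simp]:
  "msetS Q {#} = None" "msetS Q (add_mset m M) = oplus (Some (monS Q m)) (msetS Q M)"
  "msetS Q (M + N) = oplus (msetS Q M) (msetS Q N)"
  by (simp_all add: msetS_def)

lemma msetS_shift: "msetS Q (image_mset ((+) a) M) = otimes (Some (monS Q a)) (msetS Q M)"
  by (induction M) (simp_all add: otimes_oplus monS_add)

end

section \<open>Polynomials with nonnegative coefficients as multisets of monomials\<close>

definition mset_mult :: "tmon multiset \<Rightarrow> tmon multiset \<Rightarrow> tmon multiset" where
  "mset_mult A B = (\<Sum>a\<in>#A. image_mset ((+) a) B)"

definition mset_lpoly :: "tmon multiset \<Rightarrow> lpoly" where
  "mset_lpoly M = (\<Sum>m\<in>#M. frag_of m)"

lemma mset_mult_simps [simp]: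
  "mset_mult {#} B = {#}" "mset_mult (add_mset a A) B = image_mset ((+) a) B + mset_mult A B"
  by (simp_all add: mset_mult_def)

lemma mset_lpoly_simps [simp]:
  "mset_lpoly {#} = 0" "mset_lpoly (add_mset m M) = frag_of m + mset_lpoly M"
  "mset_lpoly (M + N) = mset_lpoly M + mset_lpoly N"
  by (simp_all add: mset_lpoly_def)

lemma lookup_mset_lpoly: "Poly_Mapping.lookup (mset_lpoly M) m = int (count M m)"
  by (induction M) (auto simp: lookup_add lookup_single when_def)

text \<open>Multiplicities are the coefficients, so an equation between such polynomials is one
  between multisets and can be evaluated without subtraction. They must be recorded, as \<oplus>
  need not be idempotent.\<close>

lemma mset_lpoly_inject: "mset_lpoly M = mset_lpoly N \<longleftrightarrow> M = N"
  by (metis lookup_mset_lpoly multiset_eqI of_nat_eq_iff)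

lemma mset_lpoly_eq_0 [simp]: "mset_lpoly M = 0 \<longleftrightarrow> M = {#}"
  using mset_lpoly_inject[of M "{#}"] by simp

lemma mset_lpoly_shift: "mset_lpoly (image_mset ((+) a) M) = frag_of a * mset_lpoly M"
  by (induction M) (simp_all add: frag_of_mult distrib_left)

lemma mset_lpoly_mult: "mset_lpoly (mset_mult A B) = mset_lpoly A * mset_lpoly B"
  by (induction A) (simp_all add: mset_lpoly_shift distrib_right)

lemma mset_mult_eq_empty: "mset_mult A B = {#} \<longleftrightarrow> A = {#} \<or> B = {#}"
  unfolding mset_lpoly_eq_0[symmetric] mset_lpoly_mult by (rule mult_eq_0_iff)

context semifield_ctx
begin

lemma msetS_mult: "msetS Q (mset_mult A B) = otimes (msetS Q A) (msetS Q B)"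
  by (induction A) (simp_all add: msetS_shift oplus_otimes)

text \<open>Fractions are combined by cross-multiplication. Nonempty multisets have nonzero
  polynomials and values other than the adjoined zero, so every division is legitimate on both
  sides.\<close>

lemma sfexpr_fraction:
  "\<exists>N D x y. N \<noteq> {#} \<and> D \<noteq> {#} \<and> sf_eval_field gen e = Fract (mset_lpoly N) (mset_lpoly D)
     \<and> msetS Q N = Some x \<and> msetS Q D = Some y \<and> sf_eval_sf S Q e = smul S x (sinv S y)"
proof (induction e)
  case (SFVar v)
  show ?case
    by (rule exI[of _ "{#frag_of v#}"], rule exI[of _ "{#0#}"]) (simp add: gen_def)
next
  case SFOne
  show ?case
    by (rule exI[of _ "{#0#}"], rule exI[of _ "{#0#}"]) (simp add: One_fract_def)
next
  case (SFAdd e1 e2)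
  then obtain N D x y N' D' x' y' where h: "N \<noteq> {#}" "D \<noteq> {#}" "sf_eval_field gen e1 = Fract (mset_lpoly N) (mset_lpoly D)"
    "msetS Q N = Some x" "msetS Q D = Some y" "sf_eval_sf S Q e1 = smul S x (sinv S y)"
    "N' \<noteq> {#}" "D' \<noteq> {#}" "sf_eval_field gen e2 = Fract (mset_lpoly N') (mset_lpoly D')"
    "msetS Q N' = Some x'" "msetS Q D' = Some y'" "sf_eval_sf S Q e2 = smul S x' (sinv S y')"
    by blast
  have 1: "smul S (smul S x y') (smul S (sinv S y) (sinv S y')) = smul S x (sinv S y)"
    by (metis sm.assoc sm.commute sm.right_inverse sm.right_neutral)
  have 2: "smul S (smul S x' y) (smul S (sinv S y) (sinv S y')) = smul S x' (sinv S y')"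
    by (metis sm.assoc sm.commute sm.right_inverse sm.right_neutral)
  show ?case
    by (rule exI[of _ "mset_mult N D' + mset_mult N' D"], rule exI[of _ "mset_mult D D'"])
      (simp add: h mset_mult_eq_empty mset_lpoly_mult msetS_mult splus_smul sinv_smul 1 2)
next
  case (SFMul e1 e2)
  then obtain N D x y N' D' x' y' where h: "N \<noteq> {#}" "D \<noteq> {#}" "sf_eval_field gen e1 = Fract (mset_lpoly N) (mset_lpoly D)"
    "msetS Q N = Some x" "msetS Q D = Some y" "sf_eval_sf S Q e1 = smul S x (sinv S y)"
    "N' \<noteq> {#}" "D' \<noteq> {#}" "sf_eval_field gen e2 = Fract (mset_lpoly N') (mset_lpoly D')"
    "msetS Q N' = Some x'" "msetS Q D' = Some y'" "sf_eval_sf S Q e2 = smul S x' (sinv S y')"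
    by blast
  show ?case
    by (rule exI[of _ "mset_mult N N'"], rule exI[of _ "mset_mult D D'"])
      (simp add: h mset_mult_eq_empty mset_lpoly_mult msetS_mult sinv_smul sm.assoc sm.left_commute)
next
  case (SFDiv e1 e2)
  then obtain N D x y N' D' x' y' where h: "N \<noteq> {#}" "D \<noteq> {#}" "sf_eval_field gen e1 = Fract (mset_lpoly N) (mset_lpoly D)"
    "msetS Q N = Some x" "msetS Q D = Some y" "sf_eval_sf S Q e1 = smul S x (sinv S y)"
    "N' \<noteq> {#}" "D' \<noteq> {#}" "sf_eval_field gen e2 = Fract (mset_lpoly N') (mset_lpoly D')"
    "msetS Q N' = Some x'" "msetS Q D' = Some y'" "sf_eval_sf S Q e2 = smul S x' (sinv S y')"
    by blast
  show ?case
    by (rule exI[of _ "mset_mult N D'"], rule exI[of _ "mset_mult D N'"])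
      (simp add: h mset_mult_eq_empty mset_lpoly_mult msetS_mult sinv_smul sm.assoc sm.left_commute sm.commute[of "sinv S x'"])
qed

lemma sf_eval_field_nonzero: "sf_eval_field gen e \<noteq> 0"
  using sfexpr_fraction[of e "\<lambda>_. sone S"] by (auto simp: Zero_fract_def eq_fract)

text \<open>After cross-multiplication, equality of the fractions is equality of two multisets, to
  which the multiplicative \<open>msetS\<close> applies.\<close>

theorem sf_eval_sf_well_defined:
  assumes "sf_eval_field gen e = sf_eval_field gen e'"
  shows "sf_eval_sf S Q e = sf_eval_sf S Q e'"
proof -
  obtain N D x y where h: "N \<noteq> {#}" "D \<noteq> {#}" "sf_eval_field gen e = Fract (mset_lpoly N) (mset_lpoly D)"
    "msetS Q N = Some x" "msetS Q D = Some y" "sf_eval_sf S Q e = smul S x (sinv S y)"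
    using sfexpr_fraction[of e Q] by blast
  obtain N' D' x' y' where h': "N' \<noteq> {#}" "D' \<noteq> {#}" "sf_eval_field gen e' = Fract (mset_lpoly N') (mset_lpoly D')"
    "msetS Q N' = Some x'" "msetS Q D' = Some y'" "sf_eval_sf S Q e' = smul S x' (sinv S y')"
    using sfexpr_fraction[of e' Q] by blast
  have "mset_lpoly N * mset_lpoly D' = mset_lpoly N' * mset_lpoly D"
    using assms h h' by (simp add: eq_fract)
  then have "mset_mult N D' = mset_mult N' D"
    by (simp add: mset_lpoly_mult flip: mset_lpoly_inject)
  then have "msetS Q (mset_mult N D') = msetS Q (mset_mult N' D)" by simp
  then have "smul S x y' = smul S x' y" by (simp add: msetS_mult h h')
  then have "smul S (smul S x y') (smul S (sinv S y) (sinv S y')) = smul S (smul S x' y) (smul S (sinv S y) (sinv S y'))"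
    by simp
  moreover have "smul S (smul S x y') (smul S (sinv S y) (sinv S y')) = smul S x (sinv S y)"
    "smul S (smul S x' y) (smul S (sinv S y) (sinv S y')) = smul S x' (sinv S y')"
    by (metis sm.assoc sm.commute sm.right_inverse sm.right_neutral)+
  ultimately show ?thesis by (simp add: h h')
qed

text \<open>The graph of evaluation in the semifield, single-valued by
  \<open>sf_eval_sf_well_defined\<close>. With its closure rules a recursion can be followed without
  writing down expressions.\<close>

definition sf_values :: "(pvar \<Rightarrow> 'p) \<Rightarrow> (pfield \<times> 'p) set" where
  "sf_values Q = {(a, b). \<exists>e. sf_vars e \<subseteq> {v. fst v = 1 \<or> fst v = 2}
     \<and> sf_eval_field gen e = a \<and> sf_eval_sf S Q e = b}"

lemma sf_valuesI:
  "sf_vars e \<subseteq> {v. fst v = 1 \<or> fst v = 2} \<Longrightarrow> (sf_eval_field gen e, sf_eval_sf S Q e) \<in> sf_values Q"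
  by (auto simp: sf_values_def)

lemma sf_valuesE:
  assumes "(a, b) \<in> sf_values Q"
  obtains e where "sf_vars e \<subseteq> {v. fst v = 1 \<or> fst v = 2}" "a = sf_eval_field gen e" "b = sf_eval_sf S Q e"
  using assms by (auto simp: sf_values_def)

lemma sf_values_nonzero: "(a, b) \<in> sf_values Q \<Longrightarrow> a \<noteq> 0"
  by (auto elim!: sf_valuesE simp: sf_eval_field_nonzero)

lemma sf_values_one: "(1, sone S) \<in> sf_values Q"
  using sf_valuesI[of SFOne Q] by simp

lemma sf_values_gen: "fst v = 1 \<or> fst v = 2 \<Longrightarrow> (gen v, Q v) \<in> sf_values Q"
  using sf_valuesI[of "SFVar v" Q] by simp

lemma sf_values_add: "(a, b) \<in> sf_values Q \<Longrightarrow> (a', b') \<in> sf_values Q \<Longrightarrow> (a + a', splus S b b') \<in> sf_values Q"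
  by (elim sf_valuesE) (use sf_valuesI[of "SFAdd _ _" Q] in simp)

lemma sf_values_mult: "(a, b) \<in> sf_values Q \<Longrightarrow> (a', b') \<in> sf_values Q \<Longrightarrow> (a * a', smul S b b') \<in> sf_values Q"
  by (elim sf_valuesE) (use sf_valuesI[of "SFMul _ _" Q] in simp)

lemma sf_values_divide: "(a, b) \<in> sf_values Q \<Longrightarrow> (a', b') \<in> sf_values Q \<Longrightarrow> (a / a', smul S b (sinv S b')) \<in> sf_values Q"
  by (elim sf_valuesE) (use sf_valuesI[of "SFDiv _ _" Q] in simp)

lemma sf_values_inverse: "(a, b) \<in> sf_values Q \<Longrightarrow> (inverse a, sinv S b) \<in> sf_values Q"
  using sf_values_divide[OF sf_values_one, of a b Q] by (simp add: divide_inverse)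

lemma sf_values_power: "(a, b) \<in> sf_values Q \<Longrightarrow> (a ^ k, spow S b k) \<in> sf_values Q"
  by (induction k) (simp_all add: sf_values_one spow_Suc sf_values_mult)

lemma sf_values_power_int: "(a, b) \<in> sf_values Q \<Longrightarrow> (a powi k, spowi S b k) \<in> sf_values Q"
  by (auto simp: power_int_def spowi_def power_inverse intro: sf_values_power sf_values_inverse)

lemma sf_values_mon:
  assumes "\<And>v. v \<in> Poly_Mapping.keys m \<Longrightarrow> (V v, Q' v) \<in> sf_values Q"
  shows "(evalM V m, monS Q' m) \<in> sf_values Q"
proof -
  have "((\<Prod>v\<in>A. V v powi Poly_Mapping.lookup m v), sm.F (\<lambda>v. spowi S (Q' v) (Poly_Mapping.lookup m v)) A) \<in> sf_values Q"
    if "finite A" "A \<subseteq> Poly_Mapping.keys m" for A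
    using that by (induction rule: finite_induct)
      (simp_all add: sf_values_one sf_values_mult sf_values_power_int assms)
  then show ?thesis unfolding evalM_def monS_def by simp
qed

lemma sf_values_sbig:
  "(\<And>s. s \<le> m \<Longrightarrow> (f s, g s) \<in> sf_values Q) \<Longrightarrow> ((\<Sum>s\<le>m. f s), sbig S g m) \<in> sf_values Q"
  by (induction m) (simp_all add: sf_values_add)

end

section \<open>Principal coefficients\<close>

definition clus :: "nat \<Rightarrow> (nat \<Rightarrow> 'a) \<Rightarrow> (pvar \<Rightarrow> 'a) \<Rightarrow> pvar \<Rightarrow> 'a" where
  "clus n X V v = (if fst v = 0 \<and> snd (snd v) = 0 \<and> fst (snd v) < n then X (fst (snd v)) else V v)"

lemma clus_vx [simp]: "i < n \<Longrightarrow> clus n X V (vx i) = X i"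
  by (simp add: clus_def vx_def)

lemma clus_other: "(\<And>i. i < n \<Longrightarrow> v \<noteq> vx i) \<Longrightarrow> clus n X V v = V v"
  by (cases v) (auto simp: clus_def vx_def)

lemma clus_nonzero_fst [simp]: "fst v \<noteq> 0 \<Longrightarrow> clus n X V v = V v"
  by (simp add: clus_def)

lemma clus_cases:
  obtains i where "i < n" "v = vx i" | "\<And>i. i < n \<Longrightarrow> v \<noteq> vx i"
  by blast

lemma clus_cong: "(\<And>i. i < n \<Longrightarrow> X i = Y i) \<Longrightarrow> clus n X V = clus n Y V"
  by (auto simp: clus_def)

lemma clus_upd: "k < n \<Longrightarrow> (clus n X V)(vx k := a) = clus n (X(k := a)) V"
  by (rule ext, rule_tac v = x in clus_cases[of n]) (auto simp: clus_other)

definition xmon :: "nat \<Rightarrow> (nat \<Rightarrow> int) \<Rightarrow> tmon" where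
  "xmon n b = (\<Sum>j<n. frag_cmul (b j) (frag_of (vx j)))"

lemma lookup_xmon_vx [simp]: "i < n \<Longrightarrow> Poly_Mapping.lookup (xmon n b) (vx i) = b i"
  by (simp add: xmon_def lookup_sum lookup_single when_def if_distrib[of "(*) _"] cong: if_cong)

lemma lookup_xmon_other: "(\<And>i. i < n \<Longrightarrow> v \<noteq> vx i) \<Longrightarrow> Poly_Mapping.lookup (xmon n b) v = 0"
  by (auto simp: xmon_def lookup_sum lookup_single when_def intro!: sum.neutral)

lemma evalM_sum: "nz V \<Longrightarrow> evalM V (sum f A) = (\<Prod>i\<in>A. evalM V (f i))"
  by (induction A rule: infinite_finite_induct) (simp_all add: evalM_add)

lemma evalM_clus:
  assumes "nz (clus n X V)" "\<And>j. j < n \<Longrightarrow> Poly_Mapping.lookup m (vx j) = 0"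
  shows "evalM (clus n X V) (m + xmon n b) = evalM V m * (\<Prod>j<n. X j powi b j)"
proof -
  have "evalM (clus n X V) m = evalM V m"
    by (rule evalM_cong) (use assms(2) in \<open>auto simp: in_keys_iff intro!: clus_other\<close>)
  moreover have "evalM (clus n X V) (xmon n b) = (\<Prod>j<n. X j powi b j)"
    unfolding xmon_def evalM_sum[OF assms(1)] by (simp add: evalM_cmul)
  ultimately show ?thesis by (simp add: evalM_add[OF assms(1)])
qed

section \<open>Tropical coefficients as exponent vectors\<close>

lemma lookup_tmin: "Poly_Mapping.lookup (tmin a b) v = min (Poly_Mapping.lookup a v) (Poly_Mapping.lookup b v)"
proof -
  have "{v. min (Poly_Mapping.lookup a v) (Poly_Mapping.lookup b v) \<noteq> 0} \<subseteq> Poly_Mapping.keys a \<union> Poly_Mapping.keys b"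
    by (auto simp: in_keys_iff min_def)
  then have "finite {v. min (Poly_Mapping.lookup a v) (Poly_Mapping.lookup b v) \<noteq> 0}"
    by (rule finite_subset) simp
  then show ?thesis by (simp add: tmin_def)
qed

lemma spow_trop: "spow trop a k = frag_cmul (int k) a"
  by (induction k) (simp_all add: spow_def trop_def frag_cmul_distrib)

lemma spowi_trop: "spowi trop a k = frag_cmul k a"
proof (cases "0 \<le> k")
  case False
  then have "spowi trop a k = - frag_cmul (int (nat (- k))) a"
    by (simp add: spowi_def spow_trop) (simp add: trop_def)
  with False show ?thesis by simp
qed (simp add: spowi_def spow_trop)

definition trop_theta :: "(nat \<Rightarrow> nat) \<Rightarrow> nat \<Rightarrow> tmon \<Rightarrow> tmon" where
  "trop_theta d k a = sbig trop (\<lambda>s. smul trop (ztrop d k s) (spow trop a s)) (d k)"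

lemma lookup_trop_theta:
  assumes "fst v \<noteq> 2" "Poly_Mapping.lookup a v = 0"
  shows "Poly_Mapping.lookup (trop_theta d k a) v = 0"
proof -
  have "Poly_Mapping.lookup (sbig trop f m) v = 0" if "\<And>s. Poly_Mapping.lookup (f s) v = 0" for f m
    using that by (induction m) (simp_all add: trop_def lookup_tmin)
  then show ?thesis
    unfolding trop_theta_def
    by (simp add: spow_trop) (simp add: trop_def lookup_add lookup_ztrop assms)
qed

definition coeff_mon :: "nat \<Rightarrow> tmon \<Rightarrow> bool" where
  "coeff_mon n m \<longleftrightarrow> (\<forall>v. Poly_Mapping.lookup m v \<noteq> 0 \<longrightarrow> fst v = 2 \<or> (\<exists>l<n. v = vy l))"

lemma vy_eq_iff [simp]: "vy i = vy j \<longleftrightarrow> i = j"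
  by (simp add: vy_def)

lemma vx_neq_vy [simp]: "vx i \<noteq> vy j"
  by (simp add: vx_def vy_def)

lemma coeff_monD: "coeff_mon n m \<Longrightarrow> Poly_Mapping.lookup m (vx j) = 0"
  unfolding coeff_mon_def by (metis fst_vx vx_neq_vy zero_neq_numeral)

lemma coeff_mon_trop_theta: "coeff_mon n a \<Longrightarrow> coeff_mon n (trop_theta d k a)"
  unfolding coeff_mon_def by (metis lookup_trop_theta)

text \<open>The exponent vector of y-hat_i. Indices from \<open>n\<close> on get 0, which
  \<open>mutE\<close> leaves fixed, so that \<open>ecol_mut\<close> is an equation of
  functions.\<close>

definition ecol :: "nat \<Rightarrow> (nat \<Rightarrow> tmon) \<Rightarrow> (nat \<Rightarrow> nat \<Rightarrow> int) \<Rightarrow> nat \<Rightarrow> tmon" where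
  "ecol n Y B i = (if i < n then Y i + xmon n (\<lambda>j. B j i) else 0)"

text \<open>Its coefficient part is the inverse of the tropical sum in the denominator of the
  exchange relation.\<close>

definition pbeta :: "nat \<Rightarrow> (nat \<Rightarrow> nat) \<Rightarrow> nat \<Rightarrow> (nat \<Rightarrow> tmon) \<Rightarrow> (nat \<Rightarrow> nat \<Rightarrow> int) \<Rightarrow> tmon" where
  "pbeta n d k Y B = - trop_theta d k (Y k) + xmon n (\<lambda>j. int (d k) * pos (- B j k))"

lemma exch_matrix_ecol:
  "i < n \<Longrightarrow> j < n \<Longrightarrow> coeff_mon n (Y i) \<Longrightarrow> exch_matrix (ecol n Y B) j i = B j i"
  by (simp add: exch_matrix_def ecol_def lookup_add coeff_monD)

lemma exchange_mon_pbeta: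
  assumes "k < n" "coeff_mon n (Y k)"
  shows "exchange_mon n d k (ecol n Y B) (pbeta n d k Y B)"
  using assms coeff_monD[OF coeff_mon_trop_theta[OF assms(2)]]
  by (simp add: exchange_mon_def ecol_def pbeta_def lookup_add lookup_minus coeff_monD)

lemma coeff_mon_mut_y:
  assumes "coeff_mon n (Y i)" "coeff_mon n (Y k)"
  shows "coeff_mon n (mut_y trop d (ztrop d) k Y B i)"
  unfolding coeff_mon_def
proof (intro allI impI, rule ccontr)
  fix v assume v: "Poly_Mapping.lookup (mut_y trop d (ztrop d) k Y B i) v \<noteq> 0" "\<not> (fst v = 2 \<or> (\<exists>l<n. v = vy l))"
  then have "Poly_Mapping.lookup (Y i) v = 0" "Poly_Mapping.lookup (Y k) v = 0" "Poly_Mapping.lookup (trop_theta d k (Y k)) v = 0"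
    using assms coeff_mon_trop_theta[OF assms(2), of d k] unfolding coeff_mon_def by blast+
  with v show False
    by (simp add: mut_y_def spowi_trop trop_theta_def[symmetric] split: if_splits) (simp_all add: trop_def lookup_add)
qed

text \<open>At the coordinates \<open>vx j\<close> this is matrix mutation. At the others it is
  mutation of tropical y, where the tropical sum to the power -b_ki is the coefficient part of
  \<open>\<beta>\<close> to the power b_ki.\<close>

lemma ecol_mut:
  assumes k: "k < n" and Y: "\<And>i. i < n \<Longrightarrow> coeff_mon n (Y i)" and kk: "B k k = 0"
  shows "ecol n (mut_y trop d (ztrop d) k Y B) (mut_B d k B) = mutE d k (pbeta n d k Y B) (ecol n Y B)"
    (is "?L = mutE d k ?\<beta> ?e")
proof
  fix i
  show "?L i = mutE d k ?\<beta> ?e i"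
  proof (cases "i < n")
    case False
    then show ?thesis using k by (simp add: ecol_def mutE_def pos_def)
  next
    case i: True
    show ?thesis
    proof (rule poly_mapping_eqI)
      fix v
      show "Poly_Mapping.lookup (?L i) v = Poly_Mapping.lookup (mutE d k ?\<beta> ?e i) v"
      proof (cases "\<exists>j<n. v = vx j")
        case True
        then obtain j where j: "j < n" "v = vx j" by blast
        have "Poly_Mapping.lookup (?L i) v = mut_B d k B j i"
          using exch_matrix_ecol[of i n j "mut_y trop d (ztrop d) k Y B"] coeff_mon_mut_y Y i j k
          by (simp add: exch_matrix_def)
        also have "\<dots> = mut_B d k (exch_matrix ?e) j i"
          using i j k Y by (simp add: mut_B_def exch_matrix_ecol)
        also have "\<dots> = exch_matrix (mutE d k ?\<beta> ?e) j i"
          using k j Y kk by (subst exch_matrix_mutE[OF exchange_mon_pbeta]) (simp_all add: exch_matrix_ecol)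
        finally show ?thesis using j by (simp add: exch_matrix_def)
      next
        case False
        then have x: "Poly_Mapping.lookup (xmon n b) v = 0" for b by (intro lookup_xmon_other) auto
        have vk: "v \<noteq> vx k" using False k by auto
        have "Poly_Mapping.lookup (mut_y trop d (ztrop d) k Y B i) v
          = (if i = k then - Poly_Mapping.lookup (Y k) v else Poly_Mapping.lookup (Y i) v + int (d k) * pos (B k i) * Poly_Mapping.lookup (Y k) v
            - B k i * Poly_Mapping.lookup (trop_theta d k (Y k)) v)"
          by (simp add: mut_y_def spowi_trop trop_theta_def[symmetric]) (simp add: trop_def lookup_add)
        then show ?thesis
          using i k Y vk
          by (cases "i = k")
            (simp_all add: lookup_mutE exch_matrix_ecol ecol_def pbeta_def lookup_add lookup_minus x)
      qed
    qed
  qed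
qed

lemma emb_trop_evalM: "emb_trop m = evalM gen m"
  by (simp add: emb_trop_def evalM_gen)

lemma mut_x_trop:
  assumes k: "k < n" and Y: "coeff_mon n (Y k)" and nz: "nz (clus n X gen)"
  shows "clus n (mut_x trop emb_trop n d (ztrop d) k X Y B) gen
    = mutV d k (pbeta n d k Y B) (ecol n Y B) (clus n X gen)"
proof -
  let ?V = "clus n X gen"
  have T: "Poly_Mapping.lookup (- trop_theta d k (Y k)) (vx j) = 0" for j
    using coeff_monD[OF coeff_mon_trop_theta[OF Y]] by simp
  have \<beta>: "evalM ?V (pbeta n d k Y B) = (\<Prod>j<n. X j powi pos (- B j k)) ^ d k / emb_trop (trop_theta d k (Y k))"
    unfolding pbeta_def evalM_clus[OF nz T] emb_trop_evalM
    by (simp add: evalM_uminus divide_inverse power_int_mult mult.commute[of "int _"] flip: prod_power_distrib)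
  have e: "evalM ?V (ecol n Y B k) = emb_trop (Y k) * (\<Prod>j<n. X j powi B j k)"
    using k evalM_clus[OF nz coeff_monD[OF Y]] by (simp add: ecol_def emb_trop_evalM)
  have th: "theta_at d k ?V y = (\<Sum>s\<le>d k. emb_trop (ztrop d k s) * y ^ s)" for y
  proof -
    have "theta_at d k ?V = theta_at d k gen"
      by (rule theta_at_cong) simp
    then show ?thesis by (simp add: theta_at_def emb_trop_evalM)
  qed
  have "mut_x trop emb_trop n d (ztrop d) k X Y B = X(k := evalM ?V (pbeta n d k Y B) * theta_at d k ?V (evalM ?V (ecol n Y B k)) / ?V (vx k))"
    unfolding \<beta> e th using k
    by (auto simp: mut_x_def Let_def trop_theta_def[symmetric] fun_eq_iff divide_inverse mult_ac)
  then show ?thesis using k by (simp add: mutV_def clus_upd)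
qed

lemma seed_at_snoc: "seed_at S emb n d z s0 (w @ [k]) = mutate S emb n d z k (seed_at S emb n d z s0 w)"
  by (simp add: seed_at_def)

text \<open>Substitution of polynomials for the x_j of a monomial. It is used for monomials with
  nonnegative exponents of x_j, where \<open>nat\<close> loses nothing and the result is again
  Laurent.\<close>

definition lift_mon :: "nat \<Rightarrow> (nat \<Rightarrow> lpoly) \<Rightarrow> tmon \<Rightarrow> lpoly" where
  "lift_mon n p m = frag_of (m - xmon n (\<lambda>j. Poly_Mapping.lookup m (vx j)))
     * (\<Prod>j<n. p j ^ nat (Poly_Mapping.lookup m (vx j)))"

lemma evalL_lift_mon:
  assumes "nz V" "nz (clus n (\<lambda>i. evalL (p i) V) V)" "\<And>j. j < n \<Longrightarrow> 0 \<le> Poly_Mapping.lookup m (vx j)"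
  shows "evalL (lift_mon n p m) V = evalM (clus n (\<lambda>i. evalL (p i) V) V) m"
proof -
  let ?r = "m - xmon n (\<lambda>j. Poly_Mapping.lookup m (vx j))"
  have "evalM (clus n (\<lambda>i. evalL (p i) V) V) (?r + xmon n (\<lambda>j. Poly_Mapping.lookup m (vx j)))
      = evalM V ?r * (\<Prod>j<n. evalL (p j) V powi Poly_Mapping.lookup m (vx j))"
    by (rule evalM_clus[OF assms(2)]) (simp add: lookup_minus)
  moreover have "(\<Prod>j<n. evalL (p j) V powi Poly_Mapping.lookup m (vx j)) = (\<Prod>j<n. evalL (p j) V ^ nat (Poly_Mapping.lookup m (vx j)))"
    by (intro prod.cong) (simp_all add: power_int_nonneg_exp assms(3))
  ultimately show ?thesis using assms(1) by (simp add: lift_mon_def)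
qed

section \<open>The pattern with principal coefficients\<close>

locale principal =
  fixes n :: nat and d :: "nat \<Rightarrow> nat" and B :: "nat \<Rightarrow> nat \<Rightarrow> int"
  assumes d_pos: "\<And>k. k < n \<Longrightarrow> 0 < d k" and skew: "skew_symmetrizable n B"
begin

definition "pX w = fst (seed_at trop emb_trop n d (ztrop d) (princ_seed B) w)"
definition "pY w = fst (snd (seed_at trop emb_trop n d (ztrop d) (princ_seed B) w))"
definition "pB w = snd (snd (seed_at trop emb_trop n d (ztrop d) (princ_seed B) w))"
definition "pV w = clus n (pX w) gen"
definition "pE w = ecol n (pY w) (pB w)"
definition "pbt w k = pbeta n d k (pY w) (pB w)"

lemma p_Nil: "pX [] = (\<lambda>i. gen (vx i))" "pY [] = (\<lambda>i. frag_of (vy i))" "pB [] = B"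
  by (simp_all add: pX_def pY_def pB_def seed_at_def princ_seed_def)

lemma p_snoc:
  "pX (w @ [k]) = mut_x trop emb_trop n d (ztrop d) k (pX w) (pY w) (pB w)"
  "pY (w @ [k]) = mut_y trop d (ztrop d) k (pY w) (pB w)"
  "pB (w @ [k]) = mut_B d k (pB w)"
  by (simp_all add: pX_def pY_def pB_def seed_at_snoc mutate_def split: prod.split)

lemma pV_Nil: "pV [] = gen"
  unfolding pV_def p_Nil by (rule ext, rule_tac v = x in clus_cases[of n]) (auto simp: clus_other)

lemma good_seed_Nil: "good_seed n gen (pE [])"
proof -
  have coeff: "coeff_mon n (frag_of (vy i))" if "i < n" for i
    using that by (auto simp: coeff_mon_def lookup_single when_def)
  have "p = 0" if "evalL p gen = 0" for p
    using that by (simp add: evalL_gen Zero_fract_def Fract_1_inject)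
  moreover have "skew_symmetrizable n (exch_matrix (pE []))"
    using skew by (subst skew_symmetrizable_cong[of n _ B])
      (simp_all add: pE_def exch_matrix_ecol p_Nil coeff)
  moreover have "independent_columns n (pE [])"
    unfolding independent_columns_def
  proof (intro allI impI)
    fix c l assume c: "\<forall>v. fst v \<noteq> 2 \<longrightarrow> (\<Sum>i<n. c i * Poly_Mapping.lookup (pE [] i) v) = 0" and l: "l < n"
    have "Poly_Mapping.lookup (pE [] i) (vy l) = (if i = l then 1 else 0)" if "i < n" for i
    proof -
      have "Poly_Mapping.lookup (xmon n b) (vy l) = 0" for b
        by (rule lookup_xmon_other) (simp add: vx_def vy_def)
      then show ?thesis using that
        by (auto simp: pE_def ecol_def p_Nil lookup_add lookup_single when_def vy_def)
    qed
    then have "(\<Sum>i<n. c i * Poly_Mapping.lookup (pE [] i) (vy l)) = (\<Sum>i<n. if i = l then c i else 0)"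
      by (intro sum.cong) auto
    with c[rule_format, of "vy l"] l show "c l = 0" by (simp add: vy_def)
  qed
  ultimately show ?thesis by (simp add: good_seed_def)
qed

lemma principal_state:
  assumes "set w \<subseteq> {..<n}"
  shows "good_seed n (pV w) (pE w) \<and> mutation_path n d (length w) gen (pE []) (pV w) (pE w)
    \<and> (\<forall>i<n. coeff_mon n (pY w i))"
    and "k < n \<Longrightarrow> exchange_mon n d k (pE w) (pbt w k)"
    and "k < n \<Longrightarrow> pV (w @ [k]) = mutV d k (pbt w k) (pE w) (pV w)"
    and "k < n \<Longrightarrow> pE (w @ [k]) = mutE d k (pbt w k) (pE w)"
proof -
  let ?P = "\<lambda>w. good_seed n (pV w) (pE w) \<and> mutation_path n d (length w) gen (pE []) (pV w) (pE w)
    \<and> (\<forall>i<n. coeff_mon n (pY w i))"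
  have step: "exchange_mon n d k (pE w) (pbt w k) \<and> pV (w @ [k]) = mutV d k (pbt w k) (pE w) (pV w)
      \<and> pE (w @ [k]) = mutE d k (pbt w k) (pE w)" if P: "?P w" and k: "k < n" for w k
  proof -
    have "pB w k k = exch_matrix (pE w) k k"
      using P k by (simp add: pE_def exch_matrix_ecol)
    then have "pB w k k = 0"
      using P k skew_symmetrizableD(1) unfolding good_seed_def by metis
    then show ?thesis
      using P k mut_x_trop[of k n "pY w" "pX w" d "pB w"] ecol_mut[of k n "pY w" "pB w" d]
      by (auto simp: pV_def pE_def pbt_def p_snoc good_seed_def exchange_mon_pbeta)
  qed
  have P: "?P w" if "set w \<subseteq> {..<n}" for w
    using that
  proof (induction w rule: rev_induct)
    case Nil
    have "coeff_mon n (frag_of (vy i))" if "i < n" for i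
      using that by (auto simp: coeff_mon_def lookup_single when_def)
    then show ?case using good_seed_Nil by (simp add: pV_Nil mutation_path.nil p_Nil)
  next
    case (snoc k w)
    then have k: "k < n" and IH: "?P w" by auto
    note st = step[OF IH k]
    have "good_seed n (pV (w @ [k])) (pE (w @ [k]))"
      using st IH k good_seed_mut by metis
    moreover have "mutation_path n d (length (w @ [k])) gen (pE []) (pV (w @ [k])) (pE (w @ [k]))"
      using st IH k mutation_path_snoc by fastforce
    moreover have "\<forall>i<n. coeff_mon n (pY (w @ [k]) i)"
      using IH k by (simp add: p_snoc coeff_mon_mut_y)
    ultimately show ?case by blast
  qed
  show "?P w" by (rule P[OF assms])
  show "exchange_mon n d k (pE w) (pbt w k)" "pV (w @ [k]) = mutV d k (pbt w k) (pE w) (pV w)"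
    "pE (w @ [k]) = mutE d k (pbt w k) (pE w)" if "k < n"
    using step[OF P[OF assms] that] by auto
qed

lemma Xfun_eq: "Xfun n d B w i = pX w i"
  by (simp add: Xfun_def cvar_def pX_def)

text \<open>The Laurent phenomenon supplies the witness for the choice made in
  \<open>Xpoly\<close>.\<close>

lemma evalL_Xpoly:
  assumes "set w \<subseteq> {..<n}" "i < n"
  shows "evalL (Xpoly n d B w i) gen = pX w i"
proof -
  have "\<exists>p. pV w (vx i) = evalL p gen"
    using principal_state(1)[OF assms(1)] d_pos good_seed_Nil
    by (intro laurent_phenomenon[of n gen "pE []" d "length w" "pV w" "pE w"]) auto
  then have "\<exists>p. Fract p 1 = pX w i"
    using assms by (auto simp: pV_def evalL_gen)
  then have "Fract (Xpoly n d B w i) 1 = pX w i"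
    unfolding Xpoly_def Xfun_eq by (rule someI_ex)
  then show ?thesis by (simp add: evalL_gen)
qed

lemma Xpoly_Nil: "i < n \<Longrightarrow> Xpoly n d B [] i = frag_of (frag_of (vx i))"
  using evalL_Xpoly[of "[]" i] by (simp add: p_Nil evalL_gen gen_def Fract_1_inject)

lemma Xpoly_snoc_other: "i \<noteq> k \<Longrightarrow> Xpoly n d B (w @ [k]) i = Xpoly n d B w i"
  by (simp add: Xpoly_def Xfun_eq p_snoc mut_x_def)

text \<open>d_k [-b]_+ + s b is nonnegative for 0 \<le> s \<le> d_k.\<close>

lemma exchange_exponent_nonneg:
  assumes "set w \<subseteq> {..<n}" "k < n" "s \<le> d k" "j < n"
  shows "0 \<le> Poly_Mapping.lookup (pbt w k + ztrop d k s + frag_cmul (int s) (pE w k)) (vx j)"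
proof -
  have b: "Poly_Mapping.lookup (pbt w k) (vx j) = int (d k) * pos (- Poly_Mapping.lookup (pE w k) (vx j))"
    using principal_state(2)[OF assms(1,2)] assms(4) by (simp add: exchange_mon_def)
  let ?b = "Poly_Mapping.lookup (pE w k) (vx j)"
  have "int s * (- ?b) \<le> int (d k) * pos (- ?b)"
    using assms(3) by (cases "0 \<le> - ?b") (auto simp: pos_def max_def intro: mult_right_mono mult_nonneg_nonpos)
  then show ?thesis by (simp add: lookup_add lookup_ztrop b)
qed

text \<open>The mutation rule for cluster variables is the value of this equation at the generic
  point, and evaluation there is injective.\<close>

theorem exchange_relation:
  assumes w: "set w \<subseteq> {..<n}" and k: "k < n"
  shows "Xpoly n d B (w @ [k]) k * Xpoly n d B w k
    = (\<Sum>s\<le>d k. lift_mon n (Xpoly n d B w) (pbt w k + ztrop d k s + frag_cmul (int s) (pE w k)))"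
    (is "?L = ?R")
proof -
  have V: "clus n (\<lambda>i. evalL (Xpoly n d B w i) gen) gen = pV w"
    unfolding pV_def by (rule clus_cong) (rule evalL_Xpoly[OF w])
  have nz: "nz (pV w)" using principal_state(1)[OF w] by (simp add: good_seed_def)
  have "evalL ?R gen = (\<Sum>s\<le>d k. evalM (pV w) (pbt w k + ztrop d k s + frag_cmul (int s) (pE w k)))"
    using nz exchange_exponent_nonneg[OF w k] by (simp add: evalL_lift_mon V)
  also have "\<dots> = evalM (pV w) (pbt w k) * theta_at d k (pV w) (evalM (pV w) (pE w k))"
    using nz by (simp add: evalM_add evalM_cmul theta_at_def sum_distrib_left mult.assoc)
  also have "\<dots> = pV (w @ [k]) (vx k) * pV w (vx k)"
    using nz by (simp add: principal_state(3)[OF w k] mutV_def)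
  also have "\<dots> = evalL ?L gen"
    using w k by (simp add: evalL_Xpoly pV_def)
  finally show ?thesis by (simp add: evalL_gen Fract_1_inject del: evalL_mult evalL_sum)
qed

text \<open>The principal cluster at \<open>w\<close> once the formal variables take the values
  \<open>V\<close>. It is used with \<open>val_F\<close>, where x = 1, and with
  \<open>val_Psi\<close>, the initial data of the given pattern.\<close>

definition spec :: "(pvar \<Rightarrow> 'f::field) \<Rightarrow> nat list \<Rightarrow> pvar \<Rightarrow> 'f" where
  "spec V w = clus n (\<lambda>i. evalL (Xpoly n d B w i) V) V"

lemma spec_vx: "i < n \<Longrightarrow> spec V w (vx i) = evalL (Xpoly n d B w i) V"
  by (simp add: spec_def)

lemma spec_Nil: "spec V [] = V"
  unfolding spec_def by (rule ext, rule_tac v = x in clus_cases[of n]) (auto simp: Xpoly_Nil clus_other)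

lemma spec_snoc:
  assumes w: "set w \<subseteq> {..<n}" and k: "k < n" and nz: "nz V" "nz (spec V w)"
  shows "spec V (w @ [k]) = mutV d k (pbt w k) (pE w) (spec V w)"
proof -
  let ?U = "spec V w"
  have "evalL (Xpoly n d B (w @ [k]) k) V * ?U (vx k) = evalL (Xpoly n d B (w @ [k]) k * Xpoly n d B w k) V"
    using nz k by (simp add: spec_vx)
  also have "\<dots> = (\<Sum>s\<le>d k. evalM ?U (pbt w k + ztrop d k s + frag_cmul (int s) (pE w k)))"
    unfolding exchange_relation[OF w k]
    using nz exchange_exponent_nonneg[OF w k] by (simp add: evalL_lift_mon spec_def)
  also have "\<dots> = evalM ?U (pbt w k) * theta_at d k ?U (evalM ?U (pE w k))"
    using nz by (simp add: evalM_add evalM_cmul theta_at_def sum_distrib_left mult.assoc)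
  finally have "evalL (Xpoly n d B (w @ [k]) k) V = evalM ?U (pbt w k) * theta_at d k ?U (evalM ?U (pE w k)) / ?U (vx k)"
    using nz by (simp add: eq_divide_eq)
  moreover have "spec V (w @ [k]) = ?U(vx k := evalL (Xpoly n d B (w @ [k]) k) V)"
    unfolding spec_def clus_upd[OF k] by (rule clus_cong) (auto simp: Xpoly_snoc_other)
  ultimately show ?thesis by (simp add: mutV_def)
qed

end

section \<open>Homogeneity\<close>

definition homogeneous :: "(tmon \<Rightarrow> int) \<Rightarrow> int \<Rightarrow> lpoly \<Rightarrow> bool" where
  "homogeneous \<mu> c p \<longleftrightarrow> (\<forall>m\<in>Poly_Mapping.keys p. \<mu> m = c)"

lemma homogeneous_frag_of [simp]: "homogeneous \<mu> c (frag_of m) \<longleftrightarrow> \<mu> m = c"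
  by (simp add: homogeneous_def)

lemma homogeneous_sum: "(\<And>i. i \<in> A \<Longrightarrow> homogeneous \<mu> c (f i)) \<Longrightarrow> homogeneous \<mu> c (sum f A)"
  using keys_sum[of f A] by (fastforce simp: homogeneous_def)

lemma homogeneous_mult:
  assumes "\<And>a b. \<mu> (a + b) = \<mu> a + \<mu> b" "homogeneous \<mu> c p" "homogeneous \<mu> c' q"
  shows "homogeneous \<mu> (c + c') (p * q)"
  unfolding homogeneous_def
proof
  fix m assume "m \<in> Poly_Mapping.keys (p * q)"
  then obtain a b where "m = a + b" "a \<in> Poly_Mapping.keys p" "b \<in> Poly_Mapping.keys q"
    using keys_mult by blast
  then show "\<mu> m = c + c'" using assms by (simp add: homogeneous_def)
qed

lemma homogeneous_power:
  assumes "\<And>a b. \<mu> (a + b) = \<mu> a + \<mu> b" "\<mu> 0 = 0" "homogeneous \<mu> c p"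
  shows "homogeneous \<mu> (int k * c) (p ^ k)"
proof (induction k)
  case 0
  show ?case using assms(2) by (simp add: homogeneous_def)
next
  case (Suc k)
  then show ?case using homogeneous_mult[OF assms(1,3) Suc] by (simp add: algebra_simps)
qed

lemma homogeneous_prod:
  assumes "\<And>a b. \<mu> (a + b) = \<mu> a + \<mu> b" "\<mu> 0 = 0" "\<And>i. i \<in> A \<Longrightarrow> homogeneous \<mu> (c i) (f i)"
  shows "homogeneous \<mu> (sum c A) (prod f A)"
  using assms(3)
proof (induction A rule: infinite_finite_induct)
  case (insert i A)
  then show ?case using homogeneous_mult[OF assms(1)] by simp
qed (use assms(2) in \<open>simp_all add: homogeneous_def\<close>)

context principal
begin

text \<open>Component \<open>l\<close> of the degree of a monomial in the cluster at some vertex: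
  \<open>\<gamma> j\<close> is that component for its j-th variable, and the y's keep their initial
  degree.\<close>

definition wdeg :: "(nat \<Rightarrow> int) \<Rightarrow> nat \<Rightarrow> tmon \<Rightarrow> int" where
  "wdeg \<gamma> l m = (\<Sum>j<n. \<gamma> j * Poly_Mapping.lookup m (vx j)) - (\<Sum>i<n. B l i * Poly_Mapping.lookup m (vy i))"

lemma wdeg_add: "wdeg \<gamma> l (a + b) = wdeg \<gamma> l a + wdeg \<gamma> l b"
  by (simp add: wdeg_def lookup_add distrib_left sum.distrib)

lemma wdeg_diff: "wdeg \<gamma> l (a - b) = wdeg \<gamma> l a - wdeg \<gamma> l b"
  by (simp add: wdeg_def lookup_minus right_diff_distrib sum_subtractf)

lemma wdeg_cmul: "wdeg \<gamma> l (frag_cmul c a) = c * wdeg \<gamma> l a"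
  by (simp add: wdeg_def sum_distrib_left right_diff_distrib mult.left_commute)

lemma wdeg_uminus: "wdeg \<gamma> l (- a) = - wdeg \<gamma> l a"
  by (simp add: wdeg_def sum_negf)

lemma wdeg_vx: "k < n \<Longrightarrow> wdeg \<gamma> l (frag_of (vx k)) = \<gamma> k"
  by (simp add: wdeg_def lookup_single when_def if_distrib[of "(*) _"] vx_neq_vy[symmetric] cong: if_cong)

lemma wdeg_ztrop: "wdeg \<gamma> l (ztrop d k s) = 0"
  by (simp add: wdeg_def lookup_ztrop vy_def)

lemma wdeg_upd:
  assumes "k < n"
  shows "wdeg (\<gamma>(k := g)) l m = wdeg \<gamma> l m + (g - \<gamma> k) * Poly_Mapping.lookup m (vx k)"
proof -
  have "(\<Sum>j<n. (\<gamma>(k := g)) j * Poly_Mapping.lookup m (vx j))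
      = (\<Sum>j<n. \<gamma> j * Poly_Mapping.lookup m (vx j) + (if j = k then (g - \<gamma> k) * Poly_Mapping.lookup m (vx k) else 0))"
    by (intro sum.cong) (auto simp: algebra_simps)
  then show ?thesis using assms by (simp add: wdeg_def sum.distrib)
qed

lemma mdeg_add: "mdeg n B (a + b) l = mdeg n B a l + mdeg n B b l"
  by (simp add: mdeg_def lookup_add distrib_left sum.distrib)

lemma mdeg_zero: "mdeg n B 0 l = 0"
  by (simp add: mdeg_def)

lemma homogeneous_lift_mon:
  assumes "\<And>j. j < n \<Longrightarrow> homogeneous (\<lambda>m. mdeg n B m l) (\<gamma> j) (p j)" "l < n"
    and nonneg: "\<And>j. j < n \<Longrightarrow> 0 \<le> Poly_Mapping.lookup m (vx j)"
  shows "homogeneous (\<lambda>m. mdeg n B m l) (wdeg \<gamma> l m) (lift_mon n p m)"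
proof -
  let ?\<mu> = "\<lambda>m. mdeg n B m l" and ?r = "m - xmon n (\<lambda>j. Poly_Mapping.lookup m (vx j))"
  have "Poly_Mapping.lookup (xmon n b) (vy i) = 0" for b i
    by (rule lookup_xmon_other) (simp add: vx_neq_vy[symmetric])
  then have "?\<mu> ?r = - (\<Sum>i<n. B l i * Poly_Mapping.lookup m (vy i))"
    using assms(2) by (simp add: mdeg_def lookup_minus)
  moreover have "homogeneous ?\<mu> (?\<mu> ?r + (\<Sum>j<n. int (nat (Poly_Mapping.lookup m (vx j))) * \<gamma> j)) (lift_mon n p m)"
    unfolding lift_mon_def
    by (intro homogeneous_mult homogeneous_prod homogeneous_power assms) (simp_all add: mdeg_add mdeg_zero)
  moreover have "(\<Sum>j<n. int (nat (Poly_Mapping.lookup m (vx j))) * \<gamma> j) = (\<Sum>j<n. \<gamma> j * Poly_Mapping.lookup m (vx j))"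
    using nonneg by (intro sum.cong) auto
  ultimately show ?thesis by (simp add: wdeg_def)
qed

lemma Xpoly_nonzero:
  assumes "set w \<subseteq> {..<n}" "i < n"
  shows "Xpoly n d B w i \<noteq> 0"
proof -
  have "pV w (vx i) \<noteq> 0"
    using principal_state(1)[OF assms(1)] by (simp add: good_seed_def)
  then show ?thesis
    using evalL_Xpoly[OF assms] assms(2) by (auto simp: pV_def)
qed

lemma exch_matrix_pE:
  assumes "set w \<subseteq> {..<n}" "i < n" "j < n"
  shows "Poly_Mapping.lookup (pE w i) (vx j) = pB w j i"
  using exch_matrix_ecol[OF assms(2,3)] principal_state(1)[OF assms(1)] assms(2)
  by (simp add: exch_matrix_def pE_def)

lemma pB_diag:
  assumes "set w \<subseteq> {..<n}" "k < n"
  shows "pB w k k = 0"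
  using principal_state(1)[OF assms(1)] skew_symmetrizableD(1)[of n "exch_matrix (pE w)" k] assms
  by (simp add: good_seed_def exch_matrix_def exch_matrix_pE)

lemma lookup_pbt_self:
  assumes "set w \<subseteq> {..<n}" "k < n"
  shows "Poly_Mapping.lookup (pbt w k) (vx k) = 0"
  using principal_state(2)[OF assms] assms exch_matrix_pE[OF assms assms(2)] pB_diag[OF assms]
  by (simp add: exchange_mon_def pos_def)

text \<open>The invariant is that every y-hat has degree 0. All terms of the exchange relation then
  have the degree of \<open>\<beta>\<close>, and \<open>homogeneous_factor\<close> carries
  homogeneity over to the new variable.\<close>

theorem Xpoly_homogeneous:
  assumes "set w \<subseteq> {..<n}" "l < n"
  shows "\<exists>\<gamma>. (\<forall>i<n. homogeneous (\<lambda>m. mdeg n B m l) (\<gamma> i) (Xpoly n d B w i)) \<and> (\<forall>i<n. wdeg \<gamma> l (pE w i) = 0)"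
  using assms(1)
proof (induction w rule: rev_induct)
  case Nil
  let ?\<gamma> = "\<lambda>i. if i = l then 1 else 0 :: int"
  have "mdeg n B (frag_of (vx i)) l = ?\<gamma> i" for i
    by (simp add: mdeg_def lookup_single when_def vx_neq_vy[symmetric])
  moreover have "wdeg ?\<gamma> l (pE [] i) = 0" if "i < n" for i
  proof -
    have "Poly_Mapping.lookup (xmon n b) (vy i') = 0" for b i'
      by (rule lookup_xmon_other) (simp add: vx_neq_vy[symmetric])
    then have "Poly_Mapping.lookup (pE [] i) (vy i') = (if i' = i then 1 else 0)" for i'
      using that by (simp add: pE_def ecol_def p_Nil lookup_add lookup_single when_def)
    moreover have "Poly_Mapping.lookup (pE [] i) (vx j) = B j i" if "j < n" for j
      using exch_matrix_pE[of "[]" i j] that \<open>i < n\<close> by (simp add: p_Nil)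
    ultimately show ?thesis
      using that assms(2) by (simp add: wdeg_def if_distrib[of "(*) _"] if_distrib[of "\<lambda>x. x * _"] cong: if_cong)
  qed
  ultimately show ?case by (intro exI[of _ ?\<gamma>]) (simp add: Xpoly_Nil)
next
  case (snoc k w)
  then have w: "set w \<subseteq> {..<n}" and k: "k < n" by auto
  from snoc.IH[OF w] obtain \<gamma> where hom: "\<And>i. i < n \<Longrightarrow> homogeneous (\<lambda>m. mdeg n B m l) (\<gamma> i) (Xpoly n d B w i)"
    and e: "\<And>i. i < n \<Longrightarrow> wdeg \<gamma> l (pE w i) = 0" by blast
  let ?\<beta> = "wdeg \<gamma> l (pbt w k)"
  let ?\<gamma> = "\<gamma>(k := ?\<beta> - \<gamma> k)"
  have prod: "homogeneous (\<lambda>m. mdeg n B m l) ?\<beta> (Xpoly n d B w k * Xpoly n d B (w @ [k]) k)"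
    unfolding mult.commute[of "Xpoly n d B w k"] exchange_relation[OF w k]
  proof (rule homogeneous_sum)
    fix s assume "s \<in> {..d k}"
    then have "homogeneous (\<lambda>m. mdeg n B m l) (wdeg \<gamma> l (pbt w k + ztrop d k s + frag_cmul (int s) (pE w k)))
        (lift_mon n (Xpoly n d B w) (pbt w k + ztrop d k s + frag_cmul (int s) (pE w k)))"
      using exchange_exponent_nonneg[OF w k] by (intro homogeneous_lift_mon hom assms) auto
    then show "homogeneous (\<lambda>m. mdeg n B m l) ?\<beta> (lift_mon n (Xpoly n d B w) (pbt w k + ztrop d k s + frag_cmul (int s) (pE w k)))"
      using k by (simp add: wdeg_add wdeg_cmul wdeg_ztrop e)
  qed
  have "homogeneous (\<lambda>m. mdeg n B m l) (?\<beta> - \<gamma> k) (Xpoly n d B (w @ [k]) k)"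
    unfolding homogeneous_def
  proof
    fix m assume m: "m \<in> Poly_Mapping.keys (Xpoly n d B (w @ [k]) k)"
    show "mdeg n B m l = ?\<beta> - \<gamma> k"
      by (rule homogeneous_factor[where \<mu> = "\<lambda>m. mdeg n B m l", OF mdeg_add _ Xpoly_nonzero[OF w k] _ m])
        (use hom[OF k] prod in \<open>auto simp: homogeneous_def\<close>)
  qed
  then have "\<forall>i<n. homogeneous (\<lambda>m. mdeg n B m l) (?\<gamma> i) (Xpoly n d B (w @ [k]) i)"
    using hom by (auto simp: Xpoly_snoc_other)
  \<comment> \<open>In \<open>mutE\<close> the last term adds b_ki (deg \<beta> - 2 \<gamma>_k). The
    new \<gamma>_k differs from the old by deg \<beta> - 2 \<gamma>_k and acts on the new exponent
    -b_ki, which cancels that term.\<close>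
  moreover have "wdeg ?\<gamma> l (pE (w @ [k]) i) = 0" if i: "i < n" for i
  proof (cases "i = k")
    case True
    then show ?thesis
      using k w by (simp add: principal_state(4) mutE_def wdeg_upd wdeg_uminus e exch_matrix_pE pB_diag)
  next
    case False
    then show ?thesis
      using k w i
      by (simp add: principal_state(4) wdeg_upd lookup_mutE exch_matrix_def exch_matrix_pE pB_diag lookup_pbt_self)
        (simp add: mutE_def wdeg_add wdeg_cmul wdeg_diff wdeg_vx e exch_matrix_pE algebra_simps)
  qed
  ultimately show ?case by blast
qed

lemma mdeg_gmat:
  assumes "set w \<subseteq> {..<n}" "i < n" "j < n" "m \<in> Poly_Mapping.keys (Xpoly n d B w i)"
  shows "mdeg n B m j = gmat n d B w j i"
proof -
  obtain g where g: "homogeneous (\<lambda>m. mdeg n B m j) g (Xpoly n d B w i)"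
    using Xpoly_homogeneous[OF assms(1,3)] assms(2) by blast
  have "(SOME m. m \<in> Poly_Mapping.keys (Xpoly n d B w i)) \<in> Poly_Mapping.keys (Xpoly n d B w i)"
    using assms(4) by (rule someI)
  then show ?thesis using g assms(4) by (simp add: homogeneous_def gmat_def)
qed

text \<open>The variables that may occur in the exponent vectors of the pattern. The remaining index
  triples carry default values, so comparisons of valuations are restricted to these.\<close>

definition pattern_var :: "pvar \<Rightarrow> bool" where
  "pattern_var v \<longleftrightarrow> (\<exists>i<n. v = vx i) \<or> (\<exists>l<n. v = vy l) \<or> fst v = 2"

lemma pattern_var_ztrop: "v \<in> Poly_Mapping.keys (ztrop d k s) \<Longrightarrow> pattern_var v"
  unfolding pattern_var_def by (metis in_keys_iff lookup_ztrop)

lemma pattern_var_coeff_xmon: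
  assumes "coeff_mon n m" "v \<in> Poly_Mapping.keys (m + xmon n b)"
  shows "pattern_var v"
proof (rule ccontr)
  assume v: "\<not> pattern_var v"
  then have "Poly_Mapping.lookup (xmon n b) v = 0"
    by (intro lookup_xmon_other) (auto simp: pattern_var_def)
  moreover have "Poly_Mapping.lookup m v = 0"
    using assms(1) v by (auto simp: coeff_mon_def pattern_var_def)
  ultimately show False using assms(2) by (simp add: in_keys_iff lookup_add)
qed

lemma coeff_mon_uminus: "coeff_mon n m \<Longrightarrow> coeff_mon n (- m)"
  by (simp add: coeff_mon_def)

lemma pattern_var_pE:
  assumes "set w \<subseteq> {..<n}" "k < n" "v \<in> Poly_Mapping.keys (pE w k)"
  shows "pattern_var v"
proof -
  have "coeff_mon n (pY w k)" using principal_state(1)[OF assms(1)] assms(2) by blast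
  then show ?thesis
    by (rule pattern_var_coeff_xmon) (use assms in \<open>simp add: pE_def ecol_def\<close>)
qed

lemma pattern_var_pbt:
  assumes "set w \<subseteq> {..<n}" "k < n" "v \<in> Poly_Mapping.keys (pbt w k)"
  shows "pattern_var v"
proof -
  have "coeff_mon n (- trop_theta d k (pY w k))"
    using principal_state(1)[OF assms(1)] assms(2) by (intro coeff_mon_uminus coeff_mon_trop_theta) blast
  then show ?thesis
    by (rule pattern_var_coeff_xmon) (use assms in \<open>simp only: pbt_def pbeta_def\<close>)
qed

end

section \<open>The separation formula\<close>

lemma evalM_one [simp]: "evalM (\<lambda>_. 1) m = 1"
  by (simp add: evalM_def)

lemma reduced_word_snocD: "reduced_word n (w @ [k]) \<Longrightarrow> reduced_word n w \<and> k < n"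
  unfolding reduced_word_def by (auto simp: nth_append split: if_splits)

lemma reduced_word_set: "reduced_word n w \<Longrightarrow> set w \<subseteq> {..<n}"
  by (auto simp: reduced_word_def)

locale separation = principal n d B + semifield_ctx S
  for n d B and S :: "'p semifield_ops" +
  fixes emb :: "'p \<Rightarrow> 'f::field" and z :: "nat \<Rightarrow> nat \<Rightarrow> 'p" and x :: "nat \<Rightarrow> 'f" and y :: "nat \<Rightarrow> 'p"
  assumes emb: "semifield_hom S emb" and z_data: "mutation_data S n d z"
    and cvar_nonzero: "\<And>w j. reduced_word n w \<Longrightarrow> j < n \<Longrightarrow> cvar S emb n d z (x, y, B) w j \<noteq> 0"
begin

lemma emb_smul: "emb (smul S a b) = emb a * emb b" and emb_sone [simp]: "emb (sone S) = 1"
  using emb by (simp_all add: semifield_hom_def)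

lemma emb_sinv: "emb (sinv S a) = inverse (emb a)"
  using emb_smul[of a "sinv S a"] by (simp add: inverse_unique)

lemma emb_nonzero [simp]: "emb a \<noteq> 0"
  using emb_smul[of a "sinv S a"] by auto

lemma emb_spow: "emb (spow S a k) = emb a ^ k"
  by (induction k) (simp_all add: spow_Suc emb_smul)

lemma emb_spowi: "emb (spowi S a k) = emb a powi k"
  by (simp add: spowi_def power_int_def emb_spow emb_sinv power_inverse)

lemma emb_monS: "emb (monS Q m) = evalM (\<lambda>v. emb (Q v)) m"
  unfolding monS_def evalM_def
  by (induction rule: finite_induct[OF finite_keys[of m]]) (simp_all add: emb_smul emb_spowi)

section \<open>Values of the F-polynomials in the semifield\<close>

definition val_P :: "pvar \<Rightarrow> 'p" where
  "val_P = (\<lambda>(a, b, c). if a = 1 then y b else if a = 2 then z b c else sone S)"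

definition val_F :: "pvar \<Rightarrow> pfield" where
  "val_F v = (if fst v = 0 then 1 else gen v)"

definition F_val :: "nat list \<Rightarrow> pvar \<Rightarrow> 'p" where
  "F_val w = clus n (F_in_P S n d B z y w) val_P"

text \<open>The exchange sum at \<open>k\<close> with y-hat_k read at the F-values;
  \<open>coefficient_formula\<close> makes it the denominator in the given pattern.\<close>

definition Theta :: "nat list \<Rightarrow> nat \<Rightarrow> 'p" where
  "Theta w k = sbig S (\<lambda>s. smul S (monS (F_val w) (ztrop d k s)) (spow S (monS (F_val w) (pE w k)) s)) (d k)"

text \<open>The expression in \<open>Fexpr\<close> is a mere choice; any other one for the same
  function has the same value.\<close>

lemma F_in_P_eqI:
  assumes "(Fpoly n d B w i, b) \<in> sf_values val_P"
  shows "F_in_P S n d B z y w i = b"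
proof -
  obtain e where e: "sf_vars e \<subseteq> {v. fst v = 1 \<or> fst v = 2}" "Fpoly n d B w i = sf_eval_field gen e" "b = sf_eval_sf S val_P e"
    using assms by (rule sf_valuesE)
  have "sf_vars (Fexpr n d B w i) \<subseteq> {v. fst v = 1 \<or> fst v = 2} \<and> sf_eval_field gen (Fexpr n d B w i) = Fpoly n d B w i"
    unfolding Fexpr_def by (rule someI[of _ e]) (use e in auto)
  then have "sf_eval_sf S val_P (Fexpr n d B w i) = b"
    unfolding e(2,3) by (intro sf_eval_sf_well_defined) simp
  then show ?thesis by (simp add: F_in_P_def val_P_def)
qed

lemma spec_val_F: "i < n \<Longrightarrow> spec val_F w (vx i) = Fpoly n d B w i"
  unfolding spec_vx Fpoly_def val_F_def[abs_def] ..

lemma F_in_P_Nil: "i < n \<Longrightarrow> F_in_P S n d B z y [] i = sone S"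
  using spec_val_F[of i "[]"] sf_values_one by (intro F_in_P_eqI) (simp add: spec_Nil val_F_def)

lemma F_in_P_snoc_other: "i \<noteq> k \<Longrightarrow> F_in_P S n d B z y (w @ [k]) i = F_in_P S n d B z y w i"
  by (simp add: F_in_P_def Fexpr_def Fpoly_def Xpoly_snoc_other)

lemma spec_val_F_nz:
  assumes "\<And>v. pattern_var v \<Longrightarrow> (spec val_F w v, F_val w v) \<in> sf_values val_P"
  shows "nz (spec val_F w)"
proof
  fix v
  show "spec val_F w v \<noteq> 0"
  proof (cases "\<exists>i<n. v = vx i")
    case True
    then show ?thesis using assms[of v] sf_values_nonzero by (auto simp: pattern_var_def)
  next
    case False
    then have "spec val_F w v = val_F v" unfolding spec_def by (intro clus_other) auto
    then show ?thesis by (simp add: val_F_def)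
  qed
qed

lemma exchange_value_sf:
  assumes w: "set w \<subseteq> {..<n}" and k: "k < n"
    and rel: "\<And>v. pattern_var v \<Longrightarrow> (spec val_F w v, F_val w v) \<in> sf_values val_P"
  shows "(spec val_F (w @ [k]) (vx k),
      smul S (smul S (monS (F_val w) (pbt w k)) (Theta w k)) (sinv S (F_val w (vx k)))) \<in> sf_values val_P"
proof -
  have nzF: "nz val_F" by (simp add: val_F_def)
  have "spec val_F (w @ [k]) (vx k) = evalM (spec val_F w) (pbt w k)
      * theta_at d k (spec val_F w) (evalM (spec val_F w) (pE w k)) / spec val_F w (vx k)"
    by (simp add: spec_snoc[OF w k nzF spec_val_F_nz[OF rel]] mutV_def)
  moreover have "(evalM (spec val_F w) (pbt w k), monS (F_val w) (pbt w k)) \<in> sf_values val_P"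
    by (intro sf_values_mon rel pattern_var_pbt[OF w k])
  moreover have "(theta_at d k (spec val_F w) (evalM (spec val_F w) (pE w k)), Theta w k) \<in> sf_values val_P"
    unfolding theta_at_def Theta_def
    by (intro sf_values_sbig sf_values_mult sf_values_power sf_values_mon rel)
      (simp_all add: pattern_var_ztrop pattern_var_pE[OF w k])
  moreover have "(spec val_F w (vx k), F_val w (vx k)) \<in> sf_values val_P"
    by (intro rel) (use k in \<open>auto simp: pattern_var_def\<close>)
  ultimately show ?thesis by (simp add: sf_values_mult sf_values_divide)
qed

text \<open>The recursion is stated under \<open>rel\<close> because a value is computable only
  after F has been exhibited as subtraction-free; \<open>F_val_related\<close> provides
  \<open>rel\<close> by induction.\<close>

lemma F_val_snoc_aux:
  assumes w: "set w \<subseteq> {..<n}" and k: "k < n"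
    and rel: "\<And>v. pattern_var v \<Longrightarrow> (spec val_F w v, F_val w v) \<in> sf_values val_P"
  shows "F_val (w @ [k]) = (F_val w)(vx k := smul S (smul S (monS (F_val w) (pbt w k)) (Theta w k)) (sinv S (F_val w (vx k))))"
proof -
  have eq: "F_in_P S n d B z y (w @ [k]) k = smul S (smul S (monS (F_val w) (pbt w k)) (Theta w k)) (sinv S (F_val w (vx k)))"
    using exchange_value_sf[OF w k rel] k by (intro F_in_P_eqI) (simp add: spec_val_F)
  have "F_val (w @ [k]) = (F_val w)(vx k := F_in_P S n d B z y (w @ [k]) k)"
    unfolding F_val_def clus_upd[OF k] by (rule clus_cong) (auto simp: F_in_P_snoc_other)
  then show ?thesis by (simp only: eq)
qed

lemma F_val_related:
  assumes "set w \<subseteq> {..<n}" "pattern_var v"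
  shows "(spec val_F w v, F_val w v) \<in> sf_values val_P"
  using assms
proof (induction w arbitrary: v rule: rev_induct)
  case Nil
  show ?case
  proof (cases "\<exists>i<n. v = vx i")
    case True
    then show ?thesis by (auto simp: spec_Nil F_val_def F_in_P_Nil val_F_def sf_values_one)
  next
    case False
    then have "fst v = 1 \<or> fst v = 2" using Nil by (auto simp: pattern_var_def vy_def)
    then show ?thesis by (auto simp: spec_Nil F_val_def val_F_def intro: sf_values_gen)
  qed
next
  case (snoc k w)
  then have w: "set w \<subseteq> {..<n}" and k: "k < n" by auto
  have rel: "(spec val_F w v, F_val w v) \<in> sf_values val_P" if "pattern_var v" for v
    using snoc.IH[OF w that] .
  show ?case
  proof (cases "v = vx k")
    case True
    then show ?thesis
      using exchange_value_sf[OF w k rel] by (simp add: F_val_snoc_aux[OF w k rel])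
  next
    case False
    have "nz val_F" by (simp add: val_F_def)
    then show ?thesis
      using False rel[OF snoc.prems(2)]
      by (simp add: F_val_snoc_aux[OF w k rel] spec_snoc[OF w k _ spec_val_F_nz[OF rel]] mutV_def)
  qed
qed

lemma F_val_snoc:
  assumes "set w \<subseteq> {..<n}" "k < n"
  shows "F_val (w @ [k]) = (F_val w)(vx k := smul S (smul S (monS (F_val w) (pbt w k)) (Theta w k)) (sinv S (F_val w (vx k))))"
  using assms F_val_related by (intro F_val_snoc_aux) auto

section \<open>The seeds of the given pattern\<close>

definition "sx w = fst (seed_at S emb n d z (x, y, B) w)"
definition "sy w = fst (snd (seed_at S emb n d z (x, y, B) w))"

lemma s_Nil: "sx [] = x" "sy [] = y"
  by (simp_all add: sx_def sy_def seed_at_def)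

lemma sB: "snd (snd (seed_at S emb n d z (x, y, B) w)) = pB w"
proof (induction w rule: rev_induct)
  case (snoc k w)
  then show ?case by (simp add: p_snoc seed_at_snoc mutate_def case_prod_beta)
qed (simp add: p_Nil seed_at_def)

lemma s_snoc:
  "sx (w @ [k]) = mut_x S emb n d z k (sx w) (sy w) (pB w)"
  "sy (w @ [k]) = mut_y S d z k (sy w) (pB w)"
  using sB[of w] by (simp_all add: sx_def sy_def seed_at_snoc mutate_def case_prod_beta)

lemma monS_ztrop:
  assumes "k < n" "s \<le> d k"
  shows "monS (F_val w) (ztrop d k s) = z k s"
proof (cases "s = 0 \<or> s = d k")
  case True
  then show ?thesis using z_data assms by (auto simp: ztrop_def mutation_data_def)
next
  case False
  have "z k (min s (d k - s)) = z k s"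
    using z_data assms False by (auto simp: mutation_data_def min_def)
  then show ?thesis
    using False by (simp add: ztrop_def F_val_def vz_def val_P_def)
qed

lemma Theta_eq:
  assumes "k < n"
  shows "Theta w k = sbig S (\<lambda>s. smul S (z k s) (spow S (monS (F_val w) (pE w k)) s)) (d k)"
  unfolding Theta_def by (rule sbig_cong) (simp add: monS_ztrop assms)

text \<open>In classical terms: y_i at \<open>w\<close> is the principal, tropical y_i evaluated in
  P, times the product of the F_j to the powers b_ji.\<close>

theorem coefficient_formula:
  assumes "set w \<subseteq> {..<n}" "i < n"
  shows "sy w i = monS (F_val w) (pE w i)"
  using assms
proof (induction w arbitrary: i rule: rev_induct)
  case Nil
  have "monS (F_val []) (xmon n b) = sone S" for b
    unfolding monS_def
  proof (rule sm.neutral, rule ballI)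
    fix v assume "v \<in> Poly_Mapping.keys (xmon n b)"
    then obtain j where "j < n" "v = vx j"
      using lookup_xmon_other[of n v b] by (auto simp: in_keys_iff)
    then show "spowi S (F_val [] v) (Poly_Mapping.lookup (xmon n b) v) = sone S"
      by (simp add: F_val_def F_in_P_Nil)
  qed
  then show ?case
    using Nil by (simp add: s_Nil pE_def ecol_def p_Nil monS_add F_val_def vy_def val_P_def)
next
  case (snoc k w)
  then have w: "set w \<subseteq> {..<n}" and k: "k < n" by auto
  let ?Q = "F_val w"
  have IH: "sy w i = monS ?Q (pE w i)" if "i < n" for i using snoc.IH[OF w that] .
  show ?case
  proof (cases "i = k")
    case True
    have "monS (F_val (w @ [k])) (- pE w k) = monS ?Q (- pE w k)"
      unfolding F_val_snoc[OF w k]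
      by (rule monS_cong) (use exch_matrix_pE[OF w k k] pB_diag[OF w k] in \<open>auto simp: in_keys_iff\<close>)
    then show ?thesis
      using True k w by (simp add: s_snoc mut_y_def principal_state(4) mutE_def monS_uminus IH)
  next
    case False
    let ?b = "pB w k i" and ?e' = "pE (w @ [k]) i" and ?T = "Theta w k"
    let ?q = "smul S (smul S (monS ?Q (pbt w k)) ?T) (sinv S (?Q (vx k)))"
    have e': "?e' = pE w i + frag_cmul (int (d k) * pos ?b) (pE w k) + frag_cmul ?b (pbt w k - frag_cmul 2 (frag_of (vx k)))"
      using False k w snoc.prems by (simp add: principal_state(4) mutE_def exch_matrix_pE)
    have l: "Poly_Mapping.lookup ?e' (vx k) = - ?b"
      using k w snoc.prems exch_matrix_pE[OF w k k] pB_diag[OF w k]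
      by (simp add: e' lookup_add lookup_minus exch_matrix_pE lookup_pbt_self)
    have q: "?q = smul S (monS ?Q (pbt w k - frag_of (vx k))) ?T"
      by (simp add: monS_diff ac_simps)
    \<comment> \<open>Only the value at \<open>vx k\<close> changes, and x_k has exponent -b_ki in
      e_i'. The monomial part of the new value cancels the \<open>\<beta>\<close> and x_k terms of
      \<open>mutE\<close>, leaving \<open>Theta w k\<close> to the power -b_ki.\<close>
    have "monS (F_val (w @ [k])) ?e' = smul S (monS ?Q (?e' + frag_cmul ?b (frag_of (vx k)))) (spowi S ?q (- ?b))"
      unfolding F_val_snoc[OF w k] monS_upd l
      by (simp only: diff_conv_add_uminus minus_frag_cmul minus_minus)
    also have "\<dots> = smul S (monS ?Q (?e' + frag_cmul ?b (frag_of (vx k)) + frag_cmul (- ?b) (pbt w k - frag_of (vx k)))) (spowi S ?T (- ?b))"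
      unfolding q spowi_smul monS_cmul[symmetric] monS_add[of _ "?e' + _"] by (simp add: sm.assoc)
    also have "?e' + frag_cmul ?b (frag_of (vx k)) + frag_cmul (- ?b) (pbt w k - frag_of (vx k))
        = pE w i + frag_cmul (int (d k) * pos ?b) (pE w k)"
      unfolding e' by (rule poly_mapping_eqI) (simp add: lookup_add lookup_minus algebra_simps)
    finally show ?thesis
      using False snoc.prems k by (simp add: s_snoc mut_y_def IH Theta_eq monS_add monS_cmul sm.assoc)
  qed
qed

section \<open>Specializing the principal pattern to the given one\<close>

definition val_X :: "pvar \<Rightarrow> 'f" where
  "val_X = (\<lambda>(a, b, c). if a = 1 then yhat emb n B x y b else if a = 2 then emb (z b c) else 1)"

text \<open>The specialization taking \<open>y\<^sub>l\<close> to its value in the given pattern; the remaining variables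
  do not occur and get the value that makes the comparison with \<open>val_X\<close> uniform.\<close>
definition val_Psi :: "pvar \<Rightarrow> 'f" where
  "val_Psi v = clus n x (\<lambda>v. if fst v = 1 \<and> snd (snd v) = 0 \<and> fst (snd v) < n then emb (y (fst (snd v))) else val_X v) v"

lemma sx_nonzero: "reduced_word n w \<Longrightarrow> j < n \<Longrightarrow> sx w j \<noteq> 0"
  using cvar_nonzero by (simp add: cvar_def sx_def)

lemma x_nonzero: "j < n \<Longrightarrow> x j \<noteq> 0"
  using sx_nonzero[of "[]" j] by (simp add: s_Nil reduced_word_def)

lemma val_X_nz: "nz val_X"
  by (auto simp: val_X_def yhat_def x_nonzero split: prod.split)

lemma val_Psi_vx: "i < n \<Longrightarrow> val_Psi (vx i) = x i"
  by (simp add: val_Psi_def)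

lemma val_Psi_vy: "i < n \<Longrightarrow> val_Psi (vy i) = emb (y i)"
  by (simp add: val_Psi_def clus_def) (simp add: vy_def)

lemma val_Psi_nz: "nz val_Psi"
  using val_X_nz x_nonzero by (auto simp: val_Psi_def clus_def)

text \<open>On pattern variables the specialized cluster is the product of \<open>?U\<close>, the
  given cluster with coefficients 1, and \<open>?R\<close>, the values in P; monomials split
  accordingly. By \<open>coefficient_formula\<close> both exchange sums have the same y-hat, so the
  two new variables differ by the factor in the recursion of F.\<close>

theorem cluster_variable_formula:
  assumes "reduced_word n w" "i < n"
  shows "spec val_Psi w (vx i) = sx w i * emb (F_val w (vx i))"
  using assms
proof (induction w arbitrary: i rule: rev_induct)
  case Nil
  then show ?case by (simp add: spec_Nil val_Psi_vx s_Nil F_val_def F_in_P_Nil)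
next
  case (snoc k w)
  then have rw: "reduced_word n w" and k: "k < n" using reduced_word_snocD by auto
  then have w: "set w \<subseteq> {..<n}" by (simp add: reduced_word_set)
  let ?W = "spec val_Psi w" and ?R = "\<lambda>v. emb (F_val w v)" and ?U = "clus n (sx w) (\<lambda>_. 1)"
  have IH: "?W (vx i) = sx w i * ?R (vx i)" if "i < n" for i using snoc.IH[OF rw that] .
  have nzU: "nz ?U" using sx_nonzero[OF rw] by (simp add: clus_def)
  have nzW: "nz ?W"
  proof
    fix v show "?W v \<noteq> 0"
    proof (cases v rule: clus_cases[of n])
      case (1 i)
      then show ?thesis using IH sx_nonzero[OF rw] by simp
    next
      case 2
      then have "?W v = val_Psi v" unfolding spec_def by (intro clus_other)
      then show ?thesis using val_Psi_nz by simp
    qed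
  qed
  have factor: "?W v = ?U v * ?R v" if "pattern_var v" for v
    using that unfolding pattern_var_def
  proof (elim disjE exE conjE)
    fix i assume "i < n" "v = vx i"
    then show ?thesis using IH by simp
  next
    fix l assume l: "l < n" "v = vy l"
    then have "fst v \<noteq> 0" by (simp add: vy_def)
    then show ?thesis
      using l val_Psi_vy[OF l(1)] by (simp add: spec_def F_val_def) (simp add: vy_def val_P_def)
  next
    assume v: "fst v = 2"
    then show ?thesis
      by (simp add: spec_def F_val_def val_Psi_def val_P_def val_X_def split: prod.split) auto
  qed
  have evalW: "evalM ?W m = evalM ?U m * emb (monS (F_val w) m)"
    if "\<And>v. v \<in> Poly_Mapping.keys m \<Longrightarrow> pattern_var v" for m
    unfolding emb_monS evalM_mult_left[symmetric] by (rule evalM_cong) (simp add: factor that)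
  have coeff: "coeff_mon n (pY w k)" using principal_state(1)[OF w] k by blast
  have E: "evalM ?W (pE w k) = emb (sy w k) * (\<Prod>j<n. sx w j powi pB w j k)"
    using k evalM_clus[OF nzU coeff_monD[OF coeff]]
    by (simp add: evalW pattern_var_pE[OF w k] coefficient_formula[OF w k] pE_def ecol_def)
  have T: "Poly_Mapping.lookup (- trop_theta d k (pY w k)) (vx j) = 0" for j
    using coeff_monD[OF coeff_mon_trop_theta[OF coeff]] by simp
  have UB: "evalM ?U (pbt w k) = (\<Prod>j<n. sx w j powi pos (- pB w j k)) ^ d k"
    unfolding pbt_def pbeta_def evalM_clus[OF nzU T]
    by (simp add: power_int_mult mult.commute[of "int _"] flip: prod_power_distrib)
  have Bt: "evalM ?W (pbt w k) = (\<Prod>j<n. sx w j powi pos (- pB w j k)) ^ d k * emb (monS (F_val w) (pbt w k))"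
    by (simp add: evalW pattern_var_pbt[OF w k] UB)
  have "evalM ?U (ztrop d k s) = evalM (\<lambda>_. 1) (ztrop d k s)" for s
    by (rule evalM_cong) (metis clus_nonzero_fst in_keys_iff lookup_ztrop zero_neq_numeral)
  then have th: "theta_at d k ?W u = (\<Sum>s\<le>d k. emb (z k s) * u ^ s)" for u
    unfolding theta_at_def using k
    by (intro sum.cong) (simp_all add: evalW pattern_var_ztrop monS_ztrop)
  have Th: "sbig S (\<lambda>s. smul S (z k s) (spow S (sy w k) s)) (d k) = Theta w k"
    using k by (simp add: Theta_eq coefficient_formula[OF w])
  have W': "spec val_Psi (w @ [k]) = mutV d k (pbt w k) (pE w) ?W"
    using spec_snoc[OF w k val_Psi_nz nzW] .
  show ?case
  proof (cases "i = k")
    case True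
    have "spec val_Psi (w @ [k]) (vx k) = evalM ?W (pbt w k) * (\<Sum>s\<le>d k. emb (z k s) * evalM ?W (pE w k) ^ s) / ?W (vx k)"
      by (simp add: W' mutV_def th)
    moreover have "sx (w @ [k]) k = inverse (sx w k) * (\<Prod>j<n. sx w j powi pos (- pB w j k)) ^ d k
        * (\<Sum>s\<le>d k. emb (z k s) * evalM ?W (pE w k) ^ s) / emb (Theta w k)"
      by (simp add: s_snoc mut_x_def Let_def Th E)
    moreover have "emb (F_val (w @ [k]) (vx k)) = emb (monS (F_val w) (pbt w k)) * emb (Theta w k) / ?R (vx k)"
      by (simp add: F_val_snoc[OF w k] emb_smul emb_sinv divide_inverse)
    ultimately show ?thesis
      using True k sx_nonzero[OF rw k] by (simp add: Bt IH divide_inverse mult_ac)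
  next
    case False
    then show ?thesis
      using snoc.prems IH by (simp add: W' mutV_def F_val_snoc[OF w k] s_snoc mut_x_def)
  qed
qed

text \<open>The grading is made for this: y_l is y-hat_l times the product of the x_j to the powers
  -b_jl, which are the components of deg y_l. Passing to y-hat thus splits off x to the power deg
  m.\<close>

lemma evalM_val_Psi: "evalM val_Psi m = (\<Prod>j<n. x j powi mdeg n B m j) * evalM val_X m"
proof (induction m rule: lpoly_induct)
  case zero
  show ?case by (simp add: mdeg_zero)
next
  case (of v)
  show ?case
  proof (cases "(\<exists>i<n. v = vx i) \<or> (\<exists>l<n. v = vy l)")
    case True
    then show ?thesis
    proof (elim disjE exE conjE)
      fix i assume i: "i < n" "v = vx i"
      have "(\<Prod>j<n. x j powi mdeg n B (frag_of v) j) = (\<Prod>j<n. if j = i then x j else 1)"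
        using i by (intro prod.cong) (auto simp: mdeg_def lookup_single when_def vx_neq_vy[symmetric])
      then show ?thesis using i by (simp add: val_Psi_vx val_X_def) (simp add: vx_def)
    next
      fix l assume l: "l < n" "v = vy l"
      have "mdeg n B (frag_of v) j = - B j l" for j
        using l by (simp add: mdeg_def lookup_single when_def if_distrib[of "(*) _"] vx_neq_vy[symmetric] cong: if_cong)
      then have "(\<Prod>j<n. x j powi mdeg n B (frag_of v) j) = inverse (\<Prod>j<n. x j powi B j l)"
        by (simp add: power_int_minus_divide prod_dividef inverse_eq_divide)
      moreover have "val_X (vy l) = emb (y l) * (\<Prod>j<n. x j powi B j l)"
        by (simp add: val_X_def yhat_def vy_def)
      moreover have "(\<Prod>j<n. x j powi B j l) \<noteq> 0"
        by (simp add: x_nonzero)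
      ultimately show ?thesis
        using l by (simp add: val_Psi_vy)
    qed
  next
    case False
    then have "mdeg n B (frag_of v) j = 0" if "j < n" for j
      using that by (auto simp: mdeg_def lookup_single when_def intro!: sum.neutral)
    moreover have "val_Psi v = val_X v"
      using False by (cases v) (auto simp: val_Psi_def clus_def vx_def vy_def)
    ultimately show ?thesis by simp
  qed
next
  case (diff a b)
  have "mdeg n B (a - b) j = mdeg n B a j - mdeg n B b j" for j
    using mdeg_add[of "a - b" b j] by simp
  then have "(\<Prod>j<n. x j powi mdeg n B (a - b) j) = (\<Prod>j<n. x j powi mdeg n B a j) / (\<Prod>j<n. x j powi mdeg n B b j)"
    by (simp add: power_int_diff x_nonzero flip: prod_dividef)
  then show ?case
    using diff by (simp add: evalM_diff[OF val_Psi_nz] evalM_diff[OF val_X_nz])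
qed

theorem separation_formula:
  assumes "reduced_word n w" "i < n"
  shows "cvar S emb n d z (x, y, B) w i
    = (\<Prod>j<n. x j powi gmat n d B w j i) * F_in_F emb n d B z x y w i / emb (F_in_P S n d B z y w i)"
proof -
  have w: "set w \<subseteq> {..<n}" using assms(1) by (rule reduced_word_set)
  let ?p = "Xpoly n d B w i"
  have "evalL ?p val_Psi = (\<Sum>m\<in>Poly_Mapping.keys ?p. of_int (Poly_Mapping.lookup ?p m) * ((\<Prod>j<n. x j powi gmat n d B w j i) * evalM val_X m))"
    unfolding evalL_evalM
    by (intro sum.cong refl) (simp add: evalM_val_Psi mdeg_gmat[OF w assms(2)])
  also have "\<dots> = (\<Prod>j<n. x j powi gmat n d B w j i) * evalL ?p val_X"
    unfolding evalL_evalM sum_distrib_left by (simp add: mult_ac)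
  also have "evalL ?p val_X = F_in_F emb n d B z x y w i"
    unfolding F_in_F_def val_X_def ..
  finally have "sx w i * emb (F_in_P S n d B z y w i) = (\<Prod>j<n. x j powi gmat n d B w j i) * F_in_F emb n d B z x y w i"
    using cluster_variable_formula[OF assms] assms(2) by (simp add: spec_vx F_val_def)
  then show ?thesis by (simp add: cvar_def sx_def eq_divide_eq)
qed

end

theorem mainTheorem18:
  fixes S :: "'p semifield_ops" and emb :: "'p \<Rightarrow> 'f::field"
    and n :: nat and d :: "nat \<Rightarrow> nat" and z :: "nat \<Rightarrow> nat \<Rightarrow> 'p"
    and x :: "nat \<Rightarrow> 'f" and y :: "nat \<Rightarrow> 'p" and B :: "nat \<Rightarrow> nat \<Rightarrow> int"
  assumes "semifield S"
    and "semifield_hom S emb"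
    and "mutation_data S n d z"
    and "skew_symmetrizable n B"
    and "\<forall>w j. reduced_word n w \<and> j < n \<longrightarrow> cvar S emb n d z (x, y, B) w j \<noteq> 0"
  shows "\<forall>w i. reduced_word n w \<and> i < n \<longrightarrow>
           cvar S emb n d z (x, y, B) w i =
             (\<Prod>j<n. x j powi gmat n d B w j i)
             * F_in_F emb n d B z x y w i / emb (F_in_P S n d B z y w i)"
proof -
  interpret separation n d B S emb z x y
    using assms by unfold_locales (auto simp: mutation_data_def)
  show ?thesis using separation_formula by blast
qed

end
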